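(* Let $p\in[1,2]$, let $Q\subseteq\mathbb{R}^d$ be convex, let $\varepsilon>0$, and set $\gamma=\varepsilon/(2M_2)$. Let $f$ be convex on $Q_\gamma=Q+B_2^d(\gamma)$, $M$-Lipschitz on $Q_\gamma$ with respect to $\|\cdot\|_p$ and $M_2$-Lipschitz on $Q_\gamma$ with respect to $\|\cdot\|_2$. Consider the (possibly non-smooth) problem $\min_{x\in Q}f(x)$, accessed only through a zeroth-order oracle with sufficiently small noise level $\Delta$. If $p=1$, assume in addition $\varepsilon\lesssim d^{-1/4}M_2^{3/2}R/M^{1/2}$. Then the Smoothing scheme based on the batched Accelerated gradient method is a gradient-free method that produces a random point $\hat x\in Q$ with $\mathbb{E}f(\hat x)-f(x_* )\le\varepsilon$ using $$O\left(\frac{d^{1/4}\sqrt{MM_2}\,R}{\varepsilon}\right)$$ successive iterations and $$\tilde O\left(\frac{\kappa(p,d)\,d\,M_2^2R^2}{\varepsilon^2}\right)=\begin{cases}\tilde O\left(\dfrac{d\,M_2^2R^2}{\varepsilon^2}\right), & p=2,\\[2mm] \tilde O\left(\dfrac{(\ln d)\,M_2^2R^2}{\varepsilon^2}\right), & p=1,\end{cases}$$ zeroth-order oracle calls in total.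
   Context: Notation. $B_2^d(\gamma)$ is the Euclidean ball of radius $\gamma$ centered at $0$ in $\mathbb{R}^d$; $q$ is defined by $1/p+1/q=1$; $x^0$ is the starting point, $x_*$ is the solution of $\min_{x\in Q}f(x)$ closest to $x^0$ (assumed to exist), and $R=O(\|x^0-x_*\|_p\ln d)$. $\kappa(p,d)=O\big(\sqrt{\mathbb{E}_e\|e\|_q^4}\big)=O(\min\{q,\ln d\}\,d^{2/q-1})$, where $e$ is uniform on the Euclidean unit sphere; thus $\kappa(2,d)=O(1)$ and $\kappa(1,d)=O((\ln d)/d)$. $\tilde O(\cdot)$ hides logarithmic factors; $\lesssim$ hides numerical constants. Zeroth-order oracle: at a requested point $x\in Q_\gamma$ it returns the value $f(x)$ up to an error bounded in absolute value by $\Delta$. For simplicity the error is taken to be random with zero mean, so that the gradient estimate below is unbiased. "Sufficiently small $\Delta$" means that the estimate below satisfies $\mathbb{E}_e\|\nabla f_\gamma(x,e)\|_q^2\le 2\kappa(p,d)\,d\,M_2^2$. Smoothed objective: $f_\gamma(x)=\mathbb{E}_u f(x+u)$ with $u$ uniform on $B_2^d(\gamma)$. Stochastic gradient of $f_\gamma$: $\nabla f_\gamma(x,e)=d\,\frac{f(x+\gamma e)-f(x-\gamma e)}{2\gamma}\,e$ with $e$ uniform on the Euclidean unit sphere and with $f$ denoting the oracle's returned values (two oracle calls per estimate). Batched Accelerated gradient method: a stochastic first-order method for minimizing over $Q$ a convex function $g$ whose gradient satisfies $\|\nabla g(y)-\nabla g(x)\|_q\le L\|y-x\|_p$, using unbiased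 stochastic gradients with $\mathbb{E}\|\nabla_x g(x,\eta)-\nabla g(x)\|_q^2\le\sigma^2$. It reaches expected suboptimality $\varepsilon$ in $N=O(\sqrt{LR^2/\varepsilon})$ successive iterations with $T=\tilde O(\max\{N,\sigma^2R^2/\varepsilon^2\})$ stochastic gradients in total; the stochastic gradients of one iteration form a batch, computed at the same point independently and in parallel, and averaged. Smoothing scheme: run this method on $\min_{x\in Q}f_\gamma(x)$ with stochastic gradients $\nabla f_\gamma(x,e)$, $\gamma=\varepsilon/(2M_2)$, to accuracy $\varepsilon/2$. A "successive iteration" is one iteration of the method; all oracle calls within one iteration's batch can be made in parallel.
   Formalization: For 1<p<4/3 the bound Õ(κ(p,d)dM_2²R²/ε²) is shown if ε ≲ κ(p,d)d^{3/4}M_2^{3/2}R/M^{1/2}, else Õ of the larger of it and the iteration bound; as printed it fails (f=|x_1|, p near 1, ε=1/2). Bounds are read as max{1,·} and ln d as max{1,ln d}. *)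

theory Defs
  imports "HOL-Probability.Probability"
begin

definition lp_norm :: "ereal \<Rightarrow> real ^ 'n::finite \<Rightarrow> real" where
  "lp_norm r x =
     (if r = \<infinity> then infnorm x
      else (\<Sum>i\<in>UNIV. \<bar>x $ i\<bar> powr real_of_ereal r) powr (1 / real_of_ereal r))"

text \<open>The exponent q with 1/p + 1/q = 1, for p at least 1.\<close>
definition conj_exponent :: "real \<Rightarrow> ereal" where
  "conj_exponent p = (if p = 1 then \<infinity> else ereal (p / (p - 1)))"

text \<open>The factor ln d, with value 1 for d = 1 and d = 2 so that d = 1 is not degenerate.\<close>
definition ln_dim :: "'n::finite itself \<Rightarrow> real" where
  "ln_dim _ = max 1 (ln (real CARD('n)))"

text \<open>
  Both measures live on the ball, respectively the sphere, itself and not on the whole space: the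
  objective is only constrained on a neighbourhood of Q, so nothing may depend on the
  measurability of integrands elsewhere. The uniform distribution on the sphere is the radial
  projection of the uniform distribution on the ball.
\<close>

definition unif_ball :: "real \<Rightarrow> (real ^ 'n::finite) measure" where
  "unif_ball \<gamma> = uniform_measure (restrict_space lborel (cball 0 \<gamma>)) (cball 0 \<gamma>)"

definition unif_sphere :: "(real ^ 'n::finite) measure" where
  "unif_sphere = restrict_space (distr (unif_ball 1) borel sgn) (sphere 0 1)"

text \<open>c is the numerical constant in kappa(p,d) = O(sqrt(E |e|_q^4)).\<close>
definition kappa :: "'n::finite itself \<Rightarrow> real \<Rightarrow> real \<Rightarrow> real" where
  "kappa _ c p =
     c * sqrt (\<integral>e. lp_norm (conj_exponent p) e ^ 4 \<partial>(unif_sphere :: (real ^ 'n) measure))"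

text \<open>
  In iteration k the method asks for batch k stochastic gradients at the single point query k h,
  where h lists the averaged gradients of the iterations before k (and is 0 from k on). The method
  sees the objective only through these averages.
\<close>

record 'v batched_method =
  iters :: nat
  batch :: "nat \<Rightarrow> nat"
  query :: "nat \<Rightarrow> (nat \<Rightarrow> 'v) \<Rightarrow> 'v"
  out_point :: "(nat \<Rightarrow> 'v) \<Rightarrow> 'v"

definition wf_method ::
  "('v::euclidean_space) set \<Rightarrow> 'v batched_method \<Rightarrow> bool" where
  "wf_method Q m \<longleftrightarrow>
     (\<forall>k<iters m. 1 \<le> batch m k) \<and>
     (\<forall>k h. query m k h \<in> Q) \<and>
     (\<forall>k. query m k \<in> borel_measurable (PiM UNIV (\<lambda>_. borel))) \<and>
     (\<forall>h. out_point m h \<in> Q) \<and>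
     out_point m \<in> borel_measurable (PiM UNIV (\<lambda>_. borel))"

definition num_samples :: "'v batched_method \<Rightarrow> nat" where
  "num_samples m = (\<Sum>k<iters m. batch m k)"

text \<open>The averaged gradients of the first k iterations; sample (k, j) is the j-th one of batch k.\<close>
primrec history ::
  "('v::euclidean_space) batched_method \<Rightarrow> ('v \<Rightarrow> 'w \<Rightarrow> 'v) \<Rightarrow> (nat \<times> nat \<Rightarrow> 'w) \<Rightarrow> nat \<Rightarrow> nat \<Rightarrow> 'v"
where
  "history m G \<omega> 0 = (\<lambda>_. 0)"
| "history m G \<omega> (Suc k) = (history m G \<omega> k)
     (k := (1 / real (batch m k)) *\<^sub>R
             (\<Sum>j<batch m k. G (query m k (history m G \<omega> k)) (\<omega> (k, j))))"

definition run_method ::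
  "('v::euclidean_space) batched_method \<Rightarrow> ('v \<Rightarrow> 'w \<Rightarrow> 'v) \<Rightarrow> (nat \<times> nat \<Rightarrow> 'w) \<Rightarrow> 'v" where
  "run_method m G \<omega> = out_point m (history m G \<omega> (iters m))"

definition sample_space :: "'w measure \<Rightarrow> (nat \<times> nat \<Rightarrow> 'w) measure" where
  "sample_space D = PiM UNIV (\<lambda>_. D)"

text \<open>
  The gradient is taken within Q, since the objective may be uncontrolled outside Q and Q may have
  empty interior.
\<close>
definition smooth_convex_on ::
  "real \<Rightarrow> real \<Rightarrow> (real ^ 'n::finite) set \<Rightarrow> (real ^ 'n \<Rightarrow> real) \<Rightarrow> (real ^ 'n \<Rightarrow> real ^ 'n) \<Rightarrow> bool"
where
  "smooth_convex_on p L Q g grad \<longleftrightarrow>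
     convex_on Q g \<and>
     (\<forall>x\<in>Q. (g has_derivative (\<lambda>h. grad x \<bullet> h)) (at x within Q)) \<and>
     (\<forall>x\<in>Q. \<forall>y\<in>Q. lp_norm (conj_exponent p) (grad y - grad x) \<le> L * lp_norm p (y - x))"

definition stochastic_gradient ::
  "real \<Rightarrow> real \<Rightarrow> (real ^ 'n::finite) set \<Rightarrow> (real ^ 'n \<Rightarrow> real ^ 'n)
     \<Rightarrow> 'w measure \<Rightarrow> (real ^ 'n \<Rightarrow> 'w \<Rightarrow> real ^ 'n) \<Rightarrow> bool"
where
  "stochastic_gradient p \<sigma> Q grad D G \<longleftrightarrow>
     prob_space D \<and>
     case_prod G \<in> borel_measurable (restrict_space borel Q \<Otimes>\<^sub>M D) \<and>
     (\<forall>x\<in>Q. integrable D (G x) \<and> (\<integral>\<eta>. G x \<eta> \<partial>D) = grad x) \<and>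
     (\<forall>x\<in>Q. integrable D (\<lambda>\<eta>. (lp_norm (conj_exponent p) (G x \<eta> - grad x))\<^sup>2) \<and>
            (\<integral>\<eta>. (lp_norm (conj_exponent p) (G x \<eta> - grad x))\<^sup>2 \<partial>D) \<le> \<sigma>\<^sup>2)"

text \<open>
  The expression under a soft-O: h times logarithmic factors in the dimension d and in h itself.
\<close>
definition soft :: "nat \<Rightarrow> real \<Rightarrow> real \<Rightarrow> real" where
  "soft a d h = h * (1 + ln d) ^ a * (1 + ln (1 + h)) ^ a"

text \<open>
  A x0 L \<sigma> R \<epsilon> is the method set up for the starting point x0, the smoothness constant L, the
  variance bound \<open>\<sigma>\<^sup>2\<close>, the distance parameter R and the target accuracy \<epsilon>. CN, CT, cR and a
  are the constants hidden in N = O(...), T = soft-O(...) and R = O(...). The method is run on the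
  smoothed objective, whereas R refers to a solution of the original problem; the suboptimality is
  therefore measured against the point z in Q that R refers to, and z need not minimize g.

  The sample type cannot be quantified inside the formula, hence the type argument.
\<close>
definition batched_agm ::
  "'w itself \<Rightarrow> real \<Rightarrow> real \<Rightarrow> real \<Rightarrow> nat \<Rightarrow> real \<Rightarrow> (real ^ 'n::finite) set
    \<Rightarrow> (real ^ 'n \<Rightarrow> real \<Rightarrow> real \<Rightarrow> real \<Rightarrow> real \<Rightarrow> (real ^ 'n) batched_method) \<Rightarrow> bool"
where
  "batched_agm _ CN CT cR a p Q A \<longleftrightarrow>
     (\<forall>x0\<in>Q. \<forall>L>0. \<forall>\<sigma>\<ge>0. \<forall>R\<ge>0. \<forall>\<epsilon>>0.
        wf_method Q (A x0 L \<sigma> R \<epsilon>) \<and>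
        real (iters (A x0 L \<sigma> R \<epsilon>)) \<le> CN * max 1 (sqrt (L * R\<^sup>2 / \<epsilon>)) \<and>
        real (num_samples (A x0 L \<sigma> R \<epsilon>)) \<le>
          CT * soft a (real CARD('n)) (max (real (iters (A x0 L \<sigma> R \<epsilon>))) (\<sigma>\<^sup>2 * R\<^sup>2 / \<epsilon>\<^sup>2)) \<and>
        (\<forall>g grad z (D :: 'w measure) G.
           smooth_convex_on p L Q g grad \<and> stochastic_gradient p \<sigma> Q grad D G \<and>
           z \<in> Q \<and> R = cR * lp_norm p (x0 - z) * ln_dim TYPE('n) \<longrightarrow>
           integrable (sample_space D) (\<lambda>\<omega>. g (run_method (A x0 L \<sigma> R \<epsilon>) G \<omega>)) \<and>
           (\<integral>\<omega>. g (run_method (A x0 L \<sigma> R \<epsilon>) G \<omega>) \<partial>sample_space D) - g z \<le> \<epsilon>))"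

definition enlargement :: "(real ^ 'n::finite) set \<Rightarrow> real \<Rightarrow> (real ^ 'n) set" where
  "enlargement Q \<gamma> = {x + u | x u. x \<in> Q \<and> u \<in> cball 0 \<gamma>}"

text \<open>F x \<xi> is the value returned at x; a fresh \<xi> is drawn from W at every call.\<close>
definition zeroth_order_oracle ::
  "(real ^ 'n::finite) set \<Rightarrow> (real ^ 'n \<Rightarrow> real) \<Rightarrow> real \<Rightarrow> 'o measure \<Rightarrow> (real ^ 'n \<Rightarrow> 'o \<Rightarrow> real) \<Rightarrow> bool"
where
  "zeroth_order_oracle X f \<Delta> W F \<longleftrightarrow>
     prob_space W \<and>
     case_prod F \<in> borel_measurable (restrict_space borel X \<Otimes>\<^sub>M W) \<and>
     (\<forall>x\<in>X. \<forall>\<xi>\<in>space W. \<bar>F x \<xi> - f x\<bar> \<le> \<Delta>) \<and>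
     (\<forall>x\<in>X. (\<integral>\<xi>. F x \<xi> \<partial>W) = f x)"

text \<open>The random input of one gradient estimate: a direction and the noise of its two calls.\<close>
definition estimate_space :: "'o measure \<Rightarrow> ((real ^ 'n::finite) \<times> 'o \<times> 'o) measure" where
  "estimate_space W = unif_sphere \<Otimes>\<^sub>M (W \<Otimes>\<^sub>M W)"

definition grad_estimate ::
  "(real ^ 'n::finite \<Rightarrow> 'o \<Rightarrow> real) \<Rightarrow> real \<Rightarrow> real ^ 'n \<Rightarrow> (real ^ 'n) \<times> 'o \<times> 'o \<Rightarrow> real ^ 'n"
where
  "grad_estimate F \<gamma> x = (\<lambda>(e, \<xi>1, \<xi>2).
     (real CARD('n) * ((F (x + \<gamma> *\<^sub>R e) \<xi>1 - F (x - \<gamma> *\<^sub>R e) \<xi>2) / (2 * \<gamma>))) *\<^sub>R e)"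

definition smoothed :: "(real ^ 'n::finite \<Rightarrow> real) \<Rightarrow> real \<Rightarrow> real ^ 'n \<Rightarrow> real" where
  "smoothed f \<gamma> x = (\<integral>u. f (x + u) \<partial>unif_ball \<gamma>)"

definition small_noise ::
  "real \<Rightarrow> real \<Rightarrow> real \<Rightarrow> real \<Rightarrow> (real ^ 'n::finite) set \<Rightarrow> 'o measure \<Rightarrow> (real ^ 'n \<Rightarrow> 'o \<Rightarrow> real) \<Rightarrow> bool"
where
  "small_noise c p M2 \<gamma> Q W F \<longleftrightarrow>
     (\<forall>x\<in>Q. (\<integral>\<eta>. (lp_norm (conj_exponent p) (grad_estimate F \<gamma> x \<eta>))\<^sup>2 \<partial>estimate_space W)
              \<le> 2 * kappa TYPE('n) c p * real CARD('n) * M2\<^sup>2)"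

text \<open>
  The method set up for the smoothed objective with accuracy \<epsilon>/2. The gradient of the smoothed
  objective has constant sqrt(d) M / \<gamma>; since the 2-norm is at most the p-norm, M2 is a Lipschitz
  constant for the p-norm as well and M may be replaced by min M M2. The variance bound follows
  from the second moment bound 2 \<kappa> d M2^2 and the triangle inequality.
\<close>
definition smoothing_scheme ::
  "(real ^ 'n::finite \<Rightarrow> real \<Rightarrow> real \<Rightarrow> real \<Rightarrow> real \<Rightarrow> (real ^ 'n) batched_method)
    \<Rightarrow> real \<Rightarrow> real \<Rightarrow> real \<Rightarrow> real \<Rightarrow> real \<Rightarrow> real \<Rightarrow> real \<Rightarrow> real ^ 'n \<Rightarrow> (real ^ 'n) batched_method"
where
  "smoothing_scheme A c p M M2 R \<gamma> \<epsilon> x0 =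
     A x0 (sqrt (real CARD('n)) * min M M2 / \<gamma>)
          (sqrt (8 * kappa TYPE('n) c p * real CARD('n) * M2\<^sup>2)) R (\<epsilon> / 2)"

text \<open>Each gradient estimate queries two function values.\<close>
definition oracle_calls :: "'v batched_method \<Rightarrow> nat" where
  "oracle_calls m = 2 * num_samples m"

definition iter_bound :: "'n::finite itself \<Rightarrow> real \<Rightarrow> real \<Rightarrow> real \<Rightarrow> real \<Rightarrow> real" where
  "iter_bound _ M M2 R \<epsilon> = real CARD('n) powr (1 / 4) * sqrt (M * M2) * R / \<epsilon>"

definition call_bound :: "'n::finite itself \<Rightarrow> real \<Rightarrow> real \<Rightarrow> real \<Rightarrow> real \<Rightarrow> real \<Rightarrow> real" where
  "call_bound _ c p M2 R \<epsilon> = kappa TYPE('n) c p * real CARD('n) * M2\<^sup>2 * R\<^sup>2 / \<epsilon>\<^sup>2"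

text \<open>
  The constant in the bound on the number of function evaluations. It is given explicitly because a constant chosen
  existentially for a fixed type could depend on the dimension.
\<close>
definition scale_const :: "real \<Rightarrow> real \<Rightarrow> real \<Rightarrow> real" where
  "scale_const CN c c0 = 1000 * (1 + CN) * (1 + c) * (1 + 1 / c) * (1 + c0)"

definition call_const :: "real \<Rightarrow> real \<Rightarrow> nat \<Rightarrow> real \<Rightarrow> real \<Rightarrow> real" where
  "call_const CN CT a c c0 = 2 * CT * scale_const CN c c0 * (1 + ln (scale_const CN c c0)) ^ a"

end

theory Submission
  imports Defs
begin

text \<open>
  Why the theorem holds. The scheme runs a first-order method on the ball average \<open>f\<^sub>\<gamma>\<close>, so three
  things have to be known about \<open>f\<^sub>\<gamma>\<close>: it is close to f, it is smooth with a controlled constant, and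
  the two-point estimate is an unbiased gradient with controlled variance.

  Closeness is Jensen's inequality and the Lipschitz bound: \<open>f \<le> f\<^sub>\<gamma> \<le> f + M2 \<gamma>\<close> on Q
  (\<open>smoothed_bounds\<close>), and \<open>M2 \<gamma> = \<epsilon>/2\<close> by the choice of \<open>\<gamma>\<close>.

  For smoothness, the gradient of \<open>f\<^sub>\<gamma>\<close> at x is \<open>(d/\<gamma>)\<close> times the mean of \<open>f (x + \<gamma> e) e\<close> over the unit
  sphere (\<open>smoothed_has_derivative\<close>, a form of the divergence theorem for Lipschitz functions).
  The difference D of two such gradients is tested against itself: f changes by at most
  \<open>min M M2 * \<parallel>y - x\<parallel>\<^sub>p\<close>, and \<open>\<bar>e \<bullet> D\<bar>\<close> has mean at most \<open>\<parallel>D\<parallel> / sqrt d\<close>. Hence the Euclidean norm of D,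
  and with it the q-norm, is at most \<open>sqrt d * min M M2 / \<gamma> * \<parallel>y - x\<parallel>\<^sub>p\<close>
  (\<open>norm_sphere_gradient_diff_le\<close>).

  The estimate is unbiased for this sphere average by Fubini and the symmetry of the sphere, and its
  variance is at most four times its second moment (\<open>grad_estimate_stochastic_gradient\<close>). The
  guarantee of the method then applies with the solution of the original problem as comparison point.

  It remains to count. Inserting the smoothness constant and the variance bound into the guarantee
  gives at most \<open>CN * max 1 (2 N)\<close> iterations, and a number of samples governed by the larger of the
  iteration count and \<open>32 K\<close>, where N and K are the iteration and call bounds of the statement. N
  is absorbed by K in each regime for its own reason: for \<open>p \<ge> 4/3\<close> because kappa is at least of order
  \<open>1 / sqrt d\<close> and the constant \<open>min M M2\<close> may be used, and for smaller p because of the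
  condition on the accuracy. For \<open>p = 1\<close> the size of kappa is needed as well
  (\<open>kappa_le_p1\<close>): the maximal coordinate of a random direction is estimated through moments of order
  about \<open>2 ln d\<close>, and these come from applying the formula for the gradient of a ball average to the
  monomials \<open>u\<^sub>i ^ (2 k + 1)\<close>, which is an integration by parts on the ball
  (\<open>sphere_moment_recursion\<close>).
\<close>

section \<open>The p-norm and its dual norm\<close>

lemma lp_norm_ereal:
  "lp_norm (ereal r) x = (\<Sum>i\<in>UNIV. \<bar>x $ i\<bar> powr r) powr (1 / r)"
  by (simp add: lp_norm_def)

lemma lp_norm_nonneg: "0 \<le> lp_norm r x"
  by (auto simp: lp_norm_def infnorm_pos_le)

lemma lp_norm_uminus: "lp_norm r (- x) = lp_norm r x"
  by (simp add: lp_norm_def infnorm_neg)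

lemma lp_norm_2: "lp_norm (ereal 2) x = norm x"
proof -
  have "lp_norm (ereal 2) x = sqrt (\<Sum>i\<in>UNIV. (x $ i)\<^sup>2)"
    by (simp add: lp_norm_ereal powr_half_sqrt sum_nonneg)
  then show ?thesis
    by (simp add: norm_vec_def L2_set_def)
qed

text \<open>
  Coordinates are at most \<open>A = \<parallel>x\<parallel>\<^sub>r\<close>, so \<open>\<bar>x\<^sub>i\<bar> powr s\<close> is at most
  \<open>\<bar>x\<^sub>i\<bar> powr r * A powr (s - r)\<close>, and summing gives \<open>A powr s\<close>. This is how the Euclidean norm gets
  squeezed between the q-norm and the p-norm.
\<close>
lemma lp_norm_antimono:
  fixes x :: "real ^ 'n::finite"
  assumes "0 < r" "r \<le> s"
  shows "lp_norm (ereal s) x \<le> lp_norm (ereal r) x"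
proof -
  let ?S = "\<Sum>i\<in>UNIV. \<bar>x $ i\<bar> powr r"
  have S0: "0 \<le> ?S" by (intro sum_nonneg) auto
  show ?thesis
  proof (cases "?S = 0")
    case True
    then have "\<And>i. x $ i = 0"
      using assms by (subst (asm) sum_nonneg_eq_0_iff) auto
    then show ?thesis
      using assms by (simp add: lp_norm_ereal)
  next
    case False
    define A where "A = ?S powr (1 / r)"
    have A: "0 < A" using False S0 by (auto simp: A_def)
    have Ar: "A powr r = ?S" unfolding A_def powr_powr using assms S0 False by simp
    have le: "\<bar>x $ i\<bar> \<le> A" for i
    proof -
      have "\<bar>x $ i\<bar> powr r \<le> ?S" by (rule member_le_sum) auto
      then have "\<bar>x $ i\<bar> powr r \<le> A powr r" by (simp add: Ar)
      then show ?thesis using assms A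
        by (meson abs_ge_zero less_eq_real_def powr_less_mono2 not_le)
    qed
    have "\<bar>x $ i\<bar> powr s \<le> \<bar>x $ i\<bar> powr r * A powr (s - r)" for i
    proof -
      have "\<bar>x $ i\<bar> powr s = \<bar>x $ i\<bar> powr r * \<bar>x $ i\<bar> powr (s - r)"
        by (simp flip: powr_add)
      also have "\<dots> \<le> \<bar>x $ i\<bar> powr r * A powr (s - r)"
        using le[of i] assms A by (intro mult_left_mono powr_mono2) auto
      finally show ?thesis .
    qed
    then have "(\<Sum>i\<in>UNIV. \<bar>x $ i\<bar> powr s) \<le> (\<Sum>i\<in>UNIV. \<bar>x $ i\<bar> powr r * A powr (s - r))"
      by (intro sum_mono)
    also have "\<dots> = A powr r * A powr (s - r)"
      by (simp add: Ar sum_distrib_right)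
    also have "\<dots> = A powr s" by (simp flip: powr_add)
    finally have "(\<Sum>i\<in>UNIV. \<bar>x $ i\<bar> powr s) powr (1 / s) \<le> (A powr s) powr (1 / s)"
      using assms by (intro powr_mono2 sum_nonneg) auto
    also have "\<dots> = A" using assms A by (simp add: powr_powr)
    finally show ?thesis by (simp add: lp_norm_ereal A_def)
  qed
qed

lemma norm_le_lp_norm:
  assumes "1 \<le> p" "p \<le> 2"
  shows "norm x \<le> lp_norm (ereal p) x"
  using lp_norm_antimono[of p 2 x] assms lp_norm_2[of x] by simp

lemma conj_exponent_gt_1:
  assumes "1 < p"
  shows "conj_exponent p = ereal (p / (p - 1))" "1 < p / (p - 1)"
  using assms by (auto simp: conj_exponent_def)

lemma conj_exponent_2: "conj_exponent 2 = ereal 2"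
  by (simp add: conj_exponent_def)

lemma lp_norm_conj_le_norm:
  assumes "1 \<le> p" "p \<le> 2"
  shows "lp_norm (conj_exponent p) x \<le> norm x"
proof (cases "p = 1")
  case True
  then show ?thesis by (simp add: lp_norm_def conj_exponent_def infnorm_le_norm)
next
  case False
  then have "2 \<le> p / (p - 1)" using assms by (simp add: field_simps)
  with lp_norm_antimono[of 2 "p / (p - 1)" x] lp_norm_2[of x] False show ?thesis
    by (simp add: conj_exponent_def)
qed

text \<open>
  A norm is the supremum of the linear functionals below it, and the supremum is attained. The
  explicit functional is the normalized duality map \<open>sgn x\<^sub>i * \<bar>x\<^sub>i\<bar> powr (r - 1)\<close>, and Young's
  inequality, summed over the coordinates, shows that it stays below the norm. The triangle
  inequality and Jensen's inequality for the q-norm both follow by testing with such a functional.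
\<close>
lemma lp_norm_support_functional:
  fixes x :: "real ^ 'n::finite"
  assumes "1 < r"
  shows "\<exists>w. x \<bullet> w = lp_norm (ereal r) x \<and> (\<forall>y. y \<bullet> w \<le> lp_norm (ereal r) y)"
proof (cases "lp_norm (ereal r) x = 0")
  case True
  then show ?thesis by (intro exI[of _ 0]) (simp add: lp_norm_nonneg)
next
  case False
  define N where "N = (\<lambda>y :: real ^ 'n. lp_norm (ereal r) y)"
  have N: "N y = (\<Sum>i\<in>UNIV. \<bar>y $ i\<bar> powr r) powr (1 / r)" for y
    by (simp add: N_def lp_norm_ereal)
  have Nr: "N y powr r = (\<Sum>i\<in>UNIV. \<bar>y $ i\<bar> powr r)" for y
    unfolding N powr_powr using assms by (simp add: sum_nonneg)
  have Nx: "0 < N x" using False lp_norm_nonneg[of "ereal r" x] by (simp add: N_def)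
  define w :: "real ^ 'n" where "w = (\<chi> i. sgn (x $ i) * \<bar>x $ i\<bar> powr (r - 1) / N x powr (r - 1))"
  have absw: "\<bar>w $ i\<bar> = (\<bar>x $ i\<bar> / N x) powr (r - 1)" for i
    using Nx by (simp add: w_def abs_mult powr_divide abs_sgn_eq)
  have "x $ i * w $ i = \<bar>x $ i\<bar> powr r / N x powr (r - 1)" for i
  proof (cases "x $ i = 0")
    case False
    have "x $ i * w $ i = \<bar>x $ i\<bar> * \<bar>x $ i\<bar> powr (r - 1) / N x powr (r - 1)"
      by (simp add: w_def sgn_real_def)
    also have "\<bar>x $ i\<bar> * \<bar>x $ i\<bar> powr (r - 1) = \<bar>x $ i\<bar> powr r"
      using False by (simp add: powr_mult_base)
    finally show ?thesis .
  qed (simp add: w_def)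
  then have "x \<bullet> w = N x powr r / N x powr (r - 1)"
    by (simp add: inner_vec_def Nr sum_divide_distrib)
  also have "\<dots> = N x" using Nx by (simp flip: powr_diff)
  finally have eq: "x \<bullet> w = N x" .
  have "y \<bullet> w \<le> N y" for y
  proof (cases "N y = 0")
    case True
    then have "(\<Sum>i\<in>UNIV. \<bar>y $ i\<bar> powr r) = 0" using Nr[of y] by simp
    then have "\<And>i. y $ i = 0" by (subst (asm) sum_nonneg_eq_0_iff) auto
    then have "y = 0" by (simp add: vec_eq_iff)
    then show ?thesis using True by simp
  next
    case False
    then have Ny: "0 < N y" by (simp add: N)
    define s where "s = r / (r - 1)"
    have rs: "1 / r + 1 / s = 1" "1 < s" using assms by (auto simp: s_def field_simps)
    have young: "(y $ i / N y) * w $ i \<le> \<bar>y $ i\<bar> powr r / N y powr r / r + \<bar>x $ i\<bar> powr r / N x powr r / s" for i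
    proof -
      have "(y $ i / N y) * w $ i \<le> (\<bar>y $ i\<bar> / N y) * (\<bar>x $ i\<bar> / N x) powr (r - 1)"
        using Ny by (metis abs_divide abs_ge_self abs_mult absw abs_of_pos)
      also have "\<dots> \<le> (\<bar>y $ i\<bar> / N y) powr r / r + ((\<bar>x $ i\<bar> / N x) powr (r - 1)) powr s / s"
        using Ny Nx rs assms by (intro Youngs_inequality) auto
      also have "((\<bar>x $ i\<bar> / N x) powr (r - 1)) powr s = (\<bar>x $ i\<bar> / N x) powr r"
        using assms by (simp add: powr_powr s_def)
      finally show ?thesis using Nx Ny by (simp add: powr_divide)
    qed
    have "(y \<bullet> w) / N y = (\<Sum>i\<in>UNIV. (y $ i / N y) * w $ i)"
      by (simp add: inner_vec_def sum_divide_distrib)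
    also have "\<dots> \<le> (\<Sum>i\<in>UNIV. \<bar>y $ i\<bar> powr r / N y powr r / r + \<bar>x $ i\<bar> powr r / N x powr r / s)"
      by (intro sum_mono young)
    also have "\<dots> = N y powr r / N y powr r / r + N x powr r / N x powr r / s"
      by (simp only: sum.distrib Nr flip: sum_divide_distrib)
    also have "\<dots> = 1 / r + 1 / s" using Nx Ny by simp
    finally show ?thesis using rs Ny by (simp add: field_simps)
  qed
  with eq show ?thesis unfolding N_def by blast
qed

lemma infnorm_support_functional:
  fixes x :: "real ^ 'n::finite"
  shows "\<exists>w. x \<bullet> w = infnorm x \<and> (\<forall>y. y \<bullet> w \<le> infnorm y)"
proof -
  have "infnorm x \<in> {\<bar>x \<bullet> i\<bar> | i. i \<in> Basis}"
    unfolding infnorm_Max by (rule Max_in[of "(\<lambda>i. \<bar>x \<bullet> i\<bar>) ` Basis", THEN back_subst[of "\<lambda>S. _ \<in> S"]]) auto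
  then obtain b where b: "b \<in> Basis" "infnorm x = \<bar>x \<bullet> b\<bar>" by blast
  define w where "w = (if 0 \<le> x \<bullet> b then b else - b)"
  have "y \<bullet> w \<le> infnorm y" for y
    using Basis_le_infnorm[OF b(1), of y] by (auto simp: w_def)
  moreover have "x \<bullet> w = infnorm x" using b by (auto simp: w_def)
  ultimately show ?thesis by blast
qed

lemma lp_norm_conj_support_functional:
  fixes x :: "real ^ 'n::finite"
  assumes "1 \<le> p"
  shows "\<exists>w. x \<bullet> w = lp_norm (conj_exponent p) x \<and> (\<forall>y. y \<bullet> w \<le> lp_norm (conj_exponent p) y)"
proof (cases "p = 1")
  case True
  then show ?thesis using infnorm_support_functional[of x] by (simp add: lp_norm_def conj_exponent_def)
next
  case False
  with assms lp_norm_support_functional[of "p / (p - 1)" x] conj_exponent_gt_1[of p] show ?thesis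
    by auto
qed

lemma lp_norm_conj_diff_le:
  assumes "1 \<le> p"
  shows "lp_norm (conj_exponent p) (x - y) \<le> lp_norm (conj_exponent p) x + lp_norm (conj_exponent p) y"
proof -
  obtain w where w: "(x - y) \<bullet> w = lp_norm (conj_exponent p) (x - y)"
    "\<And>y. y \<bullet> w \<le> lp_norm (conj_exponent p) y"
    using lp_norm_conj_support_functional[OF assms] by blast
  have "(x - y) \<bullet> w = x \<bullet> w + (- y) \<bullet> w" by (simp add: inner_diff_left)
  with w(1) w(2)[of x] w(2)[of "- y"] show ?thesis by (simp add: lp_norm_uminus)
qed

lemma borel_measurable_lp_norm [measurable]: "lp_norm r \<in> borel_measurable borel"
proof (cases "r = \<infinity>")
  case True
  have "infnorm \<in> borel_measurable (borel :: (real ^ 'n::finite) measure)"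
    by (intro borel_measurable_continuous_onI continuous_on_infnorm continuous_intros)
  with True show ?thesis by (simp add: lp_norm_def[abs_def])
next
  case False
  then show ?thesis by (simp add: lp_norm_def[abs_def])
qed

text \<open>
  Jensen's inequality, once for the norm (test with the functional that supports the norm at the
  mean) and once for the square.
\<close>
lemma lp_norm_conj_expectation_le:
  fixes G :: "'w \<Rightarrow> real ^ 'n::finite"
  assumes "prob_space D" "1 \<le> p" "integrable D G" "integrable D (\<lambda>\<eta>. (lp_norm (conj_exponent p) (G \<eta>))\<^sup>2)"
  shows "(lp_norm (conj_exponent p) (\<integral>\<eta>. G \<eta> \<partial>D))\<^sup>2 \<le> (\<integral>\<eta>. (lp_norm (conj_exponent p) (G \<eta>))\<^sup>2 \<partial>D)"
proof -
  interpret prob_space D by fact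
  let ?N = "lp_norm (conj_exponent p)"
  obtain w where w: "(\<integral>\<eta>. G \<eta> \<partial>D) \<bullet> w = ?N (\<integral>\<eta>. G \<eta> \<partial>D)" "\<And>y. y \<bullet> w \<le> ?N y"
    using lp_norm_conj_support_functional[OF assms(2)] by blast
  have meas: "G \<in> borel_measurable D" using assms by auto
  have int: "integrable D (\<lambda>\<eta>. ?N (G \<eta>))"
    by (rule square_integrable_imp_integrable) (use meas assms(4) in simp_all)
  have "?N (\<integral>\<eta>. G \<eta> \<partial>D) = (\<integral>\<eta>. G \<eta> \<bullet> w \<partial>D)"
    using w(1) assms(3) by simp
  also have "\<dots> \<le> (\<integral>\<eta>. ?N (G \<eta>) \<partial>D)"
    using assms(3) int w(2) by (intro integral_mono) auto
  finally have "(?N (\<integral>\<eta>. G \<eta> \<partial>D))\<^sup>2 \<le> (\<integral>\<eta>. ?N (G \<eta>) \<partial>D)\<^sup>2"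
    by (intro power_mono) (auto simp: lp_norm_nonneg)
  also have "\<dots> \<le> (\<integral>\<eta>. (?N (G \<eta>))\<^sup>2 \<partial>D)"
    using variance_eq[OF int assms(4)] variance_positive[of "\<lambda>\<eta>. ?N (G \<eta>)"] by simp
  finally show ?thesis .
qed

text \<open>
  The q-norm is not Euclidean, so the variance is not a difference of second moments; the
  inequality \<open>(a + b)\<^sup>2 \<le> 2 a\<^sup>2 + 2 b\<^sup>2\<close> costs a factor 4, which is the source of the 8 in the variance
  bound handed to the method.
\<close>
lemma lp_norm_conj_variance_le:
  fixes G :: "'w \<Rightarrow> real ^ 'n::finite"
  assumes "prob_space D" "1 \<le> p" "integrable D G" "integrable D (\<lambda>\<eta>. (lp_norm (conj_exponent p) (G \<eta>))\<^sup>2)"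
  defines "g \<equiv> (\<integral>\<eta>. G \<eta> \<partial>D)"
  shows "integrable D (\<lambda>\<eta>. (lp_norm (conj_exponent p) (G \<eta> - g))\<^sup>2)"
    and "(\<integral>\<eta>. (lp_norm (conj_exponent p) (G \<eta> - g))\<^sup>2 \<partial>D) \<le> 4 * (\<integral>\<eta>. (lp_norm (conj_exponent p) (G \<eta>))\<^sup>2 \<partial>D)"
proof -
  interpret prob_space D by fact
  let ?N = "lp_norm (conj_exponent p)"
  have meas[measurable]: "G \<in> borel_measurable D" using assms by auto
  have le: "(?N (x - g))\<^sup>2 \<le> 2 * (?N x)\<^sup>2 + 2 * (?N g)\<^sup>2" for x
  proof -
    have "(?N (x - g))\<^sup>2 \<le> (?N x + ?N g)\<^sup>2"
      by (intro power_mono lp_norm_conj_diff_le lp_norm_nonneg assms)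
    also have "\<dots> \<le> 2 * (?N x)\<^sup>2 + 2 * (?N g)\<^sup>2"
      using sum_squares_bound[of "?N x" "?N g"] by (simp add: power2_sum)
    finally show ?thesis .
  qed
  have int2: "integrable D (\<lambda>\<eta>. 2 * (?N (G \<eta>))\<^sup>2 + 2 * (?N g)\<^sup>2)" using assms(4) by simp
  show int: "integrable D (\<lambda>\<eta>. (?N (G \<eta> - g))\<^sup>2)"
    by (rule Bochner_Integration.integrable_bound[OF int2]) (auto simp: le intro!: AE_I2)
  have "(\<integral>\<eta>. (?N (G \<eta> - g))\<^sup>2 \<partial>D) \<le> (\<integral>\<eta>. 2 * (?N (G \<eta>))\<^sup>2 + 2 * (?N g)\<^sup>2 \<partial>D)"
    by (intro integral_mono int int2 le)
  also have "\<dots> = 2 * (\<integral>\<eta>. (?N (G \<eta>))\<^sup>2 \<partial>D) + 2 * (?N g)\<^sup>2"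
    using assms(4) by (simp add: prob_space)
  also have "\<dots> \<le> 4 * (\<integral>\<eta>. (?N (G \<eta>))\<^sup>2 \<partial>D)"
    using lp_norm_conj_expectation_le[OF assms(1-4)] by (simp add: g_def)
  finally show "(\<integral>\<eta>. (?N (G \<eta> - g))\<^sup>2 \<partial>D) \<le> 4 * (\<integral>\<eta>. (?N (G \<eta>))\<^sup>2 \<partial>D)" .
qed

text \<open>
  These two lower bounds keep kappa from being too small, which is what lets K absorb the iteration
  count. The case of exponents up to 4 reduces to the exponent 4,
  where it is the Cauchy-Schwarz inequality.
\<close>
lemma infnorm_pow4_ge:
  fixes x :: "real ^ 'n::finite"
  assumes "norm x = 1"
  shows "1 / (real CARD('n))\<^sup>2 \<le> infnorm x ^ 4"
proof -
  have "1 \<le> sqrt (real CARD('n)) * infnorm x" using norm_le_infnorm[of x] assms by simp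
  then have "1 ^ 4 \<le> (sqrt (real CARD('n)) * infnorm x) ^ 4" by (intro power_mono) auto
  also have "\<dots> = (real CARD('n))\<^sup>2 * infnorm x ^ 4"
    using power_mult[of "sqrt (real CARD('n))" 2 2] by (simp add: power_mult_distrib)
  finally show ?thesis by (simp add: field_simps)
qed

lemma lp_norm_pow4_ge:
  fixes x :: "real ^ 'n::finite"
  assumes "norm x = 1" "0 < r" "r \<le> 4"
  shows "1 / real CARD('n) \<le> lp_norm (ereal r) x ^ 4"
proof -
  have "1 = (\<Sum>i\<in>UNIV. (x $ i)\<^sup>2 * 1)\<^sup>2"
    using assms by (simp add: norm_vec_def L2_set_def)
  also have "\<dots> \<le> (\<Sum>i\<in>UNIV. ((x $ i)\<^sup>2)\<^sup>2) * (\<Sum>i\<in>(UNIV::'n set). 1\<^sup>2)"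
    by (rule Cauchy_Schwarz_ineq_sum)
  also have "\<dots> = (\<Sum>i\<in>UNIV. (x $ i) ^ 4) * real CARD('n)" by simp
  finally have 1: "1 / real CARD('n) \<le> (\<Sum>i\<in>UNIV. (x $ i) ^ 4)" by (simp add: field_simps)
  let ?S = "\<Sum>i\<in>UNIV. (x $ i) ^ 4"
  have p4: "y powr 4 = y ^ 4" if "0 \<le> y" for y :: real
    using that by (cases "y = 0") (simp_all add: powr_numeral)
  have "lp_norm (ereal 4) x = ?S powr (1 / 4)"
    by (simp add: lp_norm_ereal p4)
  then have "lp_norm (ereal 4) x ^ 4 = (?S powr (1 / 4)) powr 4" by (simp add: p4)
  also have "\<dots> = ?S" by (simp add: powr_powr sum_nonneg)
  finally have "?S = lp_norm (ereal 4) x ^ 4" ..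
  also have "\<dots> \<le> lp_norm (ereal r) x ^ 4"
    using lp_norm_antimono[of r 4 x] assms by (intro power_mono) (auto simp: lp_norm_nonneg)
  finally show ?thesis using 1 by simp
qed

section \<open>Uniform distributions on the ball and on the sphere\<close>

lemma lborel_integral_scaleR:
  fixes h :: "'a::euclidean_space \<Rightarrow> 'b::{banach, second_countable_topology}"
  assumes [measurable]: "h \<in> borel_measurable borel" and "c \<noteq> 0"
  shows "(\<integral>u. h u \<partial>lborel) = \<bar>c\<bar> ^ DIM('a) *\<^sub>R (\<integral>u. h (c *\<^sub>R u) \<partial>lborel)"
proof -
  have eq: "(lborel :: 'a measure) = density (distr lborel borel (\<lambda>x. 0 + c *\<^sub>R x)) (\<lambda>_. ennreal (\<bar>c\<bar> ^ DIM('a)))"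
    using lborel_affine[OF assms(2), of 0] by simp
  have "(\<integral>u. h u \<partial>lborel) = (\<integral>u. \<bar>c\<bar> ^ DIM('a) *\<^sub>R h u \<partial>distr lborel borel (\<lambda>x::'a. 0 + c *\<^sub>R x))"
    by (subst eq, rule integral_density) auto
  also have "\<dots> = \<bar>c\<bar> ^ DIM('a) *\<^sub>R (\<integral>u. h (c *\<^sub>R u) \<partial>lborel)"
    by (subst integral_distr) auto
  finally show ?thesis .
qed

lemma cball_integral_scaleR:
  fixes h :: "'a::euclidean_space \<Rightarrow> 'b::{banach, second_countable_topology}"
  assumes [measurable]: "h \<in> borel_measurable borel" and "c \<noteq> 0"
  shows "(LINT u:cball 0 (\<bar>c\<bar> * r)|lborel. h u) = \<bar>c\<bar> ^ DIM('a) *\<^sub>R (LINT u:cball 0 r|lborel. h (c *\<^sub>R u))"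
proof -
  have "indicator (cball 0 (\<bar>c\<bar> * r)) (c *\<^sub>R u) = (indicator (cball 0 r) u :: real)" for u :: 'a
    using assms(2) by (auto simp: indicator_def)
  moreover have "(\<lambda>u. indicator (cball 0 (\<bar>c\<bar> * r)) u *\<^sub>R h u) \<in> borel_measurable borel"
    by (intro borel_measurable_scaleR borel_measurable_indicator assms) auto
  ultimately show ?thesis
    unfolding set_lebesgue_integral_def
    by (subst lborel_integral_scaleR[OF _ assms(2)]) auto
qed

lemma content_cball_scale:
  assumes "0 \<le> r"
  shows "measure lborel (cball (0::'a::euclidean_space) r) = measure lborel (cball (0::'a) 1) * r ^ DIM('a)"
  using content_ball_conv_unit_ball[OF assms, of "0::'a"] by (simp add: content_cball_conv_ball)

lemma sgn_scaleR_pos: "0 < c \<Longrightarrow> sgn (c *\<^sub>R u) = sgn (u :: 'a::real_normed_vector)"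
  by (simp add: sgn_scaleR)

lemma space_unif_ball [simp]: "space (unif_ball r) = cball 0 r"
  by (simp add: unif_ball_def space_restrict_space)

lemma sets_unif_ball [measurable_cong]: "sets (unif_ball r) = sets (restrict_space borel (cball 0 r))"
  by (simp add: unif_ball_def sets_restrict_space)

lemma space_unif_sphere [simp]: "space unif_sphere = sphere 0 1"
  by (simp add: unif_sphere_def space_restrict_space)

lemma sets_unif_sphere [measurable_cong]: "sets unif_sphere = sets (restrict_space borel (sphere 0 1))"
  by (simp add: unif_sphere_def sets_restrict_space)

text \<open>
  Both measures live on the set itself, so integrands need to agree only there: replacing f by a
  Borel function on the whole space that agrees with it near Q brings every integral below into the
  scope of these rules.
\<close>
lemma measurable_unif_ballI:
  "h \<in> measurable borel N \<Longrightarrow> h \<in> measurable (unif_ball r) N"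
  by (simp add: measurable_cong_sets[OF sets_unif_ball refl] measurable_restrict_space1)

lemma measurable_unif_sphereI:
  "h \<in> measurable borel N \<Longrightarrow> h \<in> measurable unif_sphere N"
  by (simp add: measurable_cong_sets[OF sets_unif_sphere refl] measurable_restrict_space1)

lemma emeasure_restrict_cball:
  "emeasure (restrict_space lborel (cball 0 r)) (cball (0::'a::euclidean_space) r) = ennreal (measure lborel (cball (0::'a) r))"
  using emeasure_lborel_cball_finite[of "0::'a" r]
  by (subst emeasure_restrict_space) (auto intro!: emeasure_eq_ennreal_measure)

lemma prob_space_unif_ball:
  assumes "0 < r"
  shows "prob_space (unif_ball r :: (real ^ 'n::finite) measure)"
  unfolding unif_ball_def
  by (rule prob_space_uniform_measure) (use content_cball_pos[OF assms, of "0 :: real^'n"] in \<open>auto simp: emeasure_restrict_cball\<close>)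

lemma integral_unif_ball:
  fixes h :: "real ^ 'n::finite \<Rightarrow> 'b::{banach, second_countable_topology}"
  assumes [measurable]: "h \<in> borel_measurable borel" and "0 < r"
  shows "(\<integral>u. h u \<partial>unif_ball r) = (1 / measure lborel (cball (0::real^'n) r)) *\<^sub>R (LINT u:cball 0 r|lborel. h u)"
proof -
  let ?B = "cball (0::real^'n) r"
  have pos: "0 < measure lborel ?B" using assms by (simp add: content_cball_pos)
  have "(\<lambda>u. indicator ?B u / ennreal (measure lborel ?B)) \<in> borel_measurable (restrict_space lborel ?B)"
    by (intro measurable_restrict_space1 borel_measurable_divide_ennreal borel_measurable_indicator) auto
  then have eq: "unif_ball r = density (restrict_space lborel ?B) (\<lambda>u. ennreal (1 / measure lborel ?B))"
    unfolding unif_ball_def uniform_measure_def emeasure_restrict_cball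
    using divide_ennreal[OF zero_le_one pos] by (intro density_cong) auto
  have hm: "h \<in> borel_measurable (restrict_space lborel ?B)"
    by (intro measurable_restrict_space1) auto
  have "(\<integral>u. h u \<partial>unif_ball r) = (\<integral>u. (1 / measure lborel ?B) *\<^sub>R h u \<partial>restrict_space lborel ?B)"
    unfolding eq using pos hm by (intro integral_density) auto
  also have "\<dots> = (\<integral>u. indicator ?B u *\<^sub>R ((1 / measure lborel ?B) *\<^sub>R h u) \<partial>lborel)"
    by (subst integral_restrict_space) auto
  also have "\<dots> = (\<integral>u. (1 / measure lborel ?B) *\<^sub>R (indicator ?B u *\<^sub>R h u) \<partial>lborel)"
    by (intro Bochner_Integration.integral_cong) (auto simp: indicator_def)
  also have "\<dots> = (1 / measure lborel ?B) *\<^sub>R (LINT u:?B|lborel. h u)"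
    unfolding set_lebesgue_integral_def by (rule integral_scaleR_right)
  finally show ?thesis .
qed

lemma AE_unif_ball_nonzero: "AE u in (unif_ball 1 :: (real ^ 'n::finite) measure). u \<noteq> 0"
proof -
  interpret prob_space "unif_ball 1 :: (real ^ 'n) measure" by (rule prob_space_unif_ball) simp
  have m: "{0} \<in> sets (unif_ball 1 :: (real ^ 'n) measure)"
    by (auto simp: sets_unif_ball sets_restrict_space intro!: image_eqI[of _ _ "{0}"])
  have m': "cball 0 1 \<in> sets (restrict_space lborel (cball (0 :: real ^ 'n) 1))"
    using sets.top[of "restrict_space lborel (cball (0 :: real ^ 'n) 1)"] by (simp add: space_restrict_space)
  have "emeasure (unif_ball 1) {0 :: real ^ 'n} = 0"
    unfolding unif_ball_def using m m'
    by (subst emeasure_uniform_measure) (simp_all add: unif_ball_def emeasure_restrict_space)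
  then have "{0} \<in> null_sets (unif_ball 1 :: (real ^ 'n) measure)" using m by auto
  from AE_not_in[OF this] show ?thesis by simp
qed

lemma prob_space_unif_sphere: "prob_space (unif_sphere :: (real ^ 'n::finite) measure)"
proof -
  let ?U = "unif_ball 1 :: (real ^ 'n) measure"
  have sg: "sgn \<in> measurable ?U borel" by (intro measurable_unif_ballI) measurable
  interpret U: prob_space ?U by (rule prob_space_unif_ball) simp
  interpret D: prob_space "distr ?U borel sgn" by (rule U.prob_space_distr[OF sg])
  have "AE u in ?U. sgn u \<in> sphere 0 1"
    using AE_unif_ball_nonzero by eventually_elim (simp add: norm_sgn)
  then have "AE e in distr ?U borel sgn. e \<in> sphere 0 1"
    using sg by (subst AE_distr_iff) auto
  then have "emeasure (distr ?U borel sgn) (sphere 0 1) = 1"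
    by (intro D.emeasure_eq_1_AE) auto
  then show ?thesis unfolding unif_sphere_def
    by (intro prob_space_restrict_space) auto
qed

lemma integral_unif_sphere:
  fixes h :: "real ^ 'n::finite \<Rightarrow> 'b::{banach, second_countable_topology}"
  assumes [measurable]: "h \<in> borel_measurable borel"
  shows "(\<integral>e. h e \<partial>unif_sphere) = (\<integral>u. h (sgn u) \<partial>unif_ball 1)"
proof -
  let ?U = "unif_ball 1 :: (real ^ 'n) measure"
  have sg: "sgn \<in> measurable ?U borel" by (intro measurable_unif_ballI) measurable
  have hi: "(\<lambda>e. indicator (sphere 0 1) e *\<^sub>R h e) \<in> borel_measurable borel"
    by (intro borel_measurable_scaleR borel_measurable_indicator assms) auto
  have hs: "(\<lambda>u. h (sgn u)) \<in> borel_measurable ?U" by (rule measurable_compose[OF sg assms])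
  have hs': "(\<lambda>u. indicator (sphere 0 1) (sgn u) *\<^sub>R h (sgn u)) \<in> borel_measurable ?U"
    by (rule measurable_compose[OF sg hi])
  have "(\<integral>e. h e \<partial>unif_sphere) = (\<integral>e. indicator (sphere 0 1) e *\<^sub>R h e \<partial>distr ?U borel sgn)"
    unfolding unif_sphere_def by (subst integral_restrict_space) auto
  also have "\<dots> = (\<integral>u. indicator (sphere 0 1) (sgn u) *\<^sub>R h (sgn u) \<partial>?U)"
    by (rule integral_distr[OF sg hi])
  also have "\<dots> = (\<integral>u. h (sgn u) \<partial>?U)"
  proof (intro integral_cong_AE hs hs')
    show "AE u in ?U. indicator (sphere 0 1) (sgn u) *\<^sub>R h (sgn u) = h (sgn u)"
      using AE_unif_ball_nonzero by eventually_elim (simp add: norm_sgn)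
  qed
  finally show ?thesis .
qed

text \<open>
  Radius and direction of a uniform point of the ball are independent: dilating the ball does not
  change the integrand, so the integral is proportional to the volume. This replaces
  polar coordinates.
\<close>
lemma cball_integral_sgn:
  fixes h :: "real ^ 'n::finite \<Rightarrow> 'b::{banach, second_countable_topology}"
  assumes [measurable]: "h \<in> borel_measurable borel" and "0 < r"
  shows "(LINT u:cball 0 r|lborel. h (sgn u)) = measure lborel (cball (0::real^'n) r) *\<^sub>R (\<integral>e. h e \<partial>unif_sphere)"
proof -
  have pos: "0 < measure lborel (cball (0::real^'n) 1)" by (simp add: content_cball_pos)
  have "(LINT u:cball 0 r|lborel. h (sgn u)) = r ^ CARD('n) *\<^sub>R (LINT u:cball 0 1|lborel. h (sgn (r *\<^sub>R u)))"
    using cball_integral_scaleR[of "\<lambda>u. h (sgn u)" r 1] assms(2) by simp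
  also have "\<dots> = r ^ CARD('n) *\<^sub>R (LINT u:cball 0 1|lborel. h (sgn u))"
    by (simp add: sgn_scaleR_pos[OF assms(2)])
  also have "(LINT u:cball 0 1|lborel. h (sgn u)) = measure lborel (cball (0::real^'n) 1) *\<^sub>R (\<integral>e. h e \<partial>unif_sphere)"
    using pos integral_unif_ball[of "\<lambda>u. h (sgn u)" 1] by (simp add: integral_unif_sphere)
  finally show ?thesis using assms(2) by (simp add: content_cball_scale[of r] mult.commute)
qed

lemma integral_unif_ball_uminus:
  fixes h :: "real ^ 'n::finite \<Rightarrow> 'b::{banach, second_countable_topology}"
  assumes [measurable]: "h \<in> borel_measurable borel" and "0 < r"
  shows "(\<integral>u. h (- u) \<partial>unif_ball r) = (\<integral>u. h u \<partial>unif_ball r)"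
  using cball_integral_scaleR[of h "-1" r] assms by (simp add: integral_unif_ball)

lemma integral_unif_sphere_uminus:
  fixes h :: "real ^ 'n::finite \<Rightarrow> 'b::{banach, second_countable_topology}"
  assumes [measurable]: "h \<in> borel_measurable borel"
  shows "(\<integral>e. h (- e) \<partial>unif_sphere) = (\<integral>e. h e \<partial>unif_sphere)"
  using integral_unif_ball_uminus[of "\<lambda>u. h (sgn u)" 1]
  by (simp add: integral_unif_sphere sgn_minus)

lemma unif_sphere_integrable_bounded:
  fixes h :: "real ^ 'n::finite \<Rightarrow> 'b::{banach, second_countable_topology}"
  assumes "h \<in> borel_measurable borel" "\<And>e. norm e = 1 \<Longrightarrow> norm (h e) \<le> B"
  shows "integrable unif_sphere h"
proof -
  interpret prob_space "unif_sphere :: (real ^ 'n) measure" by (rule prob_space_unif_sphere)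
  show ?thesis
    by (rule integrable_const_bound[where B=B]) (auto intro!: AE_I2 measurable_unif_sphereI assms)
qed

lemma unif_ball_integrable_bounded:
  fixes h :: "real ^ 'n::finite \<Rightarrow> 'b::{banach, second_countable_topology}"
  assumes "0 < r" "h \<in> borel_measurable borel" "\<And>u. norm u \<le> r \<Longrightarrow> norm (h u) \<le> B"
  shows "integrable (unif_ball r) h"
proof -
  interpret prob_space "unif_ball r :: (real ^ 'n) measure" by (rule prob_space_unif_ball) fact
  show ?thesis
    by (rule integrable_const_bound[where B=B]) (auto intro!: AE_I2 measurable_unif_ballI assms)
qed

section \<open>The gradient of a ball average is a sphere average\<close>

text \<open>
  Differentiation under the integral sign with a derivative that exists only almost everywhere.
  The difference quotients are dominated by a Lipschitz bound, which suits integrands with kinks.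
\<close>
lemma has_derivative_integral_dominated:
  fixes G :: "'a::euclidean_space \<Rightarrow> 'z \<Rightarrow> real" and G' :: "'z \<Rightarrow> 'a"
  assumes "open S" "x \<in> S"
    and int: "\<And>y. y \<in> S \<Longrightarrow> integrable M (G y)"
    and w: "integrable M w"
    and [measurable]: "G' \<in> borel_measurable M"
    and deriv: "AE z in M. ((\<lambda>y. G y z) has_derivative (\<lambda>h. G' z \<bullet> h)) (at x)"
    and bound: "\<And>y z. y \<in> S \<Longrightarrow> z \<in> space M \<Longrightarrow> \<bar>G y z - G x z\<bar> \<le> w z * norm (y - x)"
    and bound': "\<And>z. z \<in> space M \<Longrightarrow> norm (G' z) \<le> w z"
  shows "((\<lambda>y. \<integral>z. G y z \<partial>M) has_derivative (\<lambda>h. (\<integral>z. G' z \<partial>M) \<bullet> h)) (at x)"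
proof -
  have intG': "integrable M G'"
    using bound' by (intro Bochner_Integration.integrable_bound[OF w] AE_I2)
      (auto intro: order_trans[OF _ abs_ge_self])
  let ?F = "\<lambda>y. \<integral>z. G y z \<partial>M" and ?D = "\<integral>z. G' z \<partial>M"
  have "((\<lambda>y. norm (?F y - ?F x - ?D \<bullet> (y - x)) / norm (y - x)) \<longlongrightarrow> 0) (at x within S)"
    unfolding tendsto_at_iff_sequentially comp_def
  proof (intro allI impI)
    fix X assume X: "\<forall>i. X i \<in> S - {x}" "X \<longlonglongrightarrow> x"
    define q where "q = (\<lambda>n z. (G (X n) z - G x z - G' z \<bullet> (X n - x)) / norm (X n - x))"
    have pos: "0 < norm (X n - x)" for n using X(1) by auto
    have qint: "integrable M (q n)" and qval: "(\<integral>z. q n z \<partial>M) = (?F (X n) - ?F x - ?D \<bullet> (X n - x)) / norm (X n - x)" for n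
      unfolding q_def using int[of "X n"] int[of x] intG' X(1) assms(2) by auto
    have "(\<lambda>n. \<integral>z. q n z \<partial>M) \<longlonglongrightarrow> (\<integral>z. 0 \<partial>M)"
    proof (rule integral_dominated_convergence[where w="\<lambda>z. 2 * w z"])
      show "AE z in M. (\<lambda>n. q n z) \<longlonglongrightarrow> 0"
        using deriv
      proof (rule AE_mp, intro AE_I2 impI)
        fix z assume "((\<lambda>y. G y z) has_derivative (\<lambda>h. G' z \<bullet> h)) (at x)"
        then have "((\<lambda>y. norm (G y z - G x z - G' z \<bullet> (y - x)) / norm (y - x)) \<longlongrightarrow> 0) (at x)"
          by (simp add: has_derivative_iff_norm)
        then have "(\<lambda>n. norm (G (X n) z - G x z - G' z \<bullet> (X n - x)) / norm (X n - x)) \<longlonglongrightarrow> 0"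
          using X unfolding tendsto_at_iff_sequentially comp_def by auto
        then have "(\<lambda>n. norm (q n z)) \<longlonglongrightarrow> 0" by (simp add: q_def)
        then show "(\<lambda>n. q n z) \<longlonglongrightarrow> 0" by (rule tendsto_norm_zero_cancel)
      qed
      show "AE z in M. norm (q n z) \<le> 2 * w z" for n
      proof (rule AE_I2)
        fix z assume z: "z \<in> space M"
        have "\<bar>G (X n) z - G x z - G' z \<bullet> (X n - x)\<bar> \<le> \<bar>G (X n) z - G x z\<bar> + \<bar>G' z \<bullet> (X n - x)\<bar>" by simp
        also have "\<dots> \<le> w z * norm (X n - x) + w z * norm (X n - x)"
          using bound[of "X n" z] X(1) z bound'[OF z]
          by (intro add_mono order_trans[OF Cauchy_Schwarz_ineq2] mult_right_mono) auto
        finally show "norm (q n z) \<le> 2 * w z"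
          using pos[of n] by (simp add: q_def field_simps)
      qed
    qed (use qint w in \<open>auto simp: borel_measurable_integrable\<close>)
    then have "(\<lambda>n. \<integral>z. q n z \<partial>M) \<longlonglongrightarrow> 0" by simp
    then have "(\<lambda>n. norm (\<integral>z. q n z \<partial>M)) \<longlonglongrightarrow> 0" by (rule tendsto_norm_zero)
    then show "(\<lambda>n. norm (?F (X n) - ?F x - ?D \<bullet> (X n - x)) / norm (X n - x)) \<longlonglongrightarrow> 0"
      by (simp add: qval)
  qed
  then have "(?F has_derivative (\<lambda>h. ?D \<bullet> h)) (at x within S)"
    by (simp add: has_derivative_iff_norm bounded_linear_inner_right)
  then show ?thesis by (simp only: at_within_open[OF assms(2,1)])
qed

lemma lborel_integral_translate:
  fixes h :: "'a::euclidean_space \<Rightarrow> 'b::{banach, second_countable_topology}"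
  assumes "h \<in> borel_measurable borel"
  shows "(\<integral>z. h z \<partial>lborel) = (\<integral>u. h (x + u) \<partial>lborel)"
proof -
  have "(\<integral>z. h z \<partial>lborel) = (\<integral>z. h z \<partial>distr lborel borel ((+) x))"
    by (simp add: lborel_distr_plus)
  also have "\<dots> = (\<integral>u. h (x + u) \<partial>lborel)"
    using assms by (intro integral_distr) auto
  finally show ?thesis .
qed

lemma integrable_on_cball_bounded:
  fixes h :: "'a::euclidean_space \<Rightarrow> 'b::{banach, second_countable_topology}"
  assumes "h \<in> borel_measurable borel" "\<And>u. u \<in> cball a r \<Longrightarrow> norm (h u) \<le> B"
  shows "set_integrable lborel (cball a r) h"
  unfolding set_integrable_def
proof (rule integrableI_bounded_set_indicator[where B=B])
  show "emeasure lborel (cball a r) < \<infinity>" by (rule emeasure_lborel_cball_finite)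
  show "AE x in lborel. x \<in> cball a r \<longrightarrow> norm (h x) \<le> B" using assms(2) by (intro AE_I2) auto
qed (use assms in auto)

lemma continuous_bounded_cball:
  fixes f :: "'a::euclidean_space \<Rightarrow> real"
  assumes "continuous_on UNIV f"
  obtains B where "\<And>u. u \<in> cball a r \<Longrightarrow> \<bar>f u\<bar> \<le> B"
proof -
  have "compact (f ` cball a r)"
    using assms by (intro compact_continuous_image) (auto intro: continuous_on_subset)
  then show ?thesis
    using that by (metis bounded_iff compact_imp_bounded image_eqI real_norm_def)
qed

text \<open>
  Weighting the ball by the cone \<open>s - \<parallel>u\<parallel>\<close> makes the average differentiable without any
  smoothness of f: after a translation the variable sits in the cone, whose gradient is the unit
  vector field and which has kinks only at its apex and on the sphere of radius s.
\<close>
lemma cone_integral_has_derivative: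
  fixes f :: "'a::euclidean_space \<Rightarrow> real"
  assumes f: "continuous_on UNIV f" and "0 < s"
  shows "((\<lambda>x. \<integral>u. f (x + u) * max 0 (s - norm u) \<partial>lborel) has_derivative
     (\<lambda>h. (LINT u:cball 0 s|lborel. f (x + u) *\<^sub>R sgn u) \<bullet> h)) (at x)"
proof -
  have [measurable]: "f \<in> borel_measurable borel" using f by (rule borel_measurable_continuous_onI)
  define k :: "'a \<Rightarrow> real" where "k = (\<lambda>v. max 0 (s - norm v))"
  define G where "G = (\<lambda>y z. f z * k (z - y))"
  define G' where "G' = (\<lambda>z. indicator (cball 0 s) (z - x) *\<^sub>R (f z *\<^sub>R sgn (z - x)))"
  define w where "w = (\<lambda>z. indicator (cball x (s + 1)) z * \<bar>f z\<bar>)"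
  have kmeas[measurable]: "k \<in> borel_measurable borel" by (simp add: k_def)
  have Gmeas: "G y \<in> borel_measurable borel" for y unfolding G_def by measurable
  have ind[measurable]: "(\<lambda>z. indicator (cball 0 s) (z - x) :: real) \<in> borel_measurable borel"
    by (rule measurable_compose[of "\<lambda>z. z - x" _ borel, OF _ borel_measurable_indicator]) simp_all
  have G'meas: "G' \<in> borel_measurable borel" unfolding G'_def by measurable
  have kcase: "k v = 0" if "s \<le> norm v" for v using that by (simp add: k_def)
  have klip: "\<bar>k a - k b\<bar> \<le> norm (a - b)" for a b
  proof -
    have "\<bar>max 0 c - max 0 c'\<bar> \<le> \<bar>c - c'\<bar>" for c c' :: real by linarith
    from this[of "s - norm a" "s - norm b"] norm_triangle_ineq3[of a b] show ?thesis
      by (simp add: k_def)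
  qed
  have kbd: "\<bar>k v\<bar> \<le> s" for v using assms(2) by (auto simp: k_def)
  have kderiv: "(k has_derivative (\<lambda>h. - indicator (cball 0 s) v * (sgn v \<bullet> h))) (at v)"
    if "v \<noteq> 0" "norm v \<noteq> s" for v
  proof (cases "norm v < s")
    case True
    have "((\<lambda>v. s - norm v) has_derivative (\<lambda>h. 0 - sgn v \<bullet> h)) (at v)"
      using has_derivative_diff[OF has_derivative_const has_derivative_norm[OF that(1)]]
      by (simp add: inner_commute)
    then have "(k has_derivative (\<lambda>h. 0 - sgn v \<bullet> h)) (at v)"
      by (rule has_derivative_transform_within_open[of _ _ _ _ "ball 0 s"]) (use True in \<open>auto simp: k_def\<close>)
    then show ?thesis using True by simp
  next
    case False
    have "((\<lambda>v. 0) has_derivative (\<lambda>h. 0)) (at v)" by simp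
    then have "(k has_derivative (\<lambda>h. 0)) (at v)"
      by (rule has_derivative_transform_within_open[of _ _ _ _ "- cball 0 s"]) (use False that in \<open>auto simp: k_def\<close>)
    then show ?thesis using False that by simp
  qed
  have "((\<lambda>y. \<integral>z. G y z \<partial>lborel) has_derivative (\<lambda>h. (\<integral>z. G' z \<partial>lborel) \<bullet> h)) (at x)"
  proof (rule has_derivative_integral_dominated[where w = w and S = "ball x 1"])
    show "integrable lborel (G y)" if "y \<in> ball x 1" for y
    proof -
      obtain B where B: "\<And>u. u \<in> cball y s \<Longrightarrow> \<bar>f u\<bar> \<le> B" using continuous_bounded_cball[OF f] by blast
      have "set_integrable lborel (cball y s) (G y)"
      proof (rule integrable_on_cball_bounded[OF Gmeas])
        fix u assume "u \<in> cball y s"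
        then have "\<bar>f u\<bar> * \<bar>k (u - y)\<bar> \<le> B * s" using B[of u] kbd[of "u - y"] by (intro mult_mono) auto
        then show "norm (G y u) \<le> B * s" by (simp add: G_def abs_mult)
      qed
      moreover have "indicator (cball y s) z *\<^sub>R G y z = G y z" for z
        using kcase[of "z - y"] by (auto simp: G_def indicator_def dist_norm norm_minus_commute)
      ultimately show ?thesis by (simp only: set_integrable_def)
    qed
    show "integrable lborel w"
    proof -
      obtain B where B: "\<And>u. u \<in> cball x (s + 1) \<Longrightarrow> \<bar>f u\<bar> \<le> B" using continuous_bounded_cball[OF f] by blast
      have "set_integrable lborel (cball x (s + 1)) (\<lambda>u. \<bar>f u\<bar>)"
        by (rule integrable_on_cball_bounded[where B=B]) (use B in auto)
      then show ?thesis by (simp add: set_integrable_def w_def)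
    qed
    show "G' \<in> borel_measurable lborel" using G'meas by simp
    have "AE z in lborel. z \<noteq> x" by (rule AE_lborel_singleton)
    moreover have "AE z in lborel. z \<notin> sphere x s"
    proof -
      have "sphere x s \<in> null_sets lborel"
        using negligible_sphere[of x s] by (auto simp: null_sets_completion_iff negligible_iff_null_sets)
      then show ?thesis by (rule AE_not_in)
    qed
    ultimately show "AE z in lborel. ((\<lambda>y. G y z) has_derivative (\<lambda>h. G' z \<bullet> h)) (at x)"
    proof eventually_elim
      case (elim z)
      have kd: "(k has_derivative (\<lambda>h. - indicator (cball 0 s) (z - x) * (sgn (z - x) \<bullet> h))) (at (z - x))"
        using elim by (intro kderiv) (auto simp: dist_norm norm_minus_commute)
      have "((\<lambda>y. z - y) has_derivative (\<lambda>h. 0 - h)) (at x)" by (intro derivative_intros)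
      from diff_chain_at[OF this kd]
      have "((\<lambda>y. k (z - y)) has_derivative (\<lambda>h. - indicator (cball 0 s) (z - x) * (sgn (z - x) \<bullet> (0 - h)))) (at x)"
        by (simp add: comp_def)
      then have "((\<lambda>y. f z * k (z - y)) has_derivative (\<lambda>h. f z * (- indicator (cball 0 s) (z - x) * (sgn (z - x) \<bullet> (0 - h))))) (at x)"
        by (rule has_derivative_mult_right)
      then show ?case by (simp add: G_def G'_def mult_ac)
    qed
    show "\<bar>G y z - G x z\<bar> \<le> w z * norm (y - x)" if y: "y \<in> ball x 1" for y z
    proof (cases "z \<in> cball x (s + 1)")
      case True
      have "\<bar>G y z - G x z\<bar> = \<bar>f z\<bar> * \<bar>k (z - y) - k (z - x)\<bar>"
        by (simp add: G_def abs_mult flip: right_diff_distrib)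
      also have "\<dots> \<le> \<bar>f z\<bar> * norm (y - x)"
        using klip[of "z - y" "z - x"] by (intro mult_left_mono) (auto simp: norm_minus_commute)
      finally show ?thesis using True by (simp add: w_def)
    next
      case False
      have "s \<le> norm (z - x)" "s \<le> norm (z - y)"
        using False y dist_triangle[of x z y] by (auto simp: dist_norm norm_minus_commute)
      then show ?thesis by (simp add: G_def kcase w_def)
    qed
    show "norm (G' z) \<le> w z" for z
      by (auto simp: G'_def w_def indicator_def norm_sgn dist_norm norm_minus_commute)
  qed auto
  moreover have "(\<integral>z. G y z \<partial>lborel) = (\<integral>u. f (y + u) * max 0 (s - norm u) \<partial>lborel)" for y
    by (subst lborel_integral_translate[OF Gmeas, of _ y]) (simp add: G_def k_def)
  moreover have "(\<integral>z. G' z \<partial>lborel) = (LINT u:cball 0 s|lborel. f (x + u) *\<^sub>R sgn u)"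
    by (subst lborel_integral_translate[OF G'meas, of x]) (simp add: G'_def set_lebesgue_integral_def)
  ultimately show ?thesis by simp
qed

text \<open>
  The density at the outer radius: the volume of a shell per unit of thickness.
\<close>
lemma power_difference_quotient:
  fixes r :: real
  assumes "(\<lambda>n. \<delta> n) \<longlonglongrightarrow> 0" "\<And>n. \<delta> n \<noteq> 0"
  shows "(\<lambda>n. (r ^ k - (r - \<delta> n) ^ k) / \<delta> n) \<longlonglongrightarrow> real k * r ^ (k - 1)"
proof -
  have "((\<lambda>x. x ^ k) has_real_derivative real k * r ^ (k - 1)) (at r)"
    by (auto intro!: derivative_eq_intros)
  then have "((\<lambda>h. ((r + h) ^ k - r ^ k) / h) \<longlongrightarrow> real k * r ^ (k - 1)) (at 0)"
    by (rule DERIV_D)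
  moreover have "filterlim (\<lambda>n. - \<delta> n) (at 0) sequentially"
    using assms tendsto_minus[OF assms(1)] by (intro filterlim_atI) auto
  ultimately have "(\<lambda>n. ((r + - \<delta> n) ^ k - r ^ k) / - \<delta> n) \<longlonglongrightarrow> real k * r ^ (k - 1)"
    by (rule filterlim_compose)
  moreover have "((r + - \<delta> n) ^ k - r ^ k) / - \<delta> n = (r ^ k - (r - \<delta> n) ^ k) / \<delta> n" for n
    using assms(2)[of n] by (simp add: field_simps)
  ultimately show ?thesis by simp
qed

lemma unif_sphere_mean_zero: "(\<integral>e. e \<partial>unif_sphere) = (0 :: real ^ 'n::finite)"
proof -
  have "(\<integral>e. - e \<partial>unif_sphere) = (\<integral>e. e \<partial>unif_sphere :: real ^ 'n)"
    using integral_unif_sphere_uminus[of "\<lambda>e. e"] by simp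
  then have "- (\<integral>e. e \<partial>unif_sphere) = (\<integral>e. e \<partial>unif_sphere :: real ^ 'n)"
    by simp
  then have "(\<integral>e. e \<partial>unif_sphere) + (\<integral>e. e \<partial>unif_sphere) = (0 :: real ^ 'n)"
    by (metis add.right_inverse)
  then have "2 *\<^sub>R (\<integral>e. e \<partial>unif_sphere) = (0 :: real ^ 'n)"
    by (simp only: scaleR_2)
  then show ?thesis by (simp only: scaleR_eq_0_iff) simp
qed

text \<open>
  Since e has mean zero, f may be replaced by its increment from the centre. The bound is uniform
  in x, even for unbounded f; the uniform limit of derivatives below depends on this.
\<close>
lemma norm_sphere_average_le:
  fixes f :: "real ^ 'n::finite \<Rightarrow> real"
  assumes "L-lipschitz_on UNIV f" "0 \<le> r"
  shows "norm (\<integral>e. f (x + r *\<^sub>R e) *\<^sub>R e \<partial>unif_sphere) \<le> L * r"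
proof -
  interpret prob_space "unif_sphere :: (real ^ 'n) measure" by (rule prob_space_unif_sphere)
  have fc: "continuous_on UNIV f" by (rule lipschitz_on_continuous_on[OF assms(1)])
  have [measurable]: "f \<in> borel_measurable borel" by (rule borel_measurable_continuous_onI[OF fc])
  have bd: "\<bar>f (x + r *\<^sub>R e) - f x\<bar> \<le> L * r" if "norm e = 1" for e
    using lipschitz_onD[OF assms(1), of "x + r *\<^sub>R e" x] that assms(2) by (simp add: dist_norm)
  have i1: "integrable unif_sphere (\<lambda>e. (f (x + r *\<^sub>R e) - f x) *\<^sub>R e)"
    by (rule unif_sphere_integrable_bounded[where B="L * r"]) (use bd in auto)
  have i2: "integrable unif_sphere (\<lambda>e. f x *\<^sub>R e)"
    by (rule unif_sphere_integrable_bounded[where B="\<bar>f x\<bar>"]) auto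
  have "(\<integral>e. f (x + r *\<^sub>R e) *\<^sub>R e \<partial>unif_sphere) = (\<integral>e. (f (x + r *\<^sub>R e) - f x) *\<^sub>R e + f x *\<^sub>R e \<partial>unif_sphere)"
    by (simp add: algebra_simps)
  also have "\<dots> = (\<integral>e. (f (x + r *\<^sub>R e) - f x) *\<^sub>R e \<partial>unif_sphere)"
    using Bochner_Integration.integral_add[OF i1 i2] by (simp add: unif_sphere_mean_zero)
  finally have "norm (\<integral>e. f (x + r *\<^sub>R e) *\<^sub>R e \<partial>unif_sphere) \<le> (\<integral>e. norm ((f (x + r *\<^sub>R e) - f x) *\<^sub>R e) \<partial>unif_sphere)"
    by (simp only: integral_norm_bound)
  also have "\<dots> \<le> (\<integral>e. L * r \<partial>(unif_sphere :: (real ^ 'n) measure))"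
    by (intro integral_mono integrable_norm i1) (use bd in auto)
  finally show ?thesis using prob_space by simp
qed

text \<open>
  The divergence theorem for the ball, for a Lipschitz function. The difference of the cone
  averages with radii \<open>\<gamma>\<close> and \<open>\<gamma> - \<delta>\<close>, divided by \<open>\<delta>\<close>, is an average with a weight that equals 1 on the
  smaller ball and falls linearly to 0 across the shell between them. It converges to the ball
  average as \<open>\<delta>\<close> tends to 0. Its gradient is the integral of \<open>f (x + u) * sgn u\<close> over the shell; moving u
  radially to the outer sphere changes f by at most \<open>L * \<delta>\<close>, and then only the volume of the shell
  and a sphere average remain. The convergence of the gradients is uniform, so the limit may be
  differentiated.
\<close>
lemma smoothed_has_derivative:
  fixes f :: "real ^ 'n::finite \<Rightarrow> real"
  assumes f: "L-lipschitz_on UNIV f" and g: "0 < \<gamma>"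
  shows "(smoothed f \<gamma> has_derivative
     (\<lambda>h. ((real CARD('n) / \<gamma>) *\<^sub>R (\<integral>e. f (x + \<gamma> *\<^sub>R e) *\<^sub>R e \<partial>unif_sphere)) \<bullet> h)) (at x)"
proof -
  let ?d = "CARD('n)"
  define V where "V = (\<lambda>r. measure lborel (cball (0 :: real ^ 'n) r))"
  define v where "v = V 1"
  have fc: "continuous_on UNIV f" by (rule lipschitz_on_continuous_on[OF f])
  have L0: "0 \<le> L" using f by (rule lipschitz_on_nonneg)
  have fm[measurable]: "f \<in> borel_measurable borel" by (rule borel_measurable_continuous_onI[OF fc])
  have v: "0 < v" by (simp add: v_def V_def content_cball_pos)
  have Vr: "V r = v * r ^ ?d" if "0 \<le> r" for r
    using content_cball_scale[OF that, where 'a="real ^ 'n"] by (simp add: V_def v_def)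
  \<comment> \<open>Thickness of the shell; the offset 2 keeps the inner radius positive.\<close>
  define \<delta> where "\<delta> = (\<lambda>n. \<gamma> / real (n + 2))"
  have \<delta>: "0 < \<delta> n" "\<delta> n < \<gamma>" for n using g by (auto simp: \<delta>_def field_simps add_pos_nonneg)
  have \<delta>0: "\<delta> \<longlonglongrightarrow> 0" unfolding \<delta>_def by (rule LIMSEQ_ignore_initial_segment[OF lim_const_over_n])
  define E where "E = (\<lambda>x. \<integral>e. f (x + \<gamma> *\<^sub>R e) *\<^sub>R e \<partial>unif_sphere)"
  define P where "P = (\<lambda>r x. LINT u:cball 0 r|lborel. f (x + u) *\<^sub>R sgn u)"
  define J where "J = (\<lambda>r x. \<integral>u. f (x + u) * max 0 (r - norm u) \<partial>lborel)"
  define \<Phi> where "\<Phi> = (\<lambda>n x. (1 / (V \<gamma> * \<delta> n)) * (J \<gamma> x - J (\<gamma> - \<delta> n) x))"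
  define \<Phi>' where "\<Phi>' = (\<lambda>n x. (1 / (V \<gamma> * \<delta> n)) *\<^sub>R (P \<gamma> x - P (\<gamma> - \<delta> n) x))"
  define \<rho> where "\<rho> = (\<lambda>n. (V \<gamma> - V (\<gamma> - \<delta> n)) / (V \<gamma> * \<delta> n))"
  have V\<gamma>: "0 < V \<gamma>" using v g by (simp add: Vr)
  have \<rho>: "\<rho> \<longlonglongrightarrow> ?d / \<gamma>"
  proof -
    have "\<rho> n = (\<gamma> ^ ?d - (\<gamma> - \<delta> n) ^ ?d) / \<delta> n / \<gamma> ^ ?d" for n
      using v \<delta>[of n] g by (simp add: \<rho>_def Vr field_simps)
    then have "\<rho> = (\<lambda>n. (\<gamma> ^ ?d - (\<gamma> - \<delta> n) ^ ?d) / \<delta> n / \<gamma> ^ ?d)" by (rule ext)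
    moreover have "(\<lambda>n. (\<gamma> ^ ?d - (\<gamma> - \<delta> n) ^ ?d) / \<delta> n / \<gamma> ^ ?d) \<longlonglongrightarrow> real ?d * \<gamma> ^ (?d - 1) / \<gamma> ^ ?d"
      using \<delta> by (intro tendsto_divide power_difference_quotient \<delta>0 tendsto_const) (auto simp: less_imp_neq[symmetric] g)
    moreover have "real ?d * \<gamma> ^ (?d - 1) / \<gamma> ^ ?d = ?d / \<gamma>"
      using g power_Suc[of \<gamma> "?d - 1"] by (simp add: field_simps)
    ultimately show ?thesis by simp
  qed
  have mono: "V (\<gamma> - \<delta> n) \<le> V \<gamma>" for n
    using v \<delta>[of n] by (simp add: Vr less_imp_le power_mono)
  have \<rho>0: "0 \<le> \<rho> n" for n
    using mono[of n] \<delta>[of n] V\<gamma> by (simp add: \<rho>_def)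
  have der: "((\<Phi> n) has_derivative (\<lambda>h. \<Phi>' n x \<bullet> h)) (at x within UNIV)" for n x
  proof -
    have "((\<lambda>x. (1 / (V \<gamma> * \<delta> n)) * (J \<gamma> x - J (\<gamma> - \<delta> n) x)) has_derivative
        (\<lambda>h. (1 / (V \<gamma> * \<delta> n)) * (P \<gamma> x \<bullet> h - P (\<gamma> - \<delta> n) x \<bullet> h))) (at x)"
      unfolding J_def P_def using V\<gamma> \<delta>[of n] g
      by (intro has_derivative_mult_right has_derivative_diff cone_integral_has_derivative fc) auto
    then show ?thesis by (simp add: \<Phi>_def \<Phi>'_def inner_diff_left)
  qed
  have shell: "norm (\<Phi>' n x - (?d / \<gamma>) *\<^sub>R E x) \<le> \<bar>\<rho> n - ?d / \<gamma>\<bar> * (L * \<gamma>) + \<rho> n * (L * \<delta> n)" for n x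
  proof -
    define S where "S = cball (0 :: real ^ 'n) \<gamma> - cball 0 (\<gamma> - \<delta> n)"
    have sub: "cball (0 :: real ^ 'n) (\<gamma> - \<delta> n) \<subseteq> cball 0 \<gamma>" using \<delta>[of n] by auto
    have S: "S \<in> sets lborel" by (simp add: S_def)
    have diff: "(LINT u:cball 0 \<gamma>|lborel. h u) - (LINT u:cball 0 (\<gamma> - \<delta> n)|lborel. h u) = (LINT u:S|lborel. h u)"
      if "set_integrable lborel (cball 0 \<gamma>) h" for h :: "real ^ 'n \<Rightarrow> real ^ 'n"
    proof -
      have "set_integrable lborel S h" "set_integrable lborel (cball 0 (\<gamma> - \<delta> n)) h"
        using that sub by (auto simp: S_def intro: set_integrable_subset)
      then have "(LINT u:(S \<union> cball 0 (\<gamma> - \<delta> n))|lborel. h u) = (LINT u:S|lborel. h u) + (LINT u:cball 0 (\<gamma> - \<delta> n)|lborel. h u)"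
        by (intro set_integral_Un) (auto simp: S_def)
      moreover have "S \<union> cball 0 (\<gamma> - \<delta> n) = cball 0 \<gamma>" using sub by (auto simp: S_def)
      ultimately show ?thesis by simp
    qed
    obtain B where B: "\<And>u. u \<in> cball x \<gamma> \<Longrightarrow> \<bar>f u\<bar> \<le> B" using continuous_bounded_cball[OF fc] by blast
    have B0: "0 \<le> B" using B[of x] g by auto
    have Bs: "\<bar>f (x + u)\<bar> * norm (sgn w) \<le> B" if "norm u \<le> \<gamma>" for u w :: "real ^ 'n"
      using B[of "x + u"] that B0 by (auto simp: norm_sgn dist_norm)
    have i1: "set_integrable lborel (cball 0 \<gamma>) (\<lambda>u. f (x + u) *\<^sub>R sgn u)"
      by (rule integrable_on_cball_bounded[where B=B]) (use Bs in \<open>auto simp: dist_norm\<close>)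
    have i2: "set_integrable lborel (cball 0 \<gamma>) (\<lambda>u. f (x + \<gamma> *\<^sub>R sgn u) *\<^sub>R sgn u)"
      by (rule integrable_on_cball_bounded[where B=B]) (use Bs g B0 in \<open>auto simp: norm_sgn\<close>)
    have main: "(LINT u:S|lborel. f (x + \<gamma> *\<^sub>R sgn u) *\<^sub>R sgn u) = (V \<gamma> - V (\<gamma> - \<delta> n)) *\<^sub>R E x"
    proof -
      have "(LINT u:cball 0 r|lborel. f (x + \<gamma> *\<^sub>R sgn u) *\<^sub>R sgn u) = V r *\<^sub>R E x" if "0 < r" for r
        using cball_integral_sgn[of "\<lambda>e. f (x + \<gamma> *\<^sub>R e) *\<^sub>R e" r] that by (simp add: V_def E_def)
      then show ?thesis using diff[OF i2] g \<delta>[of n] by (simp add: scaleR_diff_left)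
    qed
    have i12: "set_integrable lborel S (\<lambda>u. f (x + u) *\<^sub>R sgn u - f (x + \<gamma> *\<^sub>R sgn u) *\<^sub>R sgn u)"
      using set_integral_diff(1)[OF i1 i2] by (rule set_integrable_subset) (auto simp: S_def)
    have iS: "set_integrable lborel S (\<lambda>u. f (x + u) *\<^sub>R sgn u)" "set_integrable lborel S (\<lambda>u. f (x + \<gamma> *\<^sub>R sgn u) *\<^sub>R sgn u)"
      using i1 i2 by (auto intro: set_integrable_subset simp: S_def)
    have "emeasure lborel S \<le> emeasure lborel (cball (0 :: real ^ 'n) \<gamma>)"
      by (intro emeasure_mono) (auto simp: S_def)
    then have fin: "emeasure lborel S < \<infinity>" using emeasure_lborel_cball_finite[of "0 :: real ^ 'n" \<gamma>] by simp
    have msS: "measure lborel S = V \<gamma> - V (\<gamma> - \<delta> n)"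
      unfolding S_def V_def using sub emeasure_lborel_cball_finite[of "0 :: real ^ 'n" \<gamma>]
      by (intro measure_Diff) auto
    define Rem where "Rem = (LINT u:S|lborel. f (x + u) *\<^sub>R sgn u - f (x + \<gamma> *\<^sub>R sgn u) *\<^sub>R sgn u)"
    have "norm Rem \<le> (LINT u:S|lborel. norm (f (x + u) *\<^sub>R sgn u - f (x + \<gamma> *\<^sub>R sgn u) *\<^sub>R sgn u))"
      unfolding Rem_def by (rule set_integral_norm_bound[OF i12])
    also have "\<dots> \<le> (LINT u:S|lborel. L * \<delta> n)"
    proof (rule set_integral_mono)
      show "set_integrable lborel S (\<lambda>u. norm (f (x + u) *\<^sub>R sgn u - f (x + \<gamma> *\<^sub>R sgn u) *\<^sub>R sgn u))"
        using set_integrable_norm[OF i12] by simp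
      show "set_integrable lborel S (\<lambda>u. L * \<delta> n)"
        using S fin by (simp add: set_integrable_def)
      fix u assume "u \<in> S"
      then have u: "norm u \<le> \<gamma>" "\<gamma> - \<delta> n < norm u" by (auto simp: S_def)
      then have nz: "u \<noteq> 0" using \<delta>[of n] by auto
      have "u - \<gamma> *\<^sub>R sgn u = (norm u - \<gamma>) *\<^sub>R sgn u"
        using nz by (simp add: sgn_div_norm scaleR_diff_left left_diff_distrib)
      then have "norm (u - \<gamma> *\<^sub>R sgn u) \<le> \<delta> n" using u nz by (simp add: norm_sgn)
      moreover have "\<bar>f (x + u) - f (x + \<gamma> *\<^sub>R sgn u)\<bar> \<le> L * norm (u - \<gamma> *\<^sub>R sgn u)"
        using lipschitz_onD[OF f, of "x + u" "x + \<gamma> *\<^sub>R sgn u"] by (simp add: dist_norm)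
      ultimately have "\<bar>f (x + u) - f (x + \<gamma> *\<^sub>R sgn u)\<bar> \<le> L * \<delta> n"
        using L0 by (meson mult_left_mono order_trans)
      then show "norm (f (x + u) *\<^sub>R sgn u - f (x + \<gamma> *\<^sub>R sgn u) *\<^sub>R sgn u) \<le> L * \<delta> n"
        using nz by (simp add: norm_sgn flip: scaleR_diff_left)
    qed
    also have "\<dots> = (V \<gamma> - V (\<gamma> - \<delta> n)) * (L * \<delta> n)"
      using set_integral_const[of S lborel "L * \<delta> n"] S fin by (simp add: msS less_top)
    finally have Rem: "norm Rem \<le> (V \<gamma> - V (\<gamma> - \<delta> n)) * (L * \<delta> n)" .
    have "P \<gamma> x - P (\<gamma> - \<delta> n) x = (LINT u:S|lborel. f (x + u) *\<^sub>R sgn u)"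
      unfolding P_def by (rule diff[OF i1])
    also have "\<dots> = (V \<gamma> - V (\<gamma> - \<delta> n)) *\<^sub>R E x + Rem"
      unfolding Rem_def using iS by (simp add: set_integral_diff main)
    finally have "\<Phi>' n x = \<rho> n *\<^sub>R E x + (1 / (V \<gamma> * \<delta> n)) *\<^sub>R Rem"
      by (simp add: \<Phi>'_def \<rho>_def scaleR_add_right)
    then have "\<Phi>' n x - (?d / \<gamma>) *\<^sub>R E x = (\<rho> n - ?d / \<gamma>) *\<^sub>R E x + (1 / (V \<gamma> * \<delta> n)) *\<^sub>R Rem"
      by (simp add: scaleR_diff_left)
    then have "norm (\<Phi>' n x - (?d / \<gamma>) *\<^sub>R E x) \<le> norm ((\<rho> n - ?d / \<gamma>) *\<^sub>R E x) + norm ((1 / (V \<gamma> * \<delta> n)) *\<^sub>R Rem)"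
      by (simp only: norm_triangle_ineq)
    also have "norm ((\<rho> n - ?d / \<gamma>) *\<^sub>R E x) \<le> \<bar>\<rho> n - ?d / \<gamma>\<bar> * (L * \<gamma>)"
      unfolding norm_scaleR E_def using g by (intro mult_left_mono norm_sphere_average_le f) auto
    also have "norm ((1 / (V \<gamma> * \<delta> n)) *\<^sub>R Rem) \<le> (1 / (V \<gamma> * \<delta> n)) * ((V \<gamma> - V (\<gamma> - \<delta> n)) * (L * \<delta> n))"
      unfolding norm_scaleR using V\<gamma> \<delta>[of n] Rem by (intro mult_mono) auto
    also have "\<dots> = \<rho> n * (L * \<delta> n)" by (simp add: \<rho>_def)
    finally show ?thesis by simp
  qed
  have eta: "(\<lambda>n. \<bar>\<rho> n - ?d / \<gamma>\<bar> * (L * \<gamma>) + \<rho> n * (L * \<delta> n)) \<longlonglongrightarrow> 0"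
  proof -
    have "(\<lambda>n. \<bar>\<rho> n - ?d / \<gamma>\<bar> * (L * \<gamma>) + \<rho> n * (L * \<delta> n)) \<longlonglongrightarrow> \<bar>?d / \<gamma> - ?d / \<gamma>\<bar> * (L * \<gamma>) + ?d / \<gamma> * (L * 0)"
      by (intro tendsto_intros \<rho> \<delta>0)
    then show ?thesis by simp
  qed
  have conv: "(\<lambda>n. \<Phi> n x) \<longlonglongrightarrow> smoothed f \<gamma> x" for x
  proof -
    define \<psi> where "\<psi> = (\<lambda>n (u :: real ^ 'n). (max 0 (\<gamma> - norm u) - max 0 (\<gamma> - \<delta> n - norm u)) / \<delta> n)"
    have \<psi>01: "\<bar>\<psi> n u\<bar> \<le> indicator (cball 0 \<gamma>) u" for n u
      using \<delta>[of n] by (auto simp: \<psi>_def max_def indicator_def field_simps)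
    obtain B where B: "\<And>u. u \<in> cball x \<gamma> \<Longrightarrow> \<bar>f u\<bar> \<le> B" using continuous_bounded_cball[OF fc] by blast
    have wint: "set_integrable lborel (cball 0 \<gamma>) (\<lambda>u. \<bar>f (x + u)\<bar>)"
      by (rule integrable_on_cball_bounded[where B=B]) (use B in \<open>auto simp: dist_norm\<close>)
    have Jint: "integrable lborel (\<lambda>u. f (x + u) * max 0 (r - norm u))" if "r \<le> \<gamma>" for r
    proof (rule Bochner_Integration.integrable_bound)
      show "integrable lborel (\<lambda>u. \<gamma> * (indicator (cball 0 \<gamma>) u *\<^sub>R \<bar>f (x + u)\<bar>))"
        using wint unfolding set_integrable_def by (rule integrable_mult_right)
      show "AE u in lborel. norm (f (x + u) * max 0 (r - norm u)) \<le> norm (\<gamma> * (indicator (cball 0 \<gamma>) u *\<^sub>R \<bar>f (x + u)\<bar>))"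
      proof (rule AE_I2)
        fix u :: "real ^ 'n"
        have "r - norm u \<le> \<gamma>" using that norm_ge_zero[of u] by linarith
        then have "\<bar>max 0 (r - norm u)\<bar> \<le> \<gamma> * indicator (cball 0 \<gamma>) u"
          using that g by (auto simp: indicator_def)
        from mult_left_mono[OF this, of "\<bar>f (x + u)\<bar>"]
        show "norm (f (x + u) * max 0 (r - norm u)) \<le> norm (\<gamma> * (indicator (cball 0 \<gamma>) u *\<^sub>R \<bar>f (x + u)\<bar>))"
          using g by (simp add: abs_mult mult_ac)
      qed
    qed measurable
    have \<Phi>\<psi>: "\<Phi> n x = (\<integral>u. f (x + u) * \<psi> n u \<partial>lborel) / V \<gamma>" for n
    proof -
      have "J \<gamma> x - J (\<gamma> - \<delta> n) x = (\<integral>u. f (x + u) * max 0 (\<gamma> - norm u) - f (x + u) * max 0 (\<gamma> - \<delta> n - norm u) \<partial>lborel)"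
        unfolding J_def using \<delta>[of n] by (subst Bochner_Integration.integral_diff) (auto intro: Jint)
      also have "\<dots> = (\<integral>u. \<delta> n * (f (x + u) * \<psi> n u) \<partial>lborel)"
        using \<delta>[of n] by (intro Bochner_Integration.integral_cong) (auto simp: \<psi>_def right_diff_distrib diff_divide_distrib)
      finally show ?thesis using \<delta>[of n] by (simp add: \<Phi>_def)
    qed
    have "(\<lambda>n. \<integral>u. f (x + u) * \<psi> n u \<partial>lborel) \<longlonglongrightarrow> (\<integral>u. indicator (cball 0 \<gamma>) u *\<^sub>R f (x + u) \<partial>lborel)"
    proof (rule integral_dominated_convergence[where w="\<lambda>u. indicator (cball 0 \<gamma>) u *\<^sub>R \<bar>f (x + u)\<bar>"])
      show "(\<lambda>u. indicator (cball 0 \<gamma>) u *\<^sub>R f (x + u)) \<in> borel_measurable lborel"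
        by (intro borel_measurable_scaleR borel_measurable_indicator) auto
      show "(\<lambda>u. f (x + u) * \<psi> n u) \<in> borel_measurable lborel" for n unfolding \<psi>_def by measurable
      show "integrable lborel (\<lambda>u. indicator (cball 0 \<gamma>) u *\<^sub>R \<bar>f (x + u)\<bar>)"
        using wint by (simp add: set_integrable_def)
      show "AE u in lborel. norm (f (x + u) * \<psi> n u) \<le> indicator (cball 0 \<gamma>) u *\<^sub>R \<bar>f (x + u)\<bar>" for n
      proof (rule AE_I2)
        show "norm (f (x + u) * \<psi> n u) \<le> indicator (cball 0 \<gamma>) u *\<^sub>R \<bar>f (x + u)\<bar>" for u
          using mult_left_mono[OF \<psi>01[of n u], of "\<bar>f (x + u)\<bar>"] by (simp add: abs_mult mult.commute)
      qed
      have "sphere (0 :: real ^ 'n) \<gamma> \<in> null_sets lborel"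
        using negligible_sphere[of "0 :: real ^ 'n" \<gamma>] by (auto simp: null_sets_completion_iff negligible_iff_null_sets)
      then have "AE u in lborel. u \<notin> sphere (0 :: real ^ 'n) \<gamma>" by (rule AE_not_in)
      then show "AE u in lborel. (\<lambda>n. f (x + u) * \<psi> n u) \<longlonglongrightarrow> indicator (cball 0 \<gamma>) u *\<^sub>R f (x + u)"
      proof eventually_elim
        case (elim u)
        have "(\<lambda>n. \<psi> n u) \<longlonglongrightarrow> indicator (cball 0 \<gamma>) u"
        proof (cases "norm u < \<gamma>")
          case True
          then have "eventually (\<lambda>n. \<delta> n < \<gamma> - norm u) sequentially"
            using \<delta>0 by (intro order_tendstoD) auto
          then have "eventually (\<lambda>n. \<psi> n u = indicator (cball 0 \<gamma>) u) sequentially"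
          proof eventually_elim
            case (elim n)
            then show ?case using \<delta>[of n] by (simp add: \<psi>_def)
          qed
          then show ?thesis by (simp add: tendsto_eventually)
        next
          case False
          then have "\<psi> n u = indicator (cball 0 \<gamma>) u" for n
            using \<delta>[of n] elim by (simp add: \<psi>_def)
          then show ?thesis by simp
        qed
        then have "(\<lambda>n. f (x + u) * \<psi> n u) \<longlonglongrightarrow> f (x + u) * indicator (cball 0 \<gamma>) u"
          by (intro tendsto_intros)
        then show ?case by (simp add: mult.commute)
      qed
    qed
    then have "(\<lambda>n. (\<integral>u. f (x + u) * \<psi> n u \<partial>lborel) / V \<gamma>) \<longlonglongrightarrow> (\<integral>u. indicator (cball 0 \<gamma>) u *\<^sub>R f (x + u) \<partial>lborel) / V \<gamma>"
      using V\<gamma> by (intro tendsto_divide tendsto_const) auto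
    moreover have "smoothed f \<gamma> x = (\<integral>u. indicator (cball 0 \<gamma>) u *\<^sub>R f (x + u) \<partial>lborel) / V \<gamma>"
      unfolding smoothed_def using g by (subst integral_unif_ball) (auto simp: set_lebesgue_integral_def V_def)
    ultimately show ?thesis by (simp add: \<Phi>\<psi>)
  qed
  have nle: "\<forall>\<^sub>F n in sequentially. \<forall>x\<in>UNIV. \<forall>h. norm (\<Phi>' n x \<bullet> h - ((?d / \<gamma>) *\<^sub>R E x) \<bullet> h) \<le> e * norm h" if "0 < e" for e
    using order_tendstoD(2)[OF eta that]
  proof eventually_elim
    case (elim n)
    show ?case
    proof (intro ballI allI)
      fix x h
      have "norm (\<Phi>' n x \<bullet> h - ((?d / \<gamma>) *\<^sub>R E x) \<bullet> h) \<le> norm (\<Phi>' n x - (?d / \<gamma>) *\<^sub>R E x) * norm h"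
        using Cauchy_Schwarz_ineq2[of "\<Phi>' n x - (?d / \<gamma>) *\<^sub>R E x" h] by (simp add: inner_diff_left)
      also have "\<dots> \<le> e * norm h"
        using order_trans[OF shell[of n x] less_imp_le[OF elim]] by (rule mult_right_mono) simp
      finally show "norm (\<Phi>' n x \<bullet> h - ((?d / \<gamma>) *\<^sub>R E x) \<bullet> h) \<le> e * norm h" .
    qed
  qed
  obtain G where G: "\<And>x. (\<lambda>n. \<Phi> n x) \<longlonglongrightarrow> G x"
      "\<And>x. (G has_derivative (\<lambda>h. ((?d / \<gamma>) *\<^sub>R E x) \<bullet> h)) (at x)"
    using has_derivative_sequence[OF convex_UNIV der nle UNIV_I conv] by auto
  have "G = smoothed f \<gamma>" using LIMSEQ_unique[OF G(1) conv] by auto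
  with G(2)[of x] show ?thesis by (simp add: E_def)
qed

section \<open>Moments of the uniform distribution on the sphere\<close>

text \<open>
  The same gradient computed in two ways: as a sphere average by the previous section, and by
  differentiating f itself under the integral. Applied to monomials, this integration by parts
  yields the even moments of the sphere.
\<close>
lemma ball_mean_gradient:
  fixes f :: "real ^ 'n::finite \<Rightarrow> real"
  assumes f: "L-lipschitz_on UNIV f" and r: "0 < r"
    and g[measurable]: "g \<in> borel_measurable borel"
    and der: "\<And>z. norm z \<le> r \<Longrightarrow> (f has_derivative (\<lambda>h. g z \<bullet> h)) (at z)"
    and gL: "\<And>z. norm z \<le> r \<Longrightarrow> norm (g z) \<le> L"
  shows "(\<integral>u. g u \<partial>unif_ball r) = (real CARD('n) / r) *\<^sub>R (\<integral>e. f (r *\<^sub>R e) *\<^sub>R e \<partial>unif_sphere)"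
proof -
  interpret prob_space "unif_ball r :: (real ^ 'n) measure" by (rule prob_space_unif_ball) fact
  have fc: "continuous_on UNIV f" by (rule lipschitz_on_continuous_on[OF f])
  have fm[measurable]: "f \<in> borel_measurable borel" by (rule borel_measurable_continuous_onI[OF fc])
  have 1: "(smoothed f r has_derivative (\<lambda>h. (\<integral>u. g u \<partial>unif_ball r) \<bullet> h)) (at 0)"
    unfolding smoothed_def
  proof (rule has_derivative_integral_dominated[where S = UNIV and w = "\<lambda>_. L"])
    show "integrable (unif_ball r) (\<lambda>u. f (y + u))" for y
    proof -
      obtain B where "\<And>u. u \<in> cball y r \<Longrightarrow> \<bar>f u\<bar> \<le> B" using continuous_bounded_cball[OF fc] by blast
      then show ?thesis by (intro unif_ball_integrable_bounded[where B=B] r) (auto simp: dist_norm)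
    qed
    show "g \<in> borel_measurable (unif_ball r)" by (rule measurable_unif_ballI) fact
    show "AE u in unif_ball r. ((\<lambda>y. f (y + u)) has_derivative (\<lambda>h. g u \<bullet> h)) (at 0)"
    proof (rule AE_I2)
      fix u assume "u \<in> space (unif_ball r :: (real ^ 'n) measure)"
      then have "(f has_derivative (\<lambda>h. g u \<bullet> h)) (at (0 + u))" using der by simp
      moreover have "((\<lambda>y. y + u) has_derivative (\<lambda>h. h)) (at 0)" by (auto intro!: derivative_eq_intros)
      ultimately show "((\<lambda>y. f (y + u)) has_derivative (\<lambda>h. g u \<bullet> h)) (at 0)"
        using diff_chain_at[of "\<lambda>y. y + u" "\<lambda>h. h" 0 f "\<lambda>h. g u \<bullet> h"] by (simp add: comp_def)
    qed
    show "\<bar>f (y + u) - f (0 + u)\<bar> \<le> L * norm (y - 0)" for y u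
      using lipschitz_onD[OF f, of "y + u" "0 + u"] by (simp add: dist_norm)
  qed (use gL in auto)
  have 2: "(smoothed f r has_derivative
     (\<lambda>h. ((real CARD('n) / r) *\<^sub>R (\<integral>e. f (r *\<^sub>R e) *\<^sub>R e \<partial>unif_sphere)) \<bullet> h)) (at 0)"
    using smoothed_has_derivative[OF f r, of 0] by simp
  show ?thesis
    by (rule vector_eq_rdot[THEN iffD1], rule allI, rule fun_cong[OF has_derivative_unique[OF 1 2]])
qed

text \<open>
  Integration by parts for the linear function \<open>\<lambda>u. u \<bullet> v\<close>, whose gradient is constant.
\<close>
lemma sphere_second_moment:
  fixes v :: "real ^ 'n::finite"
  shows "(\<integral>e. (e \<bullet> v)\<^sup>2 \<partial>unif_sphere) = (norm v)\<^sup>2 / CARD('n)"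
proof -
  interpret prob_space "unif_ball 1 :: (real ^ 'n) measure" by (rule prob_space_unif_ball) simp
  have "(norm v)-lipschitz_on UNIV (\<lambda>u. u \<bullet> v)"
  proof (rule lipschitz_onI)
    fix x y :: "real ^ 'n"
    show "dist (x \<bullet> v) (y \<bullet> v) \<le> norm v * dist x y"
      using Cauchy_Schwarz_ineq2[of "x - y" v] by (simp add: dist_norm inner_diff_left mult.commute)
  qed simp
  then have "(\<integral>u. v \<partial>(unif_ball 1 :: (real ^ 'n) measure)) = (real CARD('n) / 1) *\<^sub>R (\<integral>e. ((1 *\<^sub>R e) \<bullet> v) *\<^sub>R e \<partial>unif_sphere)"
    by (rule ball_mean_gradient) (auto intro!: derivative_eq_intros simp: inner_commute)
  then have eq: "v = real CARD('n) *\<^sub>R (\<integral>e. (e \<bullet> v) *\<^sub>R e \<partial>unif_sphere)" using prob_space by simp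
  have int: "integrable unif_sphere (\<lambda>e. (e \<bullet> v) *\<^sub>R e)"
  proof (rule unif_sphere_integrable_bounded[where B = "norm v"])
    show "norm ((e \<bullet> v) *\<^sub>R e) \<le> norm v" if "norm e = 1" for e
      using Cauchy_Schwarz_ineq2[of e v] that by simp
  qed simp
  have "(norm v)\<^sup>2 = v \<bullet> v" by (simp add: dot_square_norm)
  also have "\<dots> = (real CARD('n) *\<^sub>R (\<integral>e. (e \<bullet> v) *\<^sub>R e \<partial>unif_sphere)) \<bullet> v" using eq by simp
  also have "\<dots> = real CARD('n) * (\<integral>e. (e \<bullet> v)\<^sup>2 \<partial>unif_sphere)"
    using int by (simp add: power2_eq_square flip: integral_inner_left)
  finally show ?thesis by (simp add: field_simps)
qed

lemma integral_unif_ball_sgn: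
  fixes h :: "real ^ 'n::finite \<Rightarrow> 'b::{banach, second_countable_topology}"
  assumes [measurable]: "h \<in> borel_measurable borel" and "0 < r"
  shows "(\<integral>u. h (sgn u) \<partial>unif_ball r) = (\<integral>e. h e \<partial>unif_sphere)"
proof -
  have "0 < measure lborel (cball (0 :: real ^ 'n) r)" using assms(2) by (simp add: content_cball_pos)
  then show ?thesis using assms(2) by (simp add: integral_unif_ball cball_integral_sgn)
qed

text \<open>
  Integration by parts for \<open>u\<^sub>i ^ (2 k + 1)\<close>. The boundary term is the moment of order \<open>2 k + 2\<close>, and
  the gradient term is a moment of order \<open>2 k\<close> over the ball, which is at most the same moment over the
  sphere because points of the ball are shorter.
\<close>
lemma sphere_moment_recursion:
  fixes i :: "'n::finite"
  shows "(\<integral>e. (e $ i) ^ (2 * k + 2) \<partial>unif_sphere) \<le> (2 * k + 1) / CARD('n) * (\<integral>e. (e $ i) ^ (2 * k) \<partial>unif_sphere)"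
proof -
  define m where "m = 2 * k + 1"
  \<comment> \<open>The Lipschitz bound is needed on the whole space, so the coordinate is clipped at 1; the radius
    1/2 leaves room for differentiating where the clipping is inactive.\<close>
  define clip where "clip = (\<lambda>c::real. max (-1) (min 1 c))"
  define f where "f = (\<lambda>u :: real ^ 'n. clip (u $ i) ^ m)"
  define g where "g = (\<lambda>u :: real ^ 'n. (real m * (u $ i) ^ (2 * k)) *\<^sub>R axis i (1::real))"
  let ?r = "1 / 2 :: real"
  have comp: "\<bar>u $ i\<bar> \<le> norm u" for u :: "real ^ 'n" by (rule component_le_norm_cart)
  have clip1: "\<bar>clip c\<bar> \<le> 1" and cliplip: "\<bar>clip c - clip c'\<bar> \<le> \<bar>c - c'\<bar>" for c c'
    by (auto simp: clip_def)
  have clip_id: "clip c = c" if "\<bar>c\<bar> \<le> 1" for c using that by (auto simp: clip_def)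
  have lip: "(real m)-lipschitz_on UNIV f"
  proof (rule lipschitz_onI)
    fix x y :: "real ^ 'n"
    have "\<bar>clip (x $ i) ^ m - clip (y $ i) ^ m\<bar> \<le> m * \<bar>clip (x $ i) - clip (y $ i)\<bar>"
      using norm_power_diff[of "clip (x $ i)" "clip (y $ i)" m] clip1 by simp
    also have "\<dots> \<le> m * norm (x - y)"
      using order_trans[OF cliplip[of "x $ i" "y $ i"] comp[of "x - y", simplified]] by (intro mult_left_mono) auto
    finally show "dist (f x) (f y) \<le> m * dist x y" by (simp add: f_def dist_norm)
  qed simp
  have "(\<integral>u. g u \<partial>unif_ball ?r) = (real CARD('n) / ?r) *\<^sub>R (\<integral>e. f (?r *\<^sub>R e) *\<^sub>R e \<partial>unif_sphere)"
  proof (rule ball_mean_gradient[OF lip])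
    show "g \<in> borel_measurable borel" unfolding g_def by measurable
    fix z :: "real ^ 'n" assume z: "norm z \<le> ?r"
    have zi: "\<bar>z $ i\<bar> \<le> ?r" using comp[of z] z by simp
    have "((\<lambda>u :: real ^ 'n. (u $ i) ^ m) has_derivative (\<lambda>h. real m * (z $ i) ^ (m - 1) * h $ i)) (at z)"
      by (auto intro!: derivative_eq_intros bounded_linear_imp_has_derivative[OF bounded_linear_vec_nth] simp: mult_ac)
    then have "(f has_derivative (\<lambda>h. real m * (z $ i) ^ (m - 1) * h $ i)) (at z)"
    proof (rule has_derivative_transform_within_open[of _ _ _ _ "ball 0 1"])
      fix u :: "real ^ 'n" assume "u \<in> ball 0 1"
      then have "\<bar>u $ i\<bar> \<le> 1" using comp[of u] by simp
      then show "(u $ i) ^ m = f u" by (simp add: f_def clip_id)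
    qed (use z in auto)
    then show "(f has_derivative (\<lambda>h. g z \<bullet> h)) (at z)"
      by (simp add: g_def m_def inner_commute mult_ac flip: cart_eq_inner_axis)
    have "\<bar>z $ i\<bar> ^ (2 * k) \<le> 1" using zi by (intro power_le_one) auto
    then show "norm (g z) \<le> real m" by (simp add: g_def power_abs abs_mult mult_left_le)
  qed simp
  then have "(\<integral>u. g u \<partial>unif_ball ?r) \<bullet> axis i 1 = ((real CARD('n) / ?r) *\<^sub>R (\<integral>e. f (?r *\<^sub>R e) *\<^sub>R e \<partial>unif_sphere)) \<bullet> axis i 1"
    by simp
  moreover have "(\<integral>u. g u \<partial>unif_ball ?r) \<bullet> axis i 1 = real m * (\<integral>u. (u $ i) ^ (2 * k) \<partial>unif_ball ?r)"
  proof -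
    have "integrable (unif_ball ?r) g"
    proof (rule unif_ball_integrable_bounded[where B = m])
      fix u :: "real ^ 'n" assume "norm u \<le> ?r"
      then have "\<bar>u $ i\<bar> ^ (2 * k) \<le> 1" using comp[of u] by (intro power_le_one) auto
      then show "norm (g u) \<le> m" by (simp add: g_def power_abs abs_mult mult_left_le)
    qed (auto simp: g_def)
    then have "(\<integral>u. g u \<partial>unif_ball ?r) \<bullet> axis i 1 = (\<integral>u. g u \<bullet> axis i 1 \<partial>unif_ball ?r)" by simp
    also have "\<dots> = (\<integral>u. real m * (u $ i) ^ (2 * k) \<partial>unif_ball ?r)"
      by (simp add: g_def inner_axis_axis)
    finally show ?thesis by simp
  qed
  moreover have "((real CARD('n) / ?r) *\<^sub>R (\<integral>e. f (?r *\<^sub>R e) *\<^sub>R e \<partial>unif_sphere)) \<bullet> axis i 1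
      = real CARD('n) * ?r ^ (2 * k) * (\<integral>e. (e $ i) ^ (2 * k + 2) \<partial>unif_sphere)"
  proof -
    have fm: "f \<in> borel_measurable borel" unfolding f_def clip_def by measurable
    have "integrable unif_sphere (\<lambda>e. f (?r *\<^sub>R e) *\<^sub>R e)"
    proof (rule unif_sphere_integrable_bounded[where B = 1])
      show "(\<lambda>e. f (?r *\<^sub>R e) *\<^sub>R e) \<in> borel_measurable borel" using fm by measurable
      fix e :: "real ^ 'n" assume "norm e = 1"
      then show "norm (f (?r *\<^sub>R e) *\<^sub>R e) \<le> 1"
        using clip1[of "(?r *\<^sub>R e) $ i"] by (simp add: f_def power_abs power_le_one)
    qed
    then have "(\<integral>e. f (?r *\<^sub>R e) *\<^sub>R e \<partial>unif_sphere) \<bullet> axis i 1 = (\<integral>e. (f (?r *\<^sub>R e) *\<^sub>R e) \<bullet> axis i 1 \<partial>unif_sphere)"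
      by (intro integral_inner_left[symmetric])
    also have "\<dots> = (\<integral>e. ?r ^ m * (e $ i) ^ (2 * k + 2) \<partial>unif_sphere)"
    proof (rule Bochner_Integration.integral_cong[OF refl])
      fix e :: "real ^ 'n" assume "e \<in> space unif_sphere"
      then have "\<bar>e $ i\<bar> \<le> 1" using comp[of e] by simp
      then have "f (?r *\<^sub>R e) = (?r * e $ i) ^ m" by (simp add: f_def clip_id)
      then show "(f (?r *\<^sub>R e) *\<^sub>R e) \<bullet> axis i 1 = ?r ^ m * (e $ i) ^ (2 * k + 2)"
        by (simp only: power_mult_distrib) (simp add: m_def inner_axis)
    qed
    finally show ?thesis by (simp add: m_def power_divide)
  qed
  ultimately have eq: "real m * (\<integral>u. (u $ i) ^ (2 * k) \<partial>unif_ball ?r)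
      = real CARD('n) * ?r ^ (2 * k) * (\<integral>e. (e $ i) ^ (2 * k + 2) \<partial>(unif_sphere :: (real ^ 'n) measure))" by simp
  have "(\<integral>u. (u $ i) ^ (2 * k) \<partial>unif_ball ?r) \<le> (\<integral>u. ?r ^ (2 * k) * (sgn u $ i) ^ (2 * k) \<partial>unif_ball ?r)"
  proof (rule integral_mono)
    have b1: "(u $ i) ^ (2 * k) \<le> ?r ^ (2 * k) * (sgn u $ i) ^ (2 * k)" if "norm u \<le> ?r" for u :: "real ^ 'n"
    proof -
      have "u = norm u *\<^sub>R sgn u" by (cases "u = 0") (simp_all add: sgn_div_norm)
      from arg_cong[OF this, of "\<lambda>v. v $ i"] have "u $ i = norm u * sgn u $ i"
        by (simp only: vector_scaleR_component real_scaleR_def)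
      then have "(u $ i) ^ (2 * k) = norm u ^ (2 * k) * (sgn u $ i) ^ (2 * k)"
        by (simp only: power_mult_distrib)
      also have "\<dots> \<le> ?r ^ (2 * k) * (sgn u $ i) ^ (2 * k)"
        using that by (intro mult_right_mono power_mono) auto
      finally show ?thesis .
    qed
    have b2: "(sgn u $ i) ^ (2 * k) \<le> 1" for u :: "real ^ 'n"
    proof -
      have "\<bar>sgn u $ i\<bar> \<le> 1" using comp[of "sgn u"] by (simp add: norm_sgn split: if_splits)
      then have "\<bar>sgn u $ i\<bar> ^ (2 * k) \<le> 1" by (intro power_le_one) auto
      then show ?thesis by (simp add: power_even_abs)
    qed
    show "integrable (unif_ball ?r) (\<lambda>u :: real ^ 'n. (u $ i) ^ (2 * k))"
    proof (rule unif_ball_integrable_bounded[where B = 1])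
      fix u :: "real ^ 'n" assume "norm u \<le> ?r"
      then have "\<bar>u $ i\<bar> ^ (2 * k) \<le> 1" using comp[of u] by (intro power_le_one) auto
      then show "norm ((u $ i) ^ (2 * k)) \<le> 1" by (simp add: power_abs)
    qed auto
    show "integrable (unif_ball ?r) (\<lambda>u :: real ^ 'n. ?r ^ (2 * k) * (sgn u $ i) ^ (2 * k))"
    proof (intro integrable_mult_right unif_ball_integrable_bounded[where B = 1])
      show "(\<lambda>u :: real ^ 'n. (sgn u $ i) ^ (2 * k)) \<in> borel_measurable borel"
        by (rule measurable_compose[OF borel_measurable_sgn, of "\<lambda>e. (e $ i) ^ (2 * k)"]) simp
    qed (use b2 in auto)
    show "(u $ i) ^ (2 * k) \<le> ?r ^ (2 * k) * (sgn u $ i) ^ (2 * k)"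
      if "u \<in> space (unif_ball ?r)" for u :: "real ^ 'n"
      using that by (intro b1) simp
  qed
  also have "\<dots> = ?r ^ (2 * k) * (\<integral>e. (e $ i) ^ (2 * k) \<partial>(unif_sphere :: (real ^ 'n) measure))"
    using integral_unif_ball_sgn[of "\<lambda>e :: real ^ 'n. (e $ i) ^ (2 * k)" ?r] by simp
  finally have "real m * (\<integral>u. (u $ i) ^ (2 * k) \<partial>(unif_ball ?r :: (real ^ 'n) measure))
      \<le> ?r ^ (2 * k) * (real m * (\<integral>e. (e $ i) ^ (2 * k) \<partial>(unif_sphere :: (real ^ 'n) measure)))"
    by (simp add: mult_ac mult_left_mono)
  then have "?r ^ (2 * k) * (real CARD('n) * (\<integral>e. (e $ i) ^ (2 * k + 2) \<partial>(unif_sphere :: (real ^ 'n) measure)))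
      \<le> ?r ^ (2 * k) * (real m * (\<integral>e. (e $ i) ^ (2 * k) \<partial>(unif_sphere :: (real ^ 'n) measure)))"
    unfolding eq by (simp only: mult_ac)
  then have "real CARD('n) * (\<integral>e. (e $ i) ^ (2 * k + 2) \<partial>(unif_sphere :: (real ^ 'n) measure))
      \<le> real m * (\<integral>e. (e $ i) ^ (2 * k) \<partial>(unif_sphere :: (real ^ 'n) measure))"
    by (rule mult_left_le_imp_le) simp
  then show ?thesis by (simp add: m_def field_simps)
qed

lemma sphere_moment_le:
  fixes i :: "'n::finite"
  assumes "k \<le> K"
  shows "(\<integral>e. (e $ i) ^ (2 * k) \<partial>unif_sphere) \<le> (2 * real K / CARD('n)) ^ k"
  using assms
proof (induction k)
  case 0
  interpret prob_space "unif_sphere :: (real ^ 'n) measure" by (rule prob_space_unif_sphere)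
  show ?case using prob_space by simp
next
  case (Suc k)
  have "(\<integral>e. (e $ i) ^ (2 * Suc k) \<partial>unif_sphere) \<le> (2 * k + 1) / CARD('n) * (\<integral>e. (e $ i) ^ (2 * k) \<partial>unif_sphere)"
    using sphere_moment_recursion[where i=i and k=k] by (simp add: add.commute)
  also have "\<dots> \<le> (2 * real K / CARD('n)) * (2 * real K / CARD('n)) ^ k"
    using Suc by (intro mult_mono divide_right_mono Bochner_Integration.integral_nonneg) (auto simp: power_mult)
  finally show ?case by simp
qed

section \<open>Two-sided bounds on the constant kappa\<close>

lemma lp_norm_conj_sphere_le_1:
  assumes "1 \<le> p" "p \<le> 2" "norm e = 1"
  shows "lp_norm (conj_exponent p) e ^ 4 \<le> 1"
  using lp_norm_conj_le_norm[OF assms(1,2), of e] assms(3) lp_norm_nonneg[of "conj_exponent p" e]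
  by (simp add: power_le_one)

lemma integrable_lp_norm_sphere:
  assumes "1 \<le> p" "p \<le> 2"
  shows "integrable (unif_sphere :: (real ^ 'n::finite) measure) (\<lambda>e. lp_norm (conj_exponent p) e ^ 4)"
  by (rule unif_sphere_integrable_bounded[where B = 1])
    (use lp_norm_conj_sphere_le_1[OF assms] lp_norm_nonneg in \<open>auto simp: power_abs\<close>)

lemma kappa_ge:
  assumes "1 \<le> p" "p \<le> 2" "0 \<le> c"
    and b: "\<And>e :: real ^ 'n::finite. norm e = 1 \<Longrightarrow> b \<le> lp_norm (conj_exponent p) e ^ 4"
  shows "c * sqrt b \<le> kappa TYPE('n) c p"
proof -
  interpret prob_space "unif_sphere :: (real ^ 'n) measure" by (rule prob_space_unif_sphere)
  have "b = (\<integral>e. b \<partial>(unif_sphere :: (real ^ 'n) measure))" using prob_space by simp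
  also have "\<dots> \<le> (\<integral>e. lp_norm (conj_exponent p) e ^ 4 \<partial>(unif_sphere :: (real ^ 'n) measure))"
    by (intro integral_mono integrable_lp_norm_sphere assms) (use b in auto)
  finally show ?thesis unfolding kappa_def using assms(3) by (intro mult_left_mono real_sqrt_le_mono)
qed

lemma kappa_nonneg: "0 \<le> c \<Longrightarrow> 0 \<le> kappa TYPE('n::finite) c p"
  by (simp add: kappa_def lp_norm_nonneg)

lemma kappa_2: "kappa TYPE('n::finite) c 2 = c"
proof -
  interpret prob_space "unif_sphere :: (real ^ 'n) measure" by (rule prob_space_unif_sphere)
  have "(\<integral>e. lp_norm (conj_exponent 2) e ^ 4 \<partial>(unif_sphere :: (real ^ 'n) measure)) = (\<integral>e. 1 \<partial>(unif_sphere :: (real ^ 'n) measure))"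
    by (rule Bochner_Integration.integral_cong) (auto simp: conj_exponent_2 lp_norm_2)
  then show ?thesis using prob_space by (simp add: kappa_def)
qed

lemma kappa_ge_p1:
  assumes "0 \<le> c"
  shows "c / CARD('n) \<le> kappa TYPE('n::finite) c 1"
  using kappa_ge[of 1 c "1 / (real CARD('n))\<^sup>2", where 'n='n] infnorm_pow4_ge[where 'n='n] assms
  by (simp add: conj_exponent_def lp_norm_def real_sqrt_divide)

text \<open>
  The threshold 4/3 is where the conjugate exponent equals 4, the power that defines kappa.
\<close>
lemma kappa_ge_p_ge_4_3:
  assumes "4 / 3 \<le> p" "p \<le> 2" "0 \<le> c"
  shows "c / sqrt (CARD('n)) \<le> kappa TYPE('n::finite) c p"
proof -
  have "p / (p - 1) \<le> 4" "0 < p / (p - 1)" using assms by (auto simp: field_simps)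
  then have "1 / real CARD('n) \<le> lp_norm (conj_exponent p) e ^ 4" if "norm e = 1" for e :: "real ^ 'n"
    using lp_norm_pow4_ge[OF that] assms by (simp add: conj_exponent_def)
  from kappa_ge[OF _ assms(2,3) this] show ?thesis using assms by (simp add: real_sqrt_divide)
qed

lemma infnorm_attained:
  fixes x :: "real ^ 'n::finite"
  obtains i where "infnorm x = \<bar>x $ i\<bar>"
proof -
  have "infnorm x \<in> (\<lambda>i. \<bar>x \<bullet> i\<bar>) ` Basis"
    unfolding infnorm_Max by (rule Max_in) auto
  then obtain b where b: "b \<in> Basis" "infnorm x = \<bar>x \<bullet> b\<bar>" by blast
  then obtain i where "b = axis i 1" by (auto simp: Basis_vec_def)
  with b show ?thesis using that[of i] by (simp flip: cart_eq_inner_axis)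
qed

text \<open>
  The maximum of the coordinates is controlled by a high moment: its 2k-th power is at most the
  sum of the 2k-th powers, whose expectation is at most \<open>d (2 k / d)\<^sup>k\<close>. For k close to \<open>ln d\<close> the factor d
  is absorbed by \<open>e\<^sup>k\<close>, so the squared maximum is of order \<open>s = 2 e k / d\<close>.
\<close>
lemma kappa_le_p1:
  assumes "0 \<le> c"
  shows "kappa TYPE('n::finite) c 1 \<le> 25 * c * ln_dim TYPE('n) / CARD('n)"
proof -
  interpret prob_space "unif_sphere :: (real ^ 'n) measure" by (rule prob_space_unif_sphere)
  define l where "l = ln_dim TYPE('n)"
  define d where "d = real CARD('n)"
  define k where "k = nat \<lceil>l\<rceil> + 1"
  define s where "s = 2 * exp 1 * k / d"
  have d: "1 \<le> d" by (simp add: d_def Suc_leI)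
  have l: "1 \<le> l" "ln d \<le> l" by (auto simp: l_def ln_dim_def d_def)
  have k: "l \<le> k" "k \<le> l + 2" "2 \<le> k"
    using l unfolding k_def by linarith+
  have s: "0 < s" using d k by (simp add: s_def)
  have dk: "d * (2 * real k / d) ^ k \<le> s ^ k"
  proof -
    have "d = exp (ln d)" using d by simp
    also have "\<dots> \<le> exp (real k * 1)" using l k by simp
    also have "\<dots> = exp 1 ^ k" by (rule exp_of_nat_mult)
    finally have "d * (2 * real k / d) ^ k \<le> exp 1 ^ k * (2 * real k / d) ^ k"
      using d by (intro mult_right_mono) auto
    also have "\<dots> = s ^ k" by (simp add: s_def mult_ac flip: power_mult_distrib)
    finally show ?thesis .
  qed
  have int: "integrable unif_sphere (\<lambda>e :: real ^ 'n. (e $ i) ^ (2 * k))" for i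
  proof (rule unif_sphere_integrable_bounded[where B = 1])
    fix e :: "real ^ 'n" assume "norm e = 1"
    then have "\<bar>e $ i\<bar> ^ (2 * k) \<le> 1" using component_le_norm_cart[of e i] by (intro power_le_one) auto
    then show "norm ((e $ i) ^ (2 * k)) \<le> 1" by (simp add: power_abs)
  qed simp
  have pw: "infnorm e ^ 4 \<le> s\<^sup>2 + s\<^sup>2 / s ^ k * (\<Sum>i\<in>UNIV. (e $ i) ^ (2 * k))" for e :: "real ^ 'n"
  proof -
    define y where "y = (infnorm e)\<^sup>2"
    have y0: "0 \<le> y" by (simp add: y_def)
    obtain i where i: "infnorm e = \<bar>e $ i\<bar>" by (rule infnorm_attained)
    have "y ^ k = (e $ i) ^ (2 * k)" by (simp add: y_def i power_mult)
    also have "\<dots> \<le> (\<Sum>i\<in>UNIV. (e $ i) ^ (2 * k))"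
      by (rule member_le_sum) (auto simp: power_mult)
    finally have yk: "y ^ k \<le> (\<Sum>i\<in>UNIV. (e $ i) ^ (2 * k))" .
    \<comment> \<open>One of the two terms suffices, according to whether y is below or above the threshold s.\<close>
    have "y\<^sup>2 \<le> s\<^sup>2 + s\<^sup>2 / s ^ k * y ^ k"
    proof (cases "y \<le> s")
      case True
      then have "y\<^sup>2 \<le> s\<^sup>2" using y0 by (intro power_mono)
      moreover have "0 \<le> s\<^sup>2 / s ^ k * y ^ k" using s y0 by simp
      ultimately show ?thesis by linarith
    next
      case False
      have "s ^ (k - 2) \<le> y ^ (k - 2)" using False s by (intro power_mono) auto
      then have "y\<^sup>2 * s ^ (k - 2) \<le> y\<^sup>2 * y ^ (k - 2)" by (intro mult_left_mono) auto
      also have "\<dots> = y ^ (2 + (k - 2))" by (rule power_add[symmetric])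
      also have "2 + (k - 2) = k" using k by simp
      finally have "s\<^sup>2 * (y\<^sup>2 * s ^ (k - 2)) \<le> s\<^sup>2 * y ^ k" by (intro mult_left_mono) auto
      moreover have "s\<^sup>2 * s ^ (k - 2) = s ^ k" 
        using power_add[of s 2 "k - 2", symmetric] k(3) by (simp only: le_add_diff_inverse)
      ultimately have "y\<^sup>2 * s ^ k \<le> s\<^sup>2 * y ^ k" by (metis mult.left_commute)
      then have "y\<^sup>2 \<le> s\<^sup>2 / s ^ k * y ^ k" using s by (simp add: field_simps)
      then show ?thesis by (simp add: add_increasing)
    qed
    also have "\<dots> \<le> s\<^sup>2 + s\<^sup>2 / s ^ k * (\<Sum>i\<in>UNIV. (e $ i) ^ (2 * k))"
      using s yk by (intro add_left_mono mult_left_mono) auto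
    finally show ?thesis by (simp add: y_def flip: power_mult)
  qed
  have "(\<integral>e. lp_norm (conj_exponent 1) e ^ 4 \<partial>(unif_sphere :: (real ^ 'n) measure))
      \<le> (\<integral>e. s\<^sup>2 + s\<^sup>2 / s ^ k * (\<Sum>i\<in>UNIV. (e $ i) ^ (2 * k)) \<partial>(unif_sphere :: (real ^ 'n) measure))"
    by (intro integral_mono integrable_lp_norm_sphere Bochner_Integration.integrable_add integrable_mult_right Bochner_Integration.integrable_sum int)
       (use pw in \<open>auto simp: conj_exponent_def lp_norm_def\<close>)
  also have "\<dots> = s\<^sup>2 + s\<^sup>2 / s ^ k * (\<Sum>i\<in>UNIV. \<integral>e. (e $ i) ^ (2 * k) \<partial>(unif_sphere :: (real ^ 'n) measure))"
    using int prob_space by (simp add: integrable_sum)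
  also have "\<dots> \<le> s\<^sup>2 + s\<^sup>2 / s ^ k * (\<Sum>i\<in>(UNIV :: 'n set). (2 * real k / d) ^ k)"
    using s by (intro add_left_mono mult_left_mono sum_mono) (auto simp: d_def intro: sphere_moment_le)
  also have "(\<Sum>i\<in>(UNIV :: 'n set). (2 * real k / d) ^ k) = d * (2 * real k / d) ^ k" by (simp add: d_def)
  also have "s\<^sup>2 + s\<^sup>2 / s ^ k * (d * (2 * real k / d) ^ k) \<le> s\<^sup>2 + s\<^sup>2 / s ^ k * s ^ k"
    using s dk by (intro add_left_mono mult_left_mono) auto
  also have "\<dots> = 2 * s\<^sup>2" using s by simp
  also have "\<dots> \<le> (3 / 2 * s)\<^sup>2" by (simp add: power_mult_distrib power2_eq_square)
  finally have "sqrt (\<integral>e. lp_norm (conj_exponent 1) e ^ 4 \<partial>(unif_sphere :: (real ^ 'n) measure)) \<le> 3 / 2 * s"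
    using s by (intro real_le_lsqrt) auto
  also have "\<dots> \<le> 25 * l / d"
  proof -
    have "exp 1 * real k \<le> 272 / 100 * (3 * l)"
      using e_less_272 k l by (intro mult_mono) auto
    moreover have "3 / 2 * (2 * exp 1 * real k) = 3 * (exp 1 * real k)" by simp
    ultimately have "3 / 2 * (2 * exp 1 * real k) \<le> 25 * l" using l by linarith
    then have "3 / 2 * (2 * exp 1 * real k) / d \<le> 25 * l / d" using d by (intro divide_right_mono) auto
    then show ?thesis by (simp add: s_def)
  qed
  finally have "c * sqrt (\<integral>e. lp_norm (conj_exponent 1) e ^ 4 \<partial>(unif_sphere :: (real ^ 'n) measure)) \<le> c * (25 * l / d)"
    using assms by (intro mult_left_mono)
  then show ?thesis by (simp add: kappa_def l_def d_def mult_ac)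
qed

section \<open>Regularity of the smoothed objective\<close>

text \<open>
  The inf-convolution of f with \<open>L * dist\<close> (McShane's extension). The objective is constrained only
  on the enlargement of Q, which need not be Borel and may be the only place where f is measurable.
  Replacing f by an extension settles all measurability questions and leaves every quantity of the
  scheme unchanged.
\<close>
lemma lipschitz_extension_UNIV:
  fixes f :: "'a::metric_space \<Rightarrow> real"
  assumes f: "L-lipschitz_on X f"
  obtains g where "L-lipschitz_on UNIV g" "\<And>x. x \<in> X \<Longrightarrow> g x = f x"
proof (cases "X = {}")
  case True
  then show ?thesis using that[of "\<lambda>_. 0"] lipschitz_on_nonneg[OF f] by (simp add: lipschitz_on_def)
next
  case False
  have L: "0 \<le> L" using f by (rule lipschitz_on_nonneg)
  define g where "g = (\<lambda>x. INF y\<in>X. f y + L * dist x y)"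
  have lower: "f z - L * dist x z \<le> f y + L * dist x y" if "y \<in> X" "z \<in> X" for x y z
  proof -
    have "\<bar>f z - f y\<bar> \<le> L * dist z y" using lipschitz_onD[OF f that(2,1)] by (simp add: dist_real_def)
    also have "\<dots> \<le> L * (dist x z + dist x y)" using L by (intro mult_left_mono dist_triangle3)
    finally show ?thesis by (simp add: algebra_simps)
  qed
  have bdd: "bdd_below ((\<lambda>y. f y + L * dist x y) ` X)" for x
  proof -
    obtain z where "z \<in> X" using False by blast
    then show ?thesis using lower[of _ z x] by (intro bdd_belowI2[where m = "f z - L * dist x z"])
  qed
  have ext: "g x = f x" if "x \<in> X" for x
  proof (rule antisym)
    show "g x \<le> f x" unfolding g_def using cINF_lower[OF bdd that, of x] by simp
    show "f x \<le> g x" unfolding g_def using lower[OF _ that, of _ x] False by (intro cINF_greatest) auto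
  qed
  have le: "g x \<le> g x' + L * dist x x'" for x x'
  proof -
    have "g x - L * dist x x' \<le> f y + L * dist x' y" if "y \<in> X" for y
    proof -
      have "g x \<le> f y + L * dist x y" unfolding g_def by (rule cINF_lower[OF bdd that])
      also have "\<dots> \<le> f y + L * (dist x x' + dist x' y)"
        using L by (intro add_left_mono mult_left_mono dist_triangle)
      finally show ?thesis by (simp add: algebra_simps)
    qed
    then have "g x - L * dist x x' \<le> g x'"
      unfolding g_def[of ] using False by (intro cINF_greatest) auto
    then show ?thesis by simp
  qed
  have "L-lipschitz_on UNIV g"
  proof (rule lipschitz_onI[OF _ L])
    show "dist (g x) (g y) \<le> L * dist x y" for x y
      using le[of x y] le[of y x] by (simp add: dist_real_def dist_commute abs_le_iff)
  qed
  with ext show ?thesis using that by blast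
qed

lemma sphere_abs_moment_le:
  fixes v :: "real ^ 'n::finite"
  shows "(\<integral>e. \<bar>e \<bullet> v\<bar> \<partial>unif_sphere) \<le> norm v / sqrt CARD('n)"
proof -
  interpret prob_space "unif_sphere :: (real ^ 'n) measure" by (rule prob_space_unif_sphere)
  have b: "\<bar>e \<bullet> v\<bar> \<le> norm v" if "norm e = 1" for e using Cauchy_Schwarz_ineq2[of e v] that by simp
  have i1: "integrable unif_sphere (\<lambda>e :: real ^ 'n. \<bar>e \<bullet> v\<bar>)"
    by (rule unif_sphere_integrable_bounded[where B = "norm v"]) (use b in auto)
  have i2: "integrable unif_sphere (\<lambda>e :: real ^ 'n. \<bar>e \<bullet> v\<bar>\<^sup>2)"
  proof (rule unif_sphere_integrable_bounded[where B = "(norm v)\<^sup>2"])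
    show "norm (\<bar>e \<bullet> v\<bar>\<^sup>2) \<le> (norm v)\<^sup>2" if "norm e = 1" for e
      using power_mono[OF b[OF that] abs_ge_zero, of 2] by simp
  qed simp
  have "(\<integral>e. \<bar>e \<bullet> v\<bar> \<partial>unif_sphere)\<^sup>2 \<le> (\<integral>e. \<bar>e \<bullet> v\<bar>\<^sup>2 \<partial>unif_sphere)"
    using variance_eq[OF i1 i2] variance_positive[of "\<lambda>e. \<bar>e \<bullet> v\<bar>"] by simp
  also have "\<dots> = (norm v / sqrt CARD('n))\<^sup>2"
    by (simp add: sphere_second_moment power_divide)
  finally show ?thesis by (rule power2_le_imp_le) simp
qed

text \<open>
  The gradient of the smoothed objective; the one-sided form of the two-point estimate, which has
  the same mean because the sphere is symmetric.
\<close>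
definition sphere_gradient :: "(real ^ 'n::finite \<Rightarrow> real) \<Rightarrow> real \<Rightarrow> real ^ 'n \<Rightarrow> real ^ 'n" where
  "sphere_gradient f \<gamma> x = (real CARD('n) / \<gamma>) *\<^sub>R (\<integral>e. f (x + \<gamma> *\<^sub>R e) *\<^sub>R e \<partial>unif_sphere)"

lemma integrable_sphere_average:
  fixes f :: "real ^ 'n::finite \<Rightarrow> real"
  assumes fc: "continuous_on UNIV f"
  shows "integrable unif_sphere (\<lambda>e. f (x + r *\<^sub>R e) *\<^sub>R e)"
proof -
  have [measurable]: "f \<in> borel_measurable borel" by (rule borel_measurable_continuous_onI[OF fc])
  obtain B where B: "\<And>u. u \<in> cball x \<bar>r\<bar> \<Longrightarrow> \<bar>f u\<bar> \<le> B" using continuous_bounded_cball[OF fc] by blast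
  show ?thesis
    by (rule unif_sphere_integrable_bounded[where B = B]) (use B in \<open>auto simp: dist_norm\<close>)
qed

text \<open>
  The factor \<open>sqrt d\<close> instead of d: testing the difference D of the gradients against itself leaves
  the average of \<open>\<bar>e \<bullet> D\<bar>\<close>, and a random direction has an inner product of order \<open>\<parallel>D\<parallel> / sqrt d\<close> with any
  fixed vector. The bound is in the Euclidean norm, which dominates the q-norm.
\<close>
lemma norm_sphere_gradient_diff_le:
  fixes f :: "real ^ 'n::finite \<Rightarrow> real"
  assumes fc: "continuous_on UNIV f" and "0 < \<gamma>"
    and K: "\<And>e. norm e = 1 \<Longrightarrow> \<bar>f (y + \<gamma> *\<^sub>R e) - f (x + \<gamma> *\<^sub>R e)\<bar> \<le> K"
  shows "norm (sphere_gradient f \<gamma> y - sphere_gradient f \<gamma> x) \<le> sqrt CARD('n) * K / \<gamma>"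
proof -
  interpret prob_space "unif_sphere :: (real ^ 'n) measure" by (rule prob_space_unif_sphere)
  let ?d = "real CARD('n)"
  define D where "D = sphere_gradient f \<gamma> y - sphere_gradient f \<gamma> x"
  let ?h = "\<lambda>e. f (y + \<gamma> *\<^sub>R e) *\<^sub>R e - f (x + \<gamma> *\<^sub>R e) *\<^sub>R e"
  have K0: "0 \<le> K" using K[of "axis undefined 1"] by (simp add: norm_axis_1)
  have ih: "integrable unif_sphere ?h"
    by (intro Bochner_Integration.integrable_diff integrable_sphere_average fc)
  have D: "D = (?d / \<gamma>) *\<^sub>R (\<integral>e. ?h e \<partial>unif_sphere)"
    unfolding D_def sphere_gradient_def
    by (subst Bochner_Integration.integral_diff) (auto intro: integrable_sphere_average fc simp: scaleR_diff_right)
  have "(norm D)\<^sup>2 = D \<bullet> D" by (simp add: dot_square_norm)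
  also have "\<dots> = (?d / \<gamma>) * (\<integral>e. ?h e \<bullet> D \<partial>unif_sphere)"
    using integral_inner_left[of D unif_sphere ?h] ih by (subst D) simp
  also have "(\<integral>e. ?h e \<bullet> D \<partial>unif_sphere) \<le> (\<integral>e. K * \<bar>e \<bullet> D\<bar> \<partial>unif_sphere)"
  proof (rule integral_mono)
    show "integrable unif_sphere (\<lambda>e. ?h e \<bullet> D)" using ih by simp
    show "integrable unif_sphere (\<lambda>e :: real ^ 'n. K * \<bar>e \<bullet> D\<bar>)"
    proof (intro integrable_mult_right unif_sphere_integrable_bounded[where B = "norm D"])
      show "norm \<bar>e \<bullet> D\<bar> \<le> norm D" if "norm e = 1" for e using Cauchy_Schwarz_ineq2[of e D] that by simp
    qed simp
    fix e :: "real ^ 'n" assume "e \<in> space unif_sphere"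
    then have "\<bar>f (y + \<gamma> *\<^sub>R e) - f (x + \<gamma> *\<^sub>R e)\<bar> * \<bar>e \<bullet> D\<bar> \<le> K * \<bar>e \<bullet> D\<bar>"
      using K by (intro mult_right_mono) auto
    moreover have "?h e \<bullet> D = (f (y + \<gamma> *\<^sub>R e) - f (x + \<gamma> *\<^sub>R e)) * (e \<bullet> D)"
      by (simp flip: scaleR_diff_left)
    ultimately show "?h e \<bullet> D \<le> K * \<bar>e \<bullet> D\<bar>"
      using abs_ge_self[of "?h e \<bullet> D"] by (simp add: abs_mult)
  qed
  also have "\<dots> \<le> K * (norm D / sqrt ?d)"
    using mult_left_mono[OF sphere_abs_moment_le[of D] K0] by simp
  finally have "(norm D)\<^sup>2 \<le> (?d / \<gamma>) * (K * (norm D / sqrt ?d))"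
    using assms(2) by (simp add: divide_right_mono mult_left_mono)
  also have "\<dots> = (?d / sqrt ?d) * K / \<gamma> * norm D" by (simp add: mult_ac)
  also have "?d / sqrt ?d = sqrt ?d" by (rule real_div_sqrt) simp
  finally have "norm D * norm D \<le> (sqrt ?d * K / \<gamma>) * norm D" by (simp add: power2_eq_square)
  then have "norm D \<le> sqrt ?d * K / \<gamma>"
  proof (cases "D = 0")
    case False
    then show ?thesis using \<open>norm D * norm D \<le> _\<close> by (intro mult_right_le_imp_le[of "norm D" "norm D"]) auto
  qed (use K0 assms(2) in simp)
  then show ?thesis unfolding D_def .
qed

lemma enlargement_add: "x \<in> Q \<Longrightarrow> norm u \<le> \<gamma> \<Longrightarrow> x + u \<in> enlargement Q \<gamma>"
  by (auto simp: enlargement_def)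

lemma smoothed_cong_enlargement:
  assumes "x \<in> Q" "\<And>z. z \<in> enlargement Q \<gamma> \<Longrightarrow> f z = g z"
  shows "smoothed f \<gamma> x = smoothed g \<gamma> x"
  unfolding smoothed_def
  by (rule Bochner_Integration.integral_cong) (use assms in \<open>auto simp: enlargement_add\<close>)

lemma integrable_unif_ball_lipschitz:
  fixes f :: "real ^ 'n::finite \<Rightarrow> real"
  assumes f: "L-lipschitz_on (enlargement Q \<gamma>) f" and "0 < \<gamma>" "x \<in> Q"
  shows "integrable (unif_ball \<gamma>) (\<lambda>u. f (x + u))"
proof -
  obtain g where g: "L-lipschitz_on UNIV g" "\<And>x. x \<in> enlargement Q \<gamma> \<Longrightarrow> g x = f x"
    using lipschitz_extension_UNIV[OF f] by blast
  have gc: "continuous_on UNIV g" by (rule lipschitz_on_continuous_on[OF g(1)])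
  have [measurable]: "g \<in> borel_measurable borel" by (rule borel_measurable_continuous_onI[OF gc])
  obtain B where B: "\<And>u. u \<in> cball x \<gamma> \<Longrightarrow> \<bar>g u\<bar> \<le> B" using continuous_bounded_cball[OF gc] by blast
  have "integrable (unif_ball \<gamma>) (\<lambda>u. g (x + u))"
    by (rule unif_ball_integrable_bounded[where B = B]) (use B assms in \<open>auto simp: dist_norm\<close>)
  moreover have "integrable (unif_ball \<gamma>) (\<lambda>u. g (x + u)) \<longleftrightarrow> integrable (unif_ball \<gamma>) (\<lambda>u. f (x + u))"
    by (rule Bochner_Integration.integrable_cong[OF refl]) (use g(2) assms in \<open>auto simp: enlargement_add\<close>)
  ultimately show ?thesis by simp
qed

lemma smoothed_convex:
  fixes f :: "real ^ 'n::finite \<Rightarrow> real"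
  assumes f: "L-lipschitz_on (enlargement Q \<gamma>) f" and "0 < \<gamma>" "convex Q"
    and conv: "convex_on (enlargement Q \<gamma>) f"
  shows "convex_on Q (smoothed f \<gamma>)"
proof (rule convex_onI[OF _ assms(3)])
  fix t :: real and x y assume t: "0 < t" "t < 1" and xy: "x \<in> Q" "y \<in> Q"
  note int = integrable_unif_ball_lipschitz[OF f assms(2)]
  have z: "(1 - t) *\<^sub>R x + t *\<^sub>R y \<in> Q" using assms(3) t xy by (simp add: convexD_alt)
  have "smoothed f \<gamma> ((1 - t) *\<^sub>R x + t *\<^sub>R y) \<le> (\<integral>u. (1 - t) * f (x + u) + t * f (y + u) \<partial>unif_ball \<gamma>)"
    unfolding smoothed_def
  proof (rule integral_mono)
    show "integrable (unif_ball \<gamma>) (\<lambda>u. f ((1 - t) *\<^sub>R x + t *\<^sub>R y + u))" by (rule int[OF z])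
    show "integrable (unif_ball \<gamma>) (\<lambda>u. (1 - t) * f (x + u) + t * f (y + u))"
      using int[OF xy(1)] int[OF xy(2)] by simp
    fix u assume "u \<in> space (unif_ball \<gamma> :: (real ^ 'n) measure)"
    then have "x + u \<in> enlargement Q \<gamma>" "y + u \<in> enlargement Q \<gamma>" using xy by (auto intro: enlargement_add)
    then have "f ((1 - t) *\<^sub>R (x + u) + t *\<^sub>R (y + u)) \<le> (1 - t) * f (x + u) + t * f (y + u)"
      using t by (intro convex_onD[OF conv]) auto
    then show "f ((1 - t) *\<^sub>R x + t *\<^sub>R y + u) \<le> (1 - t) * f (x + u) + t * f (y + u)"
      by (simp add: algebra_simps)
  qed
  also have "\<dots> = (1 - t) * smoothed f \<gamma> x + t * smoothed f \<gamma> y"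
    unfolding smoothed_def using int[OF xy(1)] int[OF xy(2)] by simp
  finally show "smoothed f \<gamma> ((1 - t) *\<^sub>R x + t *\<^sub>R y) \<le> (1 - t) * smoothed f \<gamma> x + t * smoothed f \<gamma> y" .
qed

text \<open>
  The lower bound is Jensen's inequality for the symmetric pair \<open>x + u\<close>, \<open>x - u\<close>.
\<close>
lemma smoothed_bounds:
  fixes f :: "real ^ 'n::finite \<Rightarrow> real"
  assumes f: "L-lipschitz_on (enlargement Q \<gamma>) f" and g: "0 < \<gamma>" and x: "x \<in> Q"
    and conv: "convex_on (enlargement Q \<gamma>) f"
  shows "f x \<le> smoothed f \<gamma> x" "smoothed f \<gamma> x \<le> f x + L * \<gamma>"
proof -
  interpret prob_space "unif_ball \<gamma> :: (real ^ 'n) measure" by (rule prob_space_unif_ball) fact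
  note int = integrable_unif_ball_lipschitz[OF f g x]
  have L: "0 \<le> L" using f by (rule lipschitz_on_nonneg)
  obtain h where h: "L-lipschitz_on UNIV h" "\<And>x. x \<in> enlargement Q \<gamma> \<Longrightarrow> h x = f x"
    using lipschitz_extension_UNIV[OF f] by blast
  have hm[measurable]: "h \<in> borel_measurable borel"
    by (rule borel_measurable_continuous_onI[OF lipschitz_on_continuous_on[OF h(1)]])
  have xE: "x + u \<in> enlargement Q \<gamma>" "x - u \<in> enlargement Q \<gamma>" if "norm u \<le> \<gamma>" for u
    using enlargement_add[OF x that] enlargement_add[OF x, of "- u"] that by auto
  have x0: "x \<in> enlargement Q \<gamma>" using xE(1)[of 0] g by simp
  have sm: "smoothed f \<gamma> x = (\<integral>u. h (x + u) \<partial>unif_ball \<gamma>)"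
    unfolding smoothed_def by (rule Bochner_Integration.integral_cong) (use h(2) xE in auto)
  have sm': "smoothed f \<gamma> x = (\<integral>u. h (x - u) \<partial>unif_ball \<gamma>)"
    using integral_unif_ball_uminus[of "\<lambda>u. h (x + u)" \<gamma>] g sm by simp
  have ih: "integrable (unif_ball \<gamma>) (\<lambda>u. h (x + u))"
    using int Bochner_Integration.integrable_cong[of "unif_ball \<gamma>" "unif_ball \<gamma>" "\<lambda>u. h (x + u)" "\<lambda>u. f (x + u)"] h(2) xE by auto
  have ih': "integrable (unif_ball \<gamma>) (\<lambda>u. h (x - u))"
  proof -
    obtain B where B: "\<And>u. u \<in> cball x \<gamma> \<Longrightarrow> \<bar>h u\<bar> \<le> B"
      using continuous_bounded_cball[OF lipschitz_on_continuous_on[OF h(1)]] by blast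
    show ?thesis by (rule unif_ball_integrable_bounded[where B = B]) (use B g in \<open>auto simp: dist_norm\<close>)
  qed
  have "2 * f x = (\<integral>u. 2 * f x \<partial>(unif_ball \<gamma> :: (real ^ 'n) measure))" using prob_space by simp
  also have "\<dots> \<le> (\<integral>u. h (x + u) + h (x - u) \<partial>unif_ball \<gamma>)"
  proof (intro integral_mono Bochner_Integration.integrable_add ih ih')
    fix u assume "u \<in> space (unif_ball \<gamma> :: (real ^ 'n) measure)"
    then have u: "norm u \<le> \<gamma>" by simp
    have "f ((1 - 1 / 2) *\<^sub>R (x + u) + (1 / 2) *\<^sub>R (x - u)) \<le> (1 - 1 / 2) * f (x + u) + (1 / 2) * f (x - u)"
      using xE[OF u] by (intro convex_onD[OF conv]) auto
    moreover have "(1 - 1 / 2 :: real) *\<^sub>R (x + u) + (1 / 2) *\<^sub>R (x - u) = x"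
      by (simp add: algebra_simps flip: scaleR_add_left)
    ultimately show "2 * f x \<le> h (x + u) + h (x - u)" using h(2) xE[OF u] by simp
  qed simp
  also have "\<dots> = 2 * smoothed f \<gamma> x" using ih ih' sm sm' by simp
  finally show "f x \<le> smoothed f \<gamma> x" by simp
  have "smoothed f \<gamma> x \<le> (\<integral>u. f x + L * \<gamma> \<partial>(unif_ball \<gamma> :: (real ^ 'n) measure))"
    unfolding smoothed_def
  proof (intro integral_mono int)
    fix u assume "u \<in> space (unif_ball \<gamma> :: (real ^ 'n) measure)"
    then have u: "norm u \<le> \<gamma>" by simp
    have "\<bar>f (x + u) - f x\<bar> \<le> L * norm u"
      using lipschitz_onD[OF f xE(1)[OF u] x0] by (simp add: dist_norm)
    also have "\<dots> \<le> L * \<gamma>" using u L by (rule mult_left_mono)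
    finally show "f (x + u) \<le> f x + L * \<gamma>" by simp
  qed simp
  then show "smoothed f \<gamma> x \<le> f x + L * \<gamma>" using prob_space by simp
qed

text \<open>
  Increments of f under a translation by \<open>y - x\<close> are bounded by \<open>min M M2 * \<parallel>y - x\<parallel>\<^sub>p\<close>, as the Euclidean
  norm is at most the p-norm. The derivative is taken within Q, where the smoothed functions of f and of
  its extension h agree.
\<close>
lemma smoothed_smooth_convex_on:
  fixes f h :: "real ^ 'n::finite \<Rightarrow> real"
  assumes p: "1 \<le> p" "p \<le> 2" and g: "0 < \<gamma>" and Q: "convex Q" and M: "0 \<le> M" "0 \<le> M2"
    and conv: "convex_on (enlargement Q \<gamma>) f"
    and f_p: "\<And>x y. x \<in> enlargement Q \<gamma> \<Longrightarrow> y \<in> enlargement Q \<gamma> \<Longrightarrow> \<bar>f x - f y\<bar> \<le> M * lp_norm p (x - y)"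
    and f_2: "M2-lipschitz_on (enlargement Q \<gamma>) f"
    and h: "M2-lipschitz_on UNIV h" "\<And>z. z \<in> enlargement Q \<gamma> \<Longrightarrow> h z = f z"
  shows "smooth_convex_on p (sqrt CARD('n) * min M M2 / \<gamma>) Q (smoothed f \<gamma>) (sphere_gradient h \<gamma>)"
  unfolding smooth_convex_on_def
proof (intro conjI ballI)
  have hc: "continuous_on UNIV h" by (rule lipschitz_on_continuous_on[OF h(1)])
  show "convex_on Q (smoothed f \<gamma>)" by (rule smoothed_convex[OF f_2 g Q conv])
  fix x assume x: "x \<in> Q"
  have "(smoothed h \<gamma> has_derivative (\<lambda>k. sphere_gradient h \<gamma> x \<bullet> k)) (at x within Q)"
    unfolding sphere_gradient_def by (rule has_derivative_at_withinI[OF smoothed_has_derivative[OF h(1) g]])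
  then show "(smoothed f \<gamma> has_derivative (\<lambda>k. sphere_gradient h \<gamma> x \<bullet> k)) (at x within Q)"
    by (rule has_derivative_transform[OF x, rotated]) (rule smoothed_cong_enlargement, use h(2) in auto)
  fix y assume y: "y \<in> Q"
  let ?K = "min M M2 * lp_norm p (y - x)"
  have "\<bar>h (y + \<gamma> *\<^sub>R e) - h (x + \<gamma> *\<^sub>R e)\<bar> \<le> ?K" if e: "norm e = 1" for e
  proof -
    have E: "x + \<gamma> *\<^sub>R e \<in> enlargement Q \<gamma>" "y + \<gamma> *\<^sub>R e \<in> enlargement Q \<gamma>"
      using x y e g by (auto intro: enlargement_add)
    have 1: "\<bar>f (y + \<gamma> *\<^sub>R e) - f (x + \<gamma> *\<^sub>R e)\<bar> \<le> M * lp_norm p (y - x)"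
      using f_p[OF E(2,1)] by simp
    have "\<bar>f (y + \<gamma> *\<^sub>R e) - f (x + \<gamma> *\<^sub>R e)\<bar> \<le> M2 * norm (y - x)"
      using lipschitz_onD[OF f_2 E(2,1)] by (simp add: dist_norm)
    also have "\<dots> \<le> M2 * lp_norm p (y - x)" using M norm_le_lp_norm[OF p, of "y - x"] by (intro mult_left_mono)
    finally show ?thesis using 1 h(2) E by (simp add: min_def)
  qed
  from norm_sphere_gradient_diff_le[OF hc g this]
  have "norm (sphere_gradient h \<gamma> y - sphere_gradient h \<gamma> x) \<le> sqrt CARD('n) * ?K / \<gamma>" .
  with lp_norm_conj_le_norm[OF p, of "sphere_gradient h \<gamma> y - sphere_gradient h \<gamma> x"]
  show "lp_norm (conj_exponent p) (sphere_gradient h \<gamma> y - sphere_gradient h \<gamma> x)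
      \<le> sqrt CARD('n) * min M M2 / \<gamma> * lp_norm p (y - x)"
    by (simp add: mult_ac)
qed

section \<open>The two-point gradient estimate\<close>

lemma distr_pair_snd:
  assumes "prob_space M" "prob_space N"
  shows "distr (M \<Otimes>\<^sub>M N) N snd = N"
proof (rule measure_eqI)
  interpret M: prob_space M by fact
  interpret N: prob_space N by fact
  fix A assume "A \<in> sets (distr (M \<Otimes>\<^sub>M N) N snd)"
  then have A: "A \<in> sets N" by simp
  have "snd -` A \<inter> space (M \<Otimes>\<^sub>M N) = space M \<times> A"
    using sets.sets_into_space[OF A] by (auto simp: space_pair_measure)
  then show "emeasure (distr (M \<Otimes>\<^sub>M N) N snd) A = emeasure N A"
    using A by (simp add: emeasure_distr N.emeasure_pair_measure_Times M.emeasure_space_1)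
qed simp

lemma measurable_from_unif_sphere:
  "h \<in> measurable N unif_sphere \<Longrightarrow> h \<in> borel_measurable N"
  by (simp add: measurable_cong_sets[OF refl sets_unif_sphere] measurable_restrict_space2_iff)

lemma measurable_grad_estimate:
  fixes F :: "real ^ 'n::finite \<Rightarrow> 'o \<Rightarrow> real"
  assumes F: "case_prod F \<in> borel_measurable (restrict_space borel (enlargement Q \<gamma>) \<Otimes>\<^sub>M W)" and "0 \<le> \<gamma>"
  shows "case_prod (grad_estimate F \<gamma>) \<in> borel_measurable (restrict_space borel Q \<Otimes>\<^sub>M estimate_space W)"
proof -
  let ?N = "restrict_space borel Q \<Otimes>\<^sub>M (unif_sphere \<Otimes>\<^sub>M (W \<Otimes>\<^sub>M W))"
  have x: "fst \<in> borel_measurable ?N"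
    using measurable_fst[of "restrict_space borel Q" "unif_sphere \<Otimes>\<^sub>M (W \<Otimes>\<^sub>M W)"]
    unfolding measurable_restrict_space2_iff by (rule conjunct1)
  have e: "(\<lambda>\<omega>. fst (snd \<omega>)) \<in> borel_measurable ?N"
    by (intro measurable_from_unif_sphere) measurable
  have 1: "(\<lambda>\<omega>. (fst \<omega> + \<gamma> *\<^sub>R fst (snd \<omega>), fst (snd (snd \<omega>)))) \<in> measurable ?N (restrict_space borel (enlargement Q \<gamma>) \<Otimes>\<^sub>M W)"
  proof (intro measurable_Pair measurable_restrict_space2)
    show "(\<lambda>\<omega>. fst \<omega> + \<gamma> *\<^sub>R fst (snd \<omega>)) \<in> space ?N \<rightarrow> enlargement Q \<gamma>"
      using assms(2) by (auto simp: space_pair_measure space_restrict_space intro!: enlargement_add)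
    show "(\<lambda>\<omega>. fst \<omega> + \<gamma> *\<^sub>R fst (snd \<omega>)) \<in> borel_measurable ?N" using x e by measurable
  qed measurable
  have 2: "(\<lambda>\<omega>. (fst \<omega> - \<gamma> *\<^sub>R fst (snd \<omega>), snd (snd (snd \<omega>)))) \<in> measurable ?N (restrict_space borel (enlargement Q \<gamma>) \<Otimes>\<^sub>M W)"
  proof (intro measurable_Pair measurable_restrict_space2)
    have "y - \<gamma> *\<^sub>R e \<in> enlargement Q \<gamma>" if "y \<in> Q" "norm e = 1" for y e
      using enlargement_add[OF that(1), of "- (\<gamma> *\<^sub>R e)" \<gamma>] that(2) assms(2) by simp
    then show "(\<lambda>\<omega>. fst \<omega> - \<gamma> *\<^sub>R fst (snd \<omega>)) \<in> space ?N \<rightarrow> enlargement Q \<gamma>"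
      by (auto simp: space_pair_measure space_restrict_space)
    show "(\<lambda>\<omega>. fst \<omega> - \<gamma> *\<^sub>R fst (snd \<omega>)) \<in> borel_measurable ?N" using x e by measurable
  qed measurable
  have "(\<lambda>\<omega>. (real CARD('n) * ((F (fst \<omega> + \<gamma> *\<^sub>R fst (snd \<omega>)) (fst (snd (snd \<omega>)))
       - F (fst \<omega> - \<gamma> *\<^sub>R fst (snd \<omega>)) (snd (snd (snd \<omega>)))) / (2 * \<gamma>))) *\<^sub>R fst (snd \<omega>)) \<in> borel_measurable ?N"
    using measurable_compose[OF 1 F] measurable_compose[OF 2 F] e
    unfolding case_prod_conv
    by (intro borel_measurable_scaleR borel_measurable_times borel_measurable_divide borel_measurable_diff borel_measurable_const)
  moreover have "case_prod (grad_estimate F \<gamma>) = (\<lambda>\<omega>. (real CARD('n) * ((F (fst \<omega> + \<gamma> *\<^sub>R fst (snd \<omega>)) (fst (snd (snd \<omega>)))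
       - F (fst \<omega> - \<gamma> *\<^sub>R fst (snd \<omega>)) (snd (snd (snd \<omega>)))) / (2 * \<gamma>))) *\<^sub>R fst (snd \<omega>))"
    by (auto simp: grad_estimate_def)
  ultimately show ?thesis by (simp add: estimate_space_def)
qed

lemma prob_space_estimate_space: "prob_space W \<Longrightarrow> prob_space (estimate_space W)"
  unfolding estimate_space_def
  by (intro prob_space_pair prob_space_unif_sphere)

text \<open>
  A crude bound whose only purpose is integrability: without it, the second moment in the noise
  assumption could be the default value 0 of a divergent integral.
\<close>
lemma grad_estimate_bounded:
  fixes F :: "real ^ 'n::finite \<Rightarrow> 'o \<Rightarrow> real"
  assumes f: "L-lipschitz_on (enlargement Q \<gamma>) f" and orc: "zeroth_order_oracle (enlargement Q \<gamma>) f \<Delta> W F"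
    and g: "0 < \<gamma>" and x: "x \<in> Q" and \<eta>: "\<eta> \<in> space (estimate_space W)"
  shows "norm (grad_estimate F \<gamma> x \<eta>) \<le> real CARD('n) * ((2 * \<Delta> + 2 * L * \<gamma>) / (2 * \<gamma>))"
proof -
  obtain e a b where \<eta>': "\<eta> = (e, a, b)" by (cases \<eta>)
  have e: "norm e = 1" and a: "a \<in> space W" and b: "b \<in> space W"
    using \<eta> by (auto simp: \<eta>' estimate_space_def space_pair_measure)
  have E: "x + \<gamma> *\<^sub>R e \<in> enlargement Q \<gamma>" "x - \<gamma> *\<^sub>R e \<in> enlargement Q \<gamma>"
    using enlargement_add[OF x, of "\<gamma> *\<^sub>R e" \<gamma>] enlargement_add[OF x, of "- (\<gamma> *\<^sub>R e)" \<gamma>] e g by auto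
  have "\<bar>F (x + \<gamma> *\<^sub>R e) a - f (x + \<gamma> *\<^sub>R e)\<bar> \<le> \<Delta>" "\<bar>F (x - \<gamma> *\<^sub>R e) b - f (x - \<gamma> *\<^sub>R e)\<bar> \<le> \<Delta>"
    using orc E a b by (auto simp: zeroth_order_oracle_def)
  moreover have "\<bar>f (x + \<gamma> *\<^sub>R e) - f (x - \<gamma> *\<^sub>R e)\<bar> \<le> 2 * L * \<gamma>"
    using lipschitz_onD[OF f E] e g by (simp add: dist_norm mult_ac flip: scaleR_2)
  ultimately have "\<bar>F (x + \<gamma> *\<^sub>R e) a - F (x - \<gamma> *\<^sub>R e) b\<bar> \<le> 2 * \<Delta> + 2 * L * \<gamma>" by linarith
  then have "\<bar>F (x + \<gamma> *\<^sub>R e) a - F (x - \<gamma> *\<^sub>R e) b\<bar> / (2 * \<gamma>) \<le> (2 * \<Delta> + 2 * L * \<gamma>) / (2 * \<gamma>)"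
    using g by (intro divide_right_mono) auto
  then have "real CARD('n) * (\<bar>F (x + \<gamma> *\<^sub>R e) a - F (x - \<gamma> *\<^sub>R e) b\<bar> / (2 * \<gamma>))
      \<le> real CARD('n) * ((2 * \<Delta> + 2 * L * \<gamma>) / (2 * \<gamma>))"
    by (rule mult_left_mono) simp
  moreover have "norm (grad_estimate F \<gamma> x \<eta>) = real CARD('n) * (\<bar>F (x + \<gamma> *\<^sub>R e) a - F (x - \<gamma> *\<^sub>R e) b\<bar> / (2 * \<gamma>))"
    using g e by (simp add: \<eta>' grad_estimate_def abs_mult)
  ultimately show ?thesis by simp
qed

text \<open>
  Fubini integrates out the noise of the two calls first, which leaves f itself; the reflection of
  the sphere then merges the two terms.
\<close>
lemma grad_estimate_unbiased:
  fixes F :: "real ^ 'n::finite \<Rightarrow> 'o \<Rightarrow> real"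
  assumes f: "L-lipschitz_on (enlargement Q \<gamma>) f" and orc: "zeroth_order_oracle (enlargement Q \<gamma>) f \<Delta> W F"
    and g: "0 < \<gamma>" and x: "x \<in> Q"
    and h: "continuous_on UNIV h" "\<And>z. z \<in> enlargement Q \<gamma> \<Longrightarrow> h z = f z"
  shows "integrable (estimate_space W) (grad_estimate F \<gamma> x)"
    and "(\<integral>\<eta>. grad_estimate F \<gamma> x \<eta> \<partial>estimate_space W) = sphere_gradient h \<gamma> x"
proof -
  have W: "prob_space W" and Fm: "case_prod F \<in> borel_measurable (restrict_space borel (enlargement Q \<gamma>) \<Otimes>\<^sub>M W)"
    using orc by (auto simp: zeroth_order_oracle_def)
  interpret W: prob_space W by (rule W)
  interpret WW: prob_space "W \<Otimes>\<^sub>M W" by (intro prob_space_pair W)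
  interpret S: prob_space "unif_sphere :: (real ^ 'n) measure" by (rule prob_space_unif_sphere)
  interpret P: pair_prob_space "unif_sphere :: (real ^ 'n) measure" "W \<Otimes>\<^sub>M W" ..
  interpret E: prob_space "estimate_space W :: ((real ^ 'n) \<times> 'o \<times> 'o) measure" by (rule prob_space_estimate_space[OF W])
  have "(\<lambda>\<eta>. grad_estimate F \<gamma> x \<eta>) \<in> borel_measurable (estimate_space W)"
    using measurable_Pair2[OF measurable_grad_estimate[OF Fm], of x] x g by (simp add: space_restrict_space)
  then show int: "integrable (estimate_space W) (grad_estimate F \<gamma> x)"
    using grad_estimate_bounded[OF f orc g x]
    by (intro E.integrable_const_bound[where B = "real CARD('n) * ((2 * \<Delta> + 2 * L * \<gamma>) / (2 * \<gamma>))"] AE_I2)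
  have calls: "integrable W (F y)" "(\<integral>\<xi>. F y \<xi> \<partial>W) = f y" if y: "y \<in> enlargement Q \<gamma>" for y
  proof -
    show "(\<integral>\<xi>. F y \<xi> \<partial>W) = f y" using orc y by (simp add: zeroth_order_oracle_def)
    have "F y \<in> borel_measurable W" using measurable_Pair2[OF Fm, of y] y by (simp add: space_restrict_space)
    moreover have "\<bar>F y \<xi>\<bar> \<le> \<bar>f y\<bar> + \<Delta>" if "\<xi> \<in> space W" for \<xi>
    proof -
      have "\<bar>F y \<xi> - f y\<bar> \<le> \<Delta>" using orc y that by (simp add: zeroth_order_oracle_def)
      then show ?thesis by linarith
    qed
    ultimately show "integrable W (F y)"
      by (intro W.integrable_const_bound[where B = "\<bar>f y\<bar> + \<Delta>"]) (auto intro!: AE_I2)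
  qed
  have inner: "(\<integral>\<zeta>. grad_estimate F \<gamma> x (e, \<zeta>) \<partial>(W \<Otimes>\<^sub>M W))
      = (real CARD('n) / (2 * \<gamma>)) *\<^sub>R (h (x + \<gamma> *\<^sub>R e) *\<^sub>R e - h (x - \<gamma> *\<^sub>R e) *\<^sub>R e)"
    if e: "norm e = 1" for e
  proof -
    have E: "x + \<gamma> *\<^sub>R e \<in> enlargement Q \<gamma>" "x - \<gamma> *\<^sub>R e \<in> enlargement Q \<gamma>"
      using enlargement_add[OF x, of "\<gamma> *\<^sub>R e" \<gamma>] enlargement_add[OF x, of "- (\<gamma> *\<^sub>R e)" \<gamma>] e g by auto
    have d1: "distr (W \<Otimes>\<^sub>M W) W fst = W" and d2: "distr (W \<Otimes>\<^sub>M W) W snd = W"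
      using W.distr_pair_fst[of W] distr_pair_snd[OF W W] by auto
    have i1: "integrable (W \<Otimes>\<^sub>M W) (\<lambda>\<zeta>. F (x + \<gamma> *\<^sub>R e) (fst \<zeta>))"
      using integrable_distr[of fst "W \<Otimes>\<^sub>M W" W "F (x + \<gamma> *\<^sub>R e)"] calls(1)[OF E(1)] d1 by simp
    have i2: "integrable (W \<Otimes>\<^sub>M W) (\<lambda>\<zeta>. F (x - \<gamma> *\<^sub>R e) (snd \<zeta>))"
      using integrable_distr[of snd "W \<Otimes>\<^sub>M W" W "F (x - \<gamma> *\<^sub>R e)"] calls(1)[OF E(2)] d2 by simp
    have v1: "(\<integral>\<zeta>. F (x + \<gamma> *\<^sub>R e) (fst \<zeta>) \<partial>(W \<Otimes>\<^sub>M W)) = h (x + \<gamma> *\<^sub>R e)"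
      using integral_distr[of fst "W \<Otimes>\<^sub>M W" W "F (x + \<gamma> *\<^sub>R e)"] calls[OF E(1)] d1 h(2)[OF E(1)] by simp
    have v2: "(\<integral>\<zeta>. F (x - \<gamma> *\<^sub>R e) (snd \<zeta>) \<partial>(W \<Otimes>\<^sub>M W)) = h (x - \<gamma> *\<^sub>R e)"
      using integral_distr[of snd "W \<Otimes>\<^sub>M W" W "F (x - \<gamma> *\<^sub>R e)"] calls[OF E(2)] d2 h(2)[OF E(2)] by simp
    have "(\<integral>\<zeta>. grad_estimate F \<gamma> x (e, \<zeta>) \<partial>(W \<Otimes>\<^sub>M W))
      = (\<integral>\<zeta>. ((real CARD('n) / (2 * \<gamma>)) * (F (x + \<gamma> *\<^sub>R e) (fst \<zeta>) - F (x - \<gamma> *\<^sub>R e) (snd \<zeta>))) *\<^sub>R e \<partial>(W \<Otimes>\<^sub>M W))"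
      by (rule Bochner_Integration.integral_cong) (auto simp: grad_estimate_def)
    also have "\<dots> = ((real CARD('n) / (2 * \<gamma>)) * (h (x + \<gamma> *\<^sub>R e) - h (x - \<gamma> *\<^sub>R e))) *\<^sub>R e"
      using i1 i2 v1 v2 by simp
    finally show ?thesis by (simp only: scaleR_scaleR flip: scaleR_diff_left)
  qed
  let ?I = "\<integral>e. h (x + \<gamma> *\<^sub>R e) *\<^sub>R e \<partial>(unif_sphere :: (real ^ 'n) measure)"
  have [measurable]: "h \<in> borel_measurable borel" by (rule borel_measurable_continuous_onI[OF h(1)])
  have minus: "(\<integral>e. h (x - \<gamma> *\<^sub>R e) *\<^sub>R e \<partial>(unif_sphere :: (real ^ 'n) measure)) = - ?I"
    using arg_cong[OF integral_unif_sphere_uminus[of "\<lambda>e. h (x + \<gamma> *\<^sub>R e) *\<^sub>R e"], of uminus] by simp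
  have iplus: "integrable unif_sphere (\<lambda>e. h (x + \<gamma> *\<^sub>R e) *\<^sub>R e)" and iminus: "integrable unif_sphere (\<lambda>e. h (x - \<gamma> *\<^sub>R e) *\<^sub>R e)"
    using integrable_sphere_average[OF h(1), of x \<gamma>] integrable_sphere_average[OF h(1), of x "- \<gamma>"] by auto
  have "(\<integral>\<eta>. grad_estimate F \<gamma> x \<eta> \<partial>estimate_space W)
      = (\<integral>e. \<integral>\<zeta>. grad_estimate F \<gamma> x (e, \<zeta>) \<partial>(W \<Otimes>\<^sub>M W) \<partial>unif_sphere)"
    using P.integral_fst'[of "grad_estimate F \<gamma> x"] int by (simp add: estimate_space_def)
  also have "\<dots> = (\<integral>e. (real CARD('n) / (2 * \<gamma>)) *\<^sub>R (h (x + \<gamma> *\<^sub>R e) *\<^sub>R e - h (x - \<gamma> *\<^sub>R e) *\<^sub>R e) \<partial>unif_sphere)"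
    by (rule Bochner_Integration.integral_cong) (auto simp: inner)
  also have "\<dots> = (real CARD('n) / (2 * \<gamma>)) *\<^sub>R (?I - (\<integral>e. h (x - \<gamma> *\<^sub>R e) *\<^sub>R e \<partial>unif_sphere))"
    by (simp only: integral_scaleR_right Bochner_Integration.integral_diff[OF iplus iminus])
  also have "\<dots> = (real CARD('n) / (2 * \<gamma>)) *\<^sub>R (2 *\<^sub>R ?I)"
    by (simp add: minus scaleR_2)
  also have "\<dots> = sphere_gradient h \<gamma> x" using g by (simp add: sphere_gradient_def)
  finally show "(\<integral>\<eta>. grad_estimate F \<gamma> x \<eta> \<partial>estimate_space W) = sphere_gradient h \<gamma> x" .
qed

lemma grad_estimate_stochastic_gradient:
  fixes F :: "real ^ 'n::finite \<Rightarrow> 'o \<Rightarrow> real"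
  assumes p: "1 \<le> p" "p \<le> 2"
    and f: "L-lipschitz_on (enlargement Q \<gamma>) f" and orc: "zeroth_order_oracle (enlargement Q \<gamma>) f \<Delta> W F"
    and g: "0 < \<gamma>"
    and h: "continuous_on UNIV h" "\<And>z. z \<in> enlargement Q \<gamma> \<Longrightarrow> h z = f z"
    and noise: "small_noise c p M2 \<gamma> Q W F" and c: "0 \<le> c"
  shows "stochastic_gradient p (sqrt (8 * kappa TYPE('n) c p * real CARD('n) * M2\<^sup>2)) Q
     (sphere_gradient h \<gamma>) (estimate_space W) (grad_estimate F \<gamma>)"
proof -
  have W: "prob_space W" and Fm: "case_prod F \<in> borel_measurable (restrict_space borel (enlargement Q \<gamma>) \<Otimes>\<^sub>M W)"
    using orc by (auto simp: zeroth_order_oracle_def)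
  have P: "prob_space (estimate_space W :: ((real ^ 'n) \<times> 'o \<times> 'o) measure)" by (rule prob_space_estimate_space[OF W])
  interpret E: prob_space "estimate_space W :: ((real ^ 'n) \<times> 'o \<times> 'o) measure" by (rule P)
  have k0: "0 \<le> kappa TYPE('n) c p" using c by (simp add: kappa_def lp_norm_nonneg)
  let ?N = "lp_norm (conj_exponent p) :: real ^ 'n \<Rightarrow> real"
  have var: "integrable (estimate_space W) (\<lambda>\<eta>. (?N (grad_estimate F \<gamma> x \<eta> - sphere_gradient h \<gamma> x))\<^sup>2) \<and>
      (\<integral>\<eta>. (?N (grad_estimate F \<gamma> x \<eta> - sphere_gradient h \<gamma> x))\<^sup>2 \<partial>estimate_space W)
        \<le> (sqrt (8 * kappa TYPE('n) c p * real CARD('n) * M2\<^sup>2))\<^sup>2" if x: "x \<in> Q" for x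
  proof -
    have u: "integrable (estimate_space W) (grad_estimate F \<gamma> x)"
      "(\<integral>\<eta>. grad_estimate F \<gamma> x \<eta> \<partial>estimate_space W) = sphere_gradient h \<gamma> x"
      by (rule grad_estimate_unbiased[OF f orc g x h], assumption)+
    let ?B = "real CARD('n) * ((2 * \<Delta> + 2 * L * \<gamma>) / (2 * \<gamma>))"
    have sq: "integrable (estimate_space W) (\<lambda>\<eta>. (?N (grad_estimate F \<gamma> x \<eta>))\<^sup>2)"
    proof (rule E.integrable_const_bound[where B = "?B\<^sup>2"])
      show "AE \<eta> in estimate_space W. norm ((?N (grad_estimate F \<gamma> x \<eta>))\<^sup>2) \<le> ?B\<^sup>2"
      proof (rule AE_I2)
        fix \<eta> :: "(real ^ 'n) \<times> 'o \<times> 'o" assume "\<eta> \<in> space (estimate_space W)"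
        from order_trans[OF lp_norm_conj_le_norm[OF p] grad_estimate_bounded[OF f orc g x this]]
        have "?N (grad_estimate F \<gamma> x \<eta>) \<le> ?B" .
        then have "(?N (grad_estimate F \<gamma> x \<eta>))\<^sup>2 \<le> ?B\<^sup>2" by (rule power_mono) (rule lp_norm_nonneg)
        then show "norm ((?N (grad_estimate F \<gamma> x \<eta>))\<^sup>2) \<le> ?B\<^sup>2" by simp
      qed
      have [measurable]: "grad_estimate F \<gamma> x \<in> borel_measurable (estimate_space W)" using u(1) by auto
      show "(\<lambda>\<eta>. (?N (grad_estimate F \<gamma> x \<eta>))\<^sup>2) \<in> borel_measurable (estimate_space W)" by measurable
    qed
    have "4 * (\<integral>\<eta>. (?N (grad_estimate F \<gamma> x \<eta>))\<^sup>2 \<partial>estimate_space W) \<le> 4 * (2 * kappa TYPE('n) c p * real CARD('n) * M2\<^sup>2)"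
      using noise x unfolding small_noise_def by (intro mult_left_mono) auto
    also have "\<dots> = (sqrt (8 * kappa TYPE('n) c p * real CARD('n) * M2\<^sup>2))\<^sup>2" using k0 by simp
    finally have le: "4 * (\<integral>\<eta>. (?N (grad_estimate F \<gamma> x \<eta>))\<^sup>2 \<partial>estimate_space W)
      \<le> (sqrt (8 * kappa TYPE('n) c p * real CARD('n) * M2\<^sup>2))\<^sup>2" .
    note v = lp_norm_conj_variance_le[OF P p(1) u(1) sq, unfolded u(2)]
    show ?thesis by (rule conjI[OF v(1) order_trans[OF v(2) le]])
  qed
  show ?thesis unfolding stochastic_gradient_def
    using P measurable_grad_estimate[OF Fm] g grad_estimate_unbiased[OF f orc g _ h] var by simp
qed

section \<open>Measurability of a run of the method\<close>

text \<open>
  The queries stay in Q, which is where the gradient oracle is known to be measurable.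
\<close>
lemma measurable_history:
  fixes m :: "('v::euclidean_space) batched_method"
  assumes m: "wf_method Q m" and G: "case_prod G \<in> borel_measurable (restrict_space borel Q \<Otimes>\<^sub>M D)"
  shows "(\<lambda>\<omega>. history m G \<omega> k) \<in> measurable (sample_space D) (PiM UNIV (\<lambda>_. borel))"
proof (induction k)
  case 0
  show ?case by (auto intro!: measurable_PiM_single')
next
  case (Suc k)
  have q: "(\<lambda>\<omega>. query m k (history m G \<omega> k)) \<in> measurable (sample_space D) (restrict_space borel Q)"
    using m by (intro measurable_restrict_space2 measurable_compose[OF Suc]) (auto simp: wf_method_def)
  have \<omega>: "(\<lambda>\<omega>. \<omega> (k, j)) \<in> measurable (sample_space D) D" for j
    unfolding sample_space_def by (rule measurable_component_singleton) simp
  have "(\<lambda>\<omega>. G (query m k (history m G \<omega> k)) (\<omega> (k, j))) \<in> borel_measurable (sample_space D)" for j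
    using measurable_compose[OF measurable_Pair[OF q \<omega>] G] by simp
  then have v: "(\<lambda>\<omega>. (1 / real (batch m k)) *\<^sub>R (\<Sum>j<batch m k. G (query m k (history m G \<omega> k)) (\<omega> (k, j))))
      \<in> borel_measurable (sample_space D)" (is "?v \<in> _")
    by (intro borel_measurable_scaleR borel_measurable_sum borel_measurable_const)
  have "(\<lambda>\<omega> i. (if i = k then ?v \<omega> else history m G \<omega> k i)) \<in> measurable (sample_space D) (PiM UNIV (\<lambda>_. borel))"
  proof (rule measurable_PiM_single')
    show "(\<lambda>\<omega>. if i = k then ?v \<omega> else history m G \<omega> k i) \<in> borel_measurable (sample_space D)" for i
      using v measurable_compose[OF Suc measurable_component_singleton[of i]] by (cases "i = k") simp_all
  qed auto
  moreover have "(\<lambda>\<omega>. history m G \<omega> (Suc k)) = (\<lambda>\<omega> i. (if i = k then ?v \<omega> else history m G \<omega> k i))"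
    by (auto simp: fun_eq_iff)
  ultimately show ?case by simp
qed

lemma measurable_run_method:
  assumes "wf_method Q m" "case_prod G \<in> borel_measurable (restrict_space borel Q \<Otimes>\<^sub>M D)"
  shows "run_method m G \<in> borel_measurable (sample_space D)"
  using measurable_compose[OF measurable_history[OF assms]] assms(1)
  unfolding run_method_def[abs_def] by (auto simp: wf_method_def)

lemma run_method_in: "wf_method Q m \<Longrightarrow> run_method m G \<omega> \<in> Q"
  by (simp add: wf_method_def run_method_def)

lemma prob_space_sample_space: "prob_space D \<Longrightarrow> prob_space (sample_space D)"
  unfolding sample_space_def by (rule prob_space_PiM)

section \<open>Counting iterations and oracle calls\<close>

lemma soft_mono:
  assumes "1 \<le> d" "0 \<le> h" "h \<le> h'"
  shows "soft a d h \<le> soft a d h'"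
  unfolding soft_def using assms by (intro mult_mono power_mono) auto

text \<open>
  A constant factor S can be pulled out of a soft-O bound at the price of a logarithm of S,
  because \<open>1 + S h \<le> S (1 + h)\<close> for \<open>S \<ge> 1\<close>.
\<close>
lemma soft_scale:
  assumes "1 \<le> d" "0 \<le> h" "1 \<le> S"
  shows "soft a d (S * h) \<le> S * (1 + ln S) ^ a * soft a d h"
proof -
  have "1 + S * h \<le> S * (1 + h)" using assms by (simp add: algebra_simps)
  moreover have "0 < 1 + S * h" using assms by (simp add: add_pos_nonneg)
  ultimately have "ln (1 + S * h) \<le> ln (S * (1 + h))" by (intro ln_mono) auto
  also have "\<dots> = ln S + ln (1 + h)" using assms by (intro ln_mult_pos) auto
  finally have "1 + ln (1 + S * h) \<le> 1 + ln S + ln (1 + h)" by simp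
  also have "\<dots> \<le> (1 + ln S) * (1 + ln (1 + h))"
    using assms by (simp add: algebra_simps)
  finally have "(1 + ln (1 + S * h)) ^ a \<le> (1 + ln S) ^ a * (1 + ln (1 + h)) ^ a"
    using assms by (simp add: power_mono add_nonneg_nonneg flip: power_mult_distrib)
  then have "S * h * (1 + ln d) ^ a * (1 + ln (1 + S * h)) ^ a
      \<le> S * h * (1 + ln d) ^ a * ((1 + ln S) ^ a * (1 + ln (1 + h)) ^ a)"
    using assms by (intro mult_left_mono) auto
  then show ?thesis by (simp add: soft_def mult_ac)
qed

lemma scale_const_ge_1:
  assumes "0 < CN" "0 < c" "0 < c0"
  shows "1 \<le> scale_const CN c c0"
proof -
  have "1 * 1 * 1 * 1 * 1 \<le> scale_const CN c c0"
    unfolding scale_const_def using assms by (intro mult_mono) auto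
  then show ?thesis by simp
qed

lemma oracle_calls_le:
  assumes "1 \<le> d" "0 < CN" "0 < CT" "0 < c" "0 < c0" "0 \<le> X" "0 \<le> Y"
    and "real (num_samples m) \<le> CT * soft a d X" "X \<le> scale_const CN c c0 * Y"
  shows "real (oracle_calls m) \<le> call_const CN CT a c c0 * soft a d Y"
proof -
  let ?S = "scale_const CN c c0"
  have "soft a d X \<le> soft a d (?S * Y)" using assms by (intro soft_mono)
  also have "\<dots> \<le> ?S * (1 + ln ?S) ^ a * soft a d Y"
    using assms by (intro soft_scale scale_const_ge_1)
  finally have "CT * soft a d X \<le> CT * (?S * (1 + ln ?S) ^ a * soft a d Y)"
    using assms by (intro mult_left_mono) auto
  with assms(8) show ?thesis by (simp add: oracle_calls_def call_const_def mult_ac)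
qed

text \<open>
  The number of samples is governed by the larger of the iteration count and the variance term, and
  both are compared with one common quantity Y. The constant 25 comes from the upper bound on kappa
  for \<open>p = 1\<close>.
\<close>
lemma workload_le:
  assumes "0 < CN" "0 < c" "0 < c0" "1 \<le> Y"
    and k: "k \<le> CN * max 1 (2 * N)" and N: "N \<le> (1 + 1 / c) * (1 + c0) * Y" and K: "K \<le> 25 * (1 + c) * Y"
  shows "max k (32 * K) \<le> scale_const CN c c0 * Y"
proof -
  let ?A = "(1 + 1 / c) * (1 + c0)"
  have A: "1 \<le> ?A"
    using mult_mono[of 1 "1 + 1 / c" 1 "1 + c0"] assms by simp
  have "max 1 (2 * N) \<le> 2 * (?A * Y)"
    using N mult_mono[of 1 ?A 1 Y] A assms(4) by auto
  then have "k \<le> CN * (2 * (?A * Y))" using k assms(1) by (meson mult_left_mono order_trans less_imp_le)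
  also have "\<dots> = (2 * CN) * ?A * Y" by simp
  also have "\<dots> \<le> (1000 * (1 + CN) * (1 + c)) * ?A * Y"
  proof (intro mult_right_mono)
    have "2 * CN * 1 \<le> (1000 * (1 + CN)) * (1 + c)" using assms by (intro mult_mono) auto
    then show "2 * CN \<le> 1000 * (1 + CN) * (1 + c)" by simp
  qed (use A assms in auto)
  finally have 1: "k \<le> scale_const CN c c0 * Y" by (simp add: scale_const_def mult_ac)
  have "32 * K \<le> (800 * (1 + c)) * Y" using mult_left_mono[OF K, of 32] by (simp add: algebra_simps)
  also have "\<dots> \<le> ((1000 * (1 + CN) * (1 + c)) * ?A) * Y"
  proof (rule mult_right_mono)
    have "(800 * 1 * (1 + c)) * 1 \<le> (1000 * (1 + CN) * (1 + c)) * ?A"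
      using A assms by (intro mult_mono mult_nonneg_nonneg) auto
    then show "800 * (1 + c) \<le> (1000 * (1 + CN) * (1 + c)) * ?A" by simp
  qed (use assms in auto)
  finally have 2: "32 * K \<le> scale_const CN c c0 * Y" by (simp add: scale_const_def mult_ac)
  from 1 2 show ?thesis by simp
qed

lemma powr_quarter_sq: "0 \<le> d \<Longrightarrow> (d powr (1 / 4))\<^sup>2 = sqrt d"
  by (simp add: powr_half_sqrt power2_eq_square flip: powr_add)

lemma iteration_count_eq:
  assumes "0 < \<epsilon>" "0 < M2" "0 \<le> L" "0 \<le> R" "0 \<le> d"
  shows "sqrt (sqrt d * L / (\<epsilon> / (2 * M2)) * R\<^sup>2 / (\<epsilon> / 2)) = 2 * (d powr (1 / 4) * sqrt (L * M2) * R / \<epsilon>)"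
proof (rule real_sqrt_unique)
  show "(2 * (d powr (1 / 4) * sqrt (L * M2) * R / \<epsilon>))\<^sup>2 = sqrt d * L / (\<epsilon> / (2 * M2)) * R\<^sup>2 / (\<epsilon> / 2)"
    using assms by (simp add: power_mult_distrib power_divide powr_quarter_sq) (simp add: power2_eq_square)
qed (use assms in auto)

text \<open>
  The accuracy condition, solved for \<open>sqrt M\<close> and inserted into the iteration bound: it is exactly
  what trades a factor \<open>sqrt M\<close> of the iteration bound for a second factor \<open>R / \<epsilon>\<close>.
\<close>
lemma iteration_bound_of_small_accuracy:
  assumes "0 < \<epsilon>" "0 < M" "0 < M2" "0 \<le> R" "0 \<le> D"
    and e: "\<epsilon> \<le> c0 * (k * M2 powr (3 / 2) * R / M powr (1 / 2))"
  shows "D * sqrt (M * M2) * R / \<epsilon> \<le> c0 * (D * k * M2\<^sup>2 * R\<^sup>2 / \<epsilon>\<^sup>2)"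
proof -
  define s t where "s = sqrt M" and "t = sqrt M2"
  have st: "0 < s" "0 < t" using assms by (auto simp: s_def t_def)
  have M: "M powr (1 / 2) = s" using assms by (simp add: s_def powr_half_sqrt)
  have "M2 powr (3 / 2) = M2 powr (1 + 1 / 2)" by simp
  also have "\<dots> = M2 * sqrt M2" using assms by (subst powr_add) (simp add: powr_half_sqrt)
  finally have M2: "M2 powr (3 / 2) = t ^ 3" using assms by (simp add: t_def power3_eq_cube)
  have "\<epsilon> * s \<le> c0 * (k * t ^ 3 * R)"
    using e st by (simp add: M M2 field_simps)
  then have "(\<epsilon> * s) * (D * t * R) \<le> (c0 * (k * t ^ 3 * R)) * (D * t * R)"
    using assms st by (intro mult_right_mono) auto
  also have "\<dots> = c0 * (D * k * t ^ 4 * R\<^sup>2)" by (simp add: power2_eq_square power3_eq_cube power4_eq_xxxx)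
  finally have "(\<epsilon> * s) * (D * t * R) / \<epsilon>\<^sup>2 \<le> c0 * (D * k * t ^ 4 * R\<^sup>2) / \<epsilon>\<^sup>2"
    by (rule divide_right_mono) simp
  moreover have "t ^ 4 = M2\<^sup>2" using assms power_mult[of t 2 2] by (simp add: t_def)
  moreover have "(\<epsilon> * s) * (D * t * R) / \<epsilon>\<^sup>2 = D * sqrt (M * M2) * R / \<epsilon>"
    using assms(1) by (simp add: s_def t_def real_sqrt_mult power2_eq_square)
  ultimately show ?thesis by simp
qed

text \<open>
  For a Lipschitz constant L at most M2 the square of the iteration bound involves M2 alone, as K
  does, and a number is at most the maximum of 1 and its square.
\<close>
lemma iteration_bound_le_sq:
  assumes "0 < \<epsilon>" "0 \<le> L" "L \<le> M2" "1 \<le> d" "0 \<le> R"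
  shows "d powr (1 / 4) * sqrt (L * M2) * R / \<epsilon> \<le> max 1 (sqrt d * M2\<^sup>2 * R\<^sup>2 / \<epsilon>\<^sup>2)"
proof -
  let ?N = "d powr (1 / 4) * sqrt (L * M2) * R / \<epsilon>"
  have "?N \<le> max 1 (?N\<^sup>2)"
  proof (cases "?N \<le> 1")
    case False
    then have "?N * 1 \<le> ?N * ?N" by (intro mult_left_mono) auto
    then show ?thesis by (simp add: power2_eq_square)
  qed simp
  also have "max 1 (?N\<^sup>2) \<le> max 1 (sqrt d * M2\<^sup>2 * R\<^sup>2 / \<epsilon>\<^sup>2)"
  proof (rule max.mono[OF order_refl])
    have "?N\<^sup>2 = sqrt d * (L * M2) * R\<^sup>2 / \<epsilon>\<^sup>2"
      using assms by (simp add: power_mult_distrib power_divide powr_quarter_sq)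
    also have "\<dots> \<le> sqrt d * (M2 * M2) * R\<^sup>2 / \<epsilon>\<^sup>2"
      using assms by (intro divide_right_mono mult_right_mono mult_left_mono) auto
    finally show "?N\<^sup>2 \<le> sqrt d * M2\<^sup>2 * R\<^sup>2 / \<epsilon>\<^sup>2" by (simp only: power2_eq_square[of M2])
  qed
  finally show ?thesis .
qed

section \<open>The smoothing scheme\<close>

theorem theorem2p4:
  fixes f :: "real ^ 'n::finite \<Rightarrow> real"
    and Q :: "(real ^ 'n) set"
    and x0 xstar :: "real ^ 'n"
    and W :: "'o measure"
    and F :: "real ^ 'n \<Rightarrow> 'o \<Rightarrow> real"
    and A :: "real ^ 'n \<Rightarrow> real \<Rightarrow> real \<Rightarrow> real \<Rightarrow> real \<Rightarrow> (real ^ 'n) batched_method"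
    and p \<epsilon> \<gamma> M M2 R \<Delta> CN CT cR c\<kappa> c0 :: real
    and a :: nat
  assumes "1 \<le> p" "p \<le> 2"
    and "convex Q" "x0 \<in> Q"
    and "0 < \<epsilon>" "0 < M" "0 < M2"
    and "0 < CN" "0 < CT" "0 < cR" "0 < c\<kappa>" "0 < c0"
    and \<gamma>: "\<gamma> = \<epsilon> / (2 * M2)"
    and f_convex: "convex_on (enlargement Q \<gamma>) f"
    and f_lipschitz_p:
      "\<And>x y. x \<in> enlargement Q \<gamma> \<Longrightarrow> y \<in> enlargement Q \<gamma> \<Longrightarrow> \<bar>f x - f y\<bar> \<le> M * lp_norm p (x - y)"
    and f_lipschitz_2: "M2-lipschitz_on (enlargement Q \<gamma>) f"
    and xstar_min: "xstar \<in> Q" "\<And>x. x \<in> Q \<Longrightarrow> f xstar \<le> f x"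
    and xstar_closest:
      "\<And>z. z \<in> Q \<Longrightarrow> (\<And>x. x \<in> Q \<Longrightarrow> f z \<le> f x) \<Longrightarrow> lp_norm p (x0 - xstar) \<le> lp_norm p (x0 - z)"
    and R: "R = cR * lp_norm p (x0 - xstar) * ln_dim TYPE('n)"
    and zo_oracle: "zeroth_order_oracle (enlargement Q \<gamma>) f \<Delta> W F"
    and noise: "small_noise c\<kappa> p M2 \<gamma> Q W F"
    and agm: "batched_agm TYPE((real ^ 'n) \<times> 'o \<times> 'o) CN CT cR a p Q A"
    and eps_p1: "p = 1 \<Longrightarrow>
      \<epsilon> \<le> c0 * (real CARD('n) powr (- 1 / 4) * M2 powr (3 / 2) * R / M powr (1 / 2))"
  shows
    "let m = smoothing_scheme A c\<kappa> p M M2 R \<gamma> \<epsilon> x0;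
         \<Omega> = sample_space (estimate_space W);
         xhat = run_method m (grad_estimate F \<gamma>);
         d = real CARD('n);
         N = iter_bound TYPE('n) M M2 R \<epsilon>;
         K = call_bound TYPE('n) c\<kappa> p M2 R \<epsilon>;
         C = call_const CN CT a c\<kappa> c0
     in xhat \<in> borel_measurable \<Omega> \<and>
        (\<forall>\<omega>\<in>space \<Omega>. xhat \<omega> \<in> Q) \<and>
        integrable \<Omega> (\<lambda>\<omega>. f (xhat \<omega>)) \<and>
        (\<integral>\<omega>. f (xhat \<omega>) \<partial>\<Omega>) - f xstar \<le> \<epsilon> \<and>
        real (iters m) \<le> 2 * CN * max 1 N \<and>
        real (oracle_calls m) \<le> C * soft a d (max 1 (max N K)) \<and>
        ((1 < p \<and> p < 4 / 3 \<longrightarrow>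
            \<epsilon> \<le> c0 * (kappa TYPE('n) c\<kappa> p * d powr (3 / 4) * M2 powr (3 / 2) * R / M powr (1 / 2))) \<longrightarrow>
          real (oracle_calls m) \<le> C * soft a d (max 1 K)) \<and>
        (p = 2 \<longrightarrow> real (oracle_calls m) \<le> C * soft a d (max 1 (d * M2\<^sup>2 * R\<^sup>2 / \<epsilon>\<^sup>2))) \<and>
        (p = 1 \<longrightarrow> real (oracle_calls m) \<le>
           C * soft a d (max 1 (ln_dim TYPE('n) * M2\<^sup>2 * R\<^sup>2 / \<epsilon>\<^sup>2)))"
proof -
  let ?d = "real CARD('n)"
  let ?\<kappa> = "kappa TYPE('n) c\<kappa> p"
  define m where "m = smoothing_scheme A c\<kappa> p M M2 R \<gamma> \<epsilon> x0"
  define \<Omega> where "\<Omega> = sample_space (estimate_space W :: ((real ^ 'n) \<times> 'o \<times> 'o) measure)"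
  define xhat where "xhat = run_method m (grad_estimate F \<gamma>)"
  define N where "N = iter_bound TYPE('n) M M2 R \<epsilon>"
  define K where "K = call_bound TYPE('n) c\<kappa> p M2 R \<epsilon>"
  define L where "L = sqrt ?d * min M M2 / \<gamma>"
  define \<sigma> where "\<sigma> = sqrt (8 * ?\<kappa> * ?d * M2\<^sup>2)"
  have pos: "0 < \<epsilon>" "0 < M" "0 < M2" "0 < CN" "0 < CT" "0 < cR" "0 < c\<kappa>" "0 < c0" by fact+
  have d1: "1 \<le> ?d" by (simp add: Suc_leI)
  have g0: "0 < \<gamma>" using pos by (simp add: \<gamma>)
  have L0: "0 < L" using pos d1 g0 by (simp add: L_def)
  have \<kappa>0: "0 \<le> ?\<kappa>" using pos by (intro kappa_nonneg) simp
  have \<sigma>0: "0 \<le> \<sigma>" using \<kappa>0 by (simp add: \<sigma>_def)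
  have ln1: "1 \<le> ln_dim TYPE('n)" by (simp add: ln_dim_def)
  have R0: "0 \<le> R" using pos ln1 by (simp add: R lp_norm_nonneg)
  have m: "m = A x0 L \<sigma> R (\<epsilon> / 2)" by (simp add: m_def smoothing_scheme_def L_def \<sigma>_def)
  have W: "prob_space W" using zo_oracle by (simp add: zeroth_order_oracle_def)
  obtain h where h: "M2-lipschitz_on UNIV h" "\<And>z. z \<in> enlargement Q \<gamma> \<Longrightarrow> h z = f z"
    using lipschitz_extension_UNIV[OF f_lipschitz_2] by blast
  have hc: "continuous_on UNIV h" by (rule lipschitz_on_continuous_on[OF h(1)])

  have smooth: "smooth_convex_on p L Q (smoothed f \<gamma>) (sphere_gradient h \<gamma>)"
    unfolding L_def using assms(1,2) g0 assms(3) pos f_convex f_lipschitz_p f_lipschitz_2 h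
    by (intro smoothed_smooth_convex_on) auto
  have stoch: "stochastic_gradient p \<sigma> Q (sphere_gradient h \<gamma>) (estimate_space W) (grad_estimate F \<gamma>)"
    unfolding \<sigma>_def using pos
    by (intro grad_estimate_stochastic_gradient[OF assms(1,2) f_lipschitz_2 zo_oracle g0 hc h(2) noise]) auto
  have "0 < \<epsilon> / 2" using pos by simp
  note guarantee = agm[unfolded batched_agm_def, rule_format, OF \<open>x0 \<in> Q\<close> L0 \<sigma>0 R0 this, folded m]
  have wf: "wf_method Q m" and iters: "real (iters m) \<le> CN * max 1 (sqrt (L * R\<^sup>2 / (\<epsilon> / 2)))"
    and samples: "real (num_samples m) \<le> CT * soft a ?d (max (real (iters m)) (\<sigma>\<^sup>2 * R\<^sup>2 / (\<epsilon> / 2)\<^sup>2))"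
    using guarantee by blast+
  have "integrable \<Omega> (\<lambda>\<omega>. smoothed f \<gamma> (xhat \<omega>)) \<and> (\<integral>\<omega>. smoothed f \<gamma> (xhat \<omega>) \<partial>\<Omega>) - smoothed f \<gamma> xstar \<le> \<epsilon> / 2"
    unfolding \<Omega>_def xhat_def using guarantee smooth stoch xstar_min(1) R by blast
  then have int_s: "integrable \<Omega> (\<lambda>\<omega>. smoothed f \<gamma> (xhat \<omega>))"
    and gap: "(\<integral>\<omega>. smoothed f \<gamma> (xhat \<omega>) \<partial>\<Omega>) - smoothed f \<gamma> xstar \<le> \<epsilon> / 2" by auto

  have meas: "xhat \<in> borel_measurable \<Omega>"
    unfolding xhat_def \<Omega>_def using stoch by (intro measurable_run_method[OF wf]) (simp add: stochastic_gradient_def)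
  have inQ: "xhat \<omega> \<in> Q" for \<omega> unfolding xhat_def by (rule run_method_in[OF wf])
  have fx: "f x = h x" if "x \<in> Q" for x
    using h(2)[of x] enlargement_add[OF that, of 0 \<gamma>] g0 by simp
  note sandwich = smoothed_bounds[OF f_lipschitz_2 g0 _ f_convex]
  \<comment> \<open>The smoothing error is one half of the accuracy, the error of the method is the other half.\<close>
  have half: "M2 * \<gamma> = \<epsilon> / 2" using pos by (simp add: \<gamma>)
  interpret \<Omega>: prob_space \<Omega>
    unfolding \<Omega>_def by (intro prob_space_sample_space prob_space_estimate_space W)
  have "(\<lambda>\<omega>. h (xhat \<omega>)) \<in> borel_measurable \<Omega>"
    by (rule measurable_compose[OF meas borel_measurable_continuous_onI[OF hc]])
  then have fmeas: "(\<lambda>\<omega>. f (xhat \<omega>)) \<in> borel_measurable \<Omega>" by (simp add: fx inQ)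
  have int_f: "integrable \<Omega> (\<lambda>\<omega>. f (xhat \<omega>))"
  proof -
    have "integrable \<Omega> (\<lambda>\<omega>. f (xhat \<omega>) - smoothed f \<gamma> (xhat \<omega>))"
    proof (rule \<Omega>.integrable_const_bound[where B = "\<epsilon> / 2"])
      show "AE \<omega> in \<Omega>. norm (f (xhat \<omega>) - smoothed f \<gamma> (xhat \<omega>)) \<le> \<epsilon> / 2"
      proof (rule AE_I2)
        show "norm (f (xhat \<omega>) - smoothed f \<gamma> (xhat \<omega>)) \<le> \<epsilon> / 2" for \<omega>
          using sandwich[OF inQ[of \<omega>]] half by simp
      qed
      show "(\<lambda>\<omega>. f (xhat \<omega>) - smoothed f \<gamma> (xhat \<omega>)) \<in> borel_measurable \<Omega>"
        using fmeas borel_measurable_integrable[OF int_s] by (rule borel_measurable_diff)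
    qed
    from Bochner_Integration.integrable_add[OF this int_s] show ?thesis by simp
  qed
  have "(\<integral>\<omega>. f (xhat \<omega>) \<partial>\<Omega>) \<le> (\<integral>\<omega>. smoothed f \<gamma> (xhat \<omega>) \<partial>\<Omega>)"
    by (intro integral_mono int_f int_s sandwich(1) inQ)
  then have opt: "(\<integral>\<omega>. f (xhat \<omega>) \<partial>\<Omega>) - f xstar \<le> \<epsilon>"
    using gap sandwich(2)[OF xstar_min(1)] half by linarith

  \<comment> \<open>The iteration bound with the smaller Lipschitz constant that the scheme really uses.\<close>
  define N' where "N' = ?d powr (1 / 4) * sqrt (min M M2 * M2) * R / \<epsilon>"
  have N_eq: "N = ?d powr (1 / 4) * sqrt (M * M2) * R / \<epsilon>" by (simp add: N_def iter_bound_def)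
  have K_eq: "K = ?\<kappa> * ?d * M2\<^sup>2 * R\<^sup>2 / \<epsilon>\<^sup>2" by (simp add: K_def call_bound_def)
  define Z where "Z = M2\<^sup>2 * R\<^sup>2 / \<epsilon>\<^sup>2"
  have Z0: "0 \<le> Z" by (simp add: Z_def)
  have KZ: "K = ?\<kappa> * ?d * Z" by (simp add: K_eq Z_def)
  have N'N: "N' \<le> N"
    unfolding N'_def N_eq using pos R0
    by (intro divide_right_mono mult_right_mono mult_left_mono real_sqrt_le_mono) auto
  have "sqrt (L * R\<^sup>2 / (\<epsilon> / 2)) = 2 * N'"
    using iteration_count_eq[of \<epsilon> M2 "min M M2" R ?d] pos R0 by (simp add: L_def \<gamma> N'_def)
  with iters have iters': "real (iters m) \<le> CN * max 1 (2 * N')" by simp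
  have iters_le: "real (iters m) \<le> 2 * CN * max 1 N"
  proof -
    have "max 1 (2 * N') \<le> 2 * max 1 N" using N'N by auto
    then have "CN * max 1 (2 * N') \<le> CN * (2 * max 1 N)" using pos by (intro mult_left_mono) auto
    with iters' show ?thesis by simp
  qed
  have work: "\<sigma>\<^sup>2 * R\<^sup>2 / (\<epsilon> / 2)\<^sup>2 = 32 * K"
    using \<kappa>0 by (simp add: \<sigma>_def K_eq power_divide)
  have calls: "real (oracle_calls m) \<le> call_const CN CT a c\<kappa> c0 * soft a ?d Y"
    if Y: "1 \<le> Y" and N: "N' \<le> (1 + 1 / c\<kappa>) * (1 + c0) * Y" and K: "K \<le> 25 * (1 + c\<kappa>) * Y" for Y
  proof (rule oracle_calls_le[OF d1 pos(4,5,7,8)])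
    show "real (num_samples m) \<le> CT * soft a ?d (max (real (iters m)) (32 * K))"
      using samples by (simp add: work)
    show "max (real (iters m)) (32 * K) \<le> scale_const CN c\<kappa> c0 * Y"
      by (rule workload_le[OF pos(4,7,8) Y iters' N K])
  qed (use Y in auto)
  have A1: "1 \<le> (1 + 1 / c\<kappa>) * (1 + c0)" and A2: "1 + 1 / c\<kappa> \<le> (1 + 1 / c\<kappa>) * (1 + c0)"
    and A3: "c0 \<le> (1 + 1 / c\<kappa>) * (1 + c0)" and A4: "c0 / c\<kappa> \<le> (1 + 1 / c\<kappa>) * (1 + c0)"
    using pos divide_pos_pos[OF pos(8,7)] divide_pos_pos[OF zero_less_one pos(7)]
    by (simp_all add: algebra_simps add_divide_distrib)
  have B: "Y \<le> 25 * (1 + c\<kappa>) * Y" if "1 \<le> Y" for Y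
    using mult_right_mono[of 1 "25 * (1 + c\<kappa>)" Y] pos that by simp
  have scaleY: "c * Y \<le> (1 + 1 / c\<kappa>) * (1 + c0) * Y" if "c \<le> (1 + 1 / c\<kappa>) * (1 + c0)" "1 \<le> Y" for c Y
    using that by (intro mult_right_mono) auto

  have calls_max: "real (oracle_calls m) \<le> call_const CN CT a c\<kappa> c0 * soft a ?d (max 1 (max N K))"
  proof (rule calls)
    show "N' \<le> (1 + 1 / c\<kappa>) * (1 + c0) * max 1 (max N K)"
      using N'N scaleY[OF A1, of "max 1 (max N K)"] by simp
    show "K \<le> 25 * (1 + c\<kappa>) * max 1 (max N K)"
      using B[of "max 1 (max N K)"] by simp
  qed simp

  have small1: "N \<le> c0 * Z" if "p = 1"
  proof -
    have "N \<le> c0 * (?d powr (1 / 4) * ?d powr (- 1 / 4) * M2\<^sup>2 * R\<^sup>2 / \<epsilon>\<^sup>2)"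
      unfolding N_eq using eps_p1[OF that] pos R0 by (intro iteration_bound_of_small_accuracy) auto
    also have "?d powr (1 / 4) * ?d powr (- 1 / 4) = 1" by (simp flip: powr_add)
    finally show ?thesis by (simp add: Z_def)
  qed

  have N'_K: "N' \<le> (1 + 1 / c\<kappa>) * (1 + c0) * max 1 K"
    if mid: "1 < p \<and> p < 4 / 3 \<longrightarrow>
      \<epsilon> \<le> c0 * (?\<kappa> * ?d powr (3 / 4) * M2 powr (3 / 2) * R / M powr (1 / 2))"
  proof -
    consider "p = 1" | "1 < p" "p < 4 / 3" | "4 / 3 \<le> p" using assms(1) by linarith
    then show ?thesis
    proof cases
      case 1
      \<comment> \<open>Here \<open>\<kappa> * d\<close> is bounded below by a constant, so the accuracy condition gives a bound by K.\<close>
      have "c\<kappa> / ?d * ?d \<le> ?\<kappa> * ?d"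
        using kappa_ge_p1[of c\<kappa>, where 'n='n] pos by (intro mult_right_mono) (auto simp: 1)
      then have "c\<kappa> * Z \<le> K" using Z0 by (simp add: KZ mult_right_mono)
      then have "c0 / c\<kappa> * (c\<kappa> * Z) \<le> c0 / c\<kappa> * K" using pos by (intro mult_left_mono) auto
      then have "N' \<le> c0 / c\<kappa> * K" using small1[OF 1] N'N pos by simp
      also have "\<dots> \<le> c0 / c\<kappa> * max 1 K" using pos by (intro mult_left_mono) auto
      also have "\<dots> \<le> (1 + 1 / c\<kappa>) * (1 + c0) * max 1 K" by (rule scaleY[OF A4]) simp
      finally show ?thesis .
    next
      case 2
      have "N \<le> c0 * (?d powr (1 / 4) * (?\<kappa> * ?d powr (3 / 4)) * M2\<^sup>2 * R\<^sup>2 / \<epsilon>\<^sup>2)"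
        unfolding N_eq using mid 2 pos R0 by (intro iteration_bound_of_small_accuracy) auto
      also have "?d powr (1 / 4) * (?\<kappa> * ?d powr (3 / 4)) = ?\<kappa> * (?d powr (1 / 4) * ?d powr (3 / 4))" by simp
      also have "?d powr (1 / 4) * ?d powr (3 / 4) = ?d" by (simp flip: powr_add)
      finally have "N' \<le> c0 * K" using N'N by (simp add: K_eq)
      also have "\<dots> \<le> c0 * max 1 K" using pos by (intro mult_left_mono) auto
      also have "\<dots> \<le> (1 + 1 / c\<kappa>) * (1 + c0) * max 1 K" by (rule scaleY[OF A3]) simp
      finally show ?thesis .
    next
      case 3
      \<comment> \<open>Here \<open>\<kappa> * d\<close> is at least of order \<open>sqrt d\<close>, so K dominates the square of the iteration bound.\<close>
      have "c\<kappa> / sqrt ?d * ?d \<le> ?\<kappa> * ?d"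
        using kappa_ge_p_ge_4_3[OF 3 assms(2), of c\<kappa>, where 'n='n] pos by (intro mult_right_mono) auto
      moreover have "c\<kappa> / sqrt ?d * ?d = c\<kappa> * sqrt ?d" using real_div_sqrt[of ?d] by (simp flip: times_divide_eq_right)
      ultimately have "c\<kappa> * sqrt ?d * Z \<le> K" using Z0 by (simp only: KZ mult_right_mono)
      then have "sqrt ?d * Z \<le> (1 / c\<kappa>) * K" using pos by (simp add: field_simps)
      moreover have "(1 / c\<kappa>) * K \<le> (1 / c\<kappa>) * max 1 K" "0 \<le> (1 / c\<kappa>) * max 1 K"
        using pos by (auto intro!: divide_right_mono)
      moreover have "(1 + 1 / c\<kappa>) * max 1 K = max 1 K + (1 / c\<kappa>) * max 1 K"
        by (simp add: distrib_right)
      ultimately have "max 1 (sqrt ?d * Z) \<le> (1 + 1 / c\<kappa>) * max 1 K" by linarith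
      moreover have "N' \<le> max 1 (sqrt ?d * Z)"
        unfolding N'_def Z_def using iteration_bound_le_sq[of \<epsilon> "min M M2" M2 ?d R] pos R0 d1 by simp
      ultimately have "N' \<le> (1 + 1 / c\<kappa>) * max 1 K" by linarith
      also have "\<dots> \<le> (1 + 1 / c\<kappa>) * (1 + c0) * max 1 K" by (rule scaleY[OF A2]) simp
      finally show ?thesis .
    qed
  qed
  have calls_K: "real (oracle_calls m) \<le> call_const CN CT a c\<kappa> c0 * soft a ?d (max 1 K)"
    if "1 < p \<and> p < 4 / 3 \<longrightarrow>
      \<epsilon> \<le> c0 * (?\<kappa> * ?d powr (3 / 4) * M2 powr (3 / 2) * R / M powr (1 / 2))"
    using N'_K[OF that] B[of "max 1 K"] by (intro calls) auto

  have calls_2: "real (oracle_calls m) \<le> call_const CN CT a c\<kappa> c0 * soft a ?d (max 1 (?d * M2\<^sup>2 * R\<^sup>2 / \<epsilon>\<^sup>2))"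
    if p: "p = 2"
  proof -
    let ?Y = "max 1 (?d * Z)"
    have "K = c\<kappa> * (?d * Z)" by (simp add: KZ p kappa_2)
    also have "\<dots> \<le> c\<kappa> * ?Y" using pos by (intro mult_left_mono) auto
    also have "\<dots> \<le> 25 * (1 + c\<kappa>) * ?Y" using pos by (intro mult_right_mono) auto
    finally have K: "K \<le> 25 * (1 + c\<kappa>) * ?Y" .
    have "sqrt ?d * Z \<le> ?d * Z"
      using Z0 d1 real_sqrt_le_mono[of ?d "?d\<^sup>2"] by (intro mult_right_mono) (auto simp: power2_eq_square)
    then have "N' \<le> 1 * ?Y"
      unfolding N'_def using iteration_bound_le_sq[of \<epsilon> "min M M2" M2 ?d R] pos R0 d1 by (simp add: Z_def)
    also have "\<dots> \<le> (1 + 1 / c\<kappa>) * (1 + c0) * ?Y" by (rule scaleY[OF A1]) simp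
    finally have "real (oracle_calls m) \<le> call_const CN CT a c\<kappa> c0 * soft a ?d ?Y"
      using K by (intro calls) auto
    then show ?thesis by (simp add: Z_def mult.assoc)
  qed

  have calls_1: "real (oracle_calls m) \<le> call_const CN CT a c\<kappa> c0 * soft a ?d (max 1 (ln_dim TYPE('n) * M2\<^sup>2 * R\<^sup>2 / \<epsilon>\<^sup>2))"
    if p: "p = 1"
  proof -
    let ?l = "ln_dim TYPE('n)"
    let ?Y = "max 1 (?l * Z)"
    have "?\<kappa> * ?d \<le> (25 * c\<kappa> * ?l / ?d) * ?d"
      using kappa_le_p1[of c\<kappa>, where 'n='n] pos by (intro mult_right_mono) (auto simp: p)
    then have "K \<le> 25 * c\<kappa> * ?l * Z" using Z0 by (simp add: KZ mult_right_mono)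
    also have "\<dots> = 25 * c\<kappa> * (?l * Z)" by simp
    also have "\<dots> \<le> 25 * (1 + c\<kappa>) * ?Y" using pos Z0 ln1 by (intro mult_mono) auto
    finally have K: "K \<le> 25 * (1 + c\<kappa>) * ?Y" .
    have "1 * Z \<le> ?l * Z" using ln1 Z0 by (rule mult_right_mono)
    then have "c0 * Z \<le> c0 * ?Y" using pos by (intro mult_left_mono) auto
    then have "N' \<le> c0 * ?Y" using small1[OF p] N'N by linarith
    also have "\<dots> \<le> (1 + 1 / c\<kappa>) * (1 + c0) * ?Y" by (rule scaleY[OF A3]) simp
    finally have "real (oracle_calls m) \<le> call_const CN CT a c\<kappa> c0 * soft a ?d ?Y"
      using K by (intro calls) auto
    then show ?thesis by (simp add: Z_def mult.assoc)
  qed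
  show ?thesis
    unfolding Let_def m_def[symmetric] \<Omega>_def[symmetric] xhat_def[symmetric] N_def[symmetric] K_def[symmetric]
    using meas inQ int_f opt iters_le calls_max calls_K calls_2 calls_1 by blast
qed

end
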